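(* Let $M$ be a quaternionic manifold of real dimension $4n$. For all $k,r\ge 0$, the exterior derivative $d$ maps $C^\infty(M,E_{k,r})$ to $C^\infty(M,E_{k+1,r+1}\oplus E_{k+1,r-1})$.
   Context: A quaternionic manifold is, for $n\ge 2$, a real $4n$-manifold $M$ with an $\mathrm{Sp}(1)\mathrm{GL}(n,\mathbb{H})$-structure $Q$ admitting a torsion-free connection; here $\mathrm{Sp}(1)\mathrm{GL}(n,\mathbb{H})=\mathrm{Sp}(1)\times_{\mathbb{Z}_2}\mathrm{GL}(n,\mathbb{H})\subset \mathrm{GL}(4n,\mathbb{R})$ acts on $\mathbb{H}^n$, with $\mathrm{Sp}(1)$ the unit quaternions acting by left multiplication and $\mathrm{GL}(n,\mathbb{H})$ acting by right multiplication by quaternionic matrices. For $n=1$ a quaternionic manifold means a self-dual conformal 4-manifold (with the induced $\mathrm{Sp}(1)\mathrm{GL}(1,\mathbb{H})$-structure). The structure gives locally defined almost complex structures $I,J,K$ with $IJ=K$, well defined up to rotation. They act on $T^*M$ (with $IJ=K$ there too) and, extended by derivations, on $\Lambda^kT^*M$, giving an action of $\mathfrak{sp}(1)=\langle I,J,K\rangle$. The Casimir operator $I^2+J^2+K^2$ on $\Lambda^kT^*M$ is globally well defined. $E_{k,r}\subset\Lambda^kT^*M$ is the subbundle consisting of the $\mathrm{Sp}(1)$-representations with highest weight $r$ (copies of $V_r=S^r(\mathbb{C}^2)$); equivalently, the eigenbundle of $I^2+J^2+K^2$ on $\Lambda^kT^*M$ with eigenvalue $-r(r+2)$. It is zero unless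 $0\le r\le k$ and $r\equiv k\bmod 2$; also $E_{k,-1}=0$. One has $\Lambda^kT^*M=\bigoplus_{r=0}^kE_{k,r}$. *)

theory Defs
  imports "HOL-Analysis.Analysis" "HOL-Library.Function_Algebras"
begin

subsection \<open>Real-valued functions as a vector space\<close>

instantiation "fun" :: (type, real_vector) real_vector
begin

definition scaleR_fun_def: "scaleR a f = (\<lambda>x. a *\<^sub>R f x)"

instance
  by standard (simp_all add: scaleR_fun_def fun_eq_iff scaleR_add_right scaleR_add_left)

end

subsection \<open>Smooth maps on open subsets of Euclidean spaces\<close>

fun C_k_on :: "nat \<Rightarrow> ('a::euclidean_space) set \<Rightarrow> ('a \<Rightarrow> 'b::real_normed_vector) \<Rightarrow> bool" where
  "C_k_on 0 S f \<longleftrightarrow> continuous_on S f"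
| "C_k_on (Suc k) S f \<longleftrightarrow>
     (\<forall>x\<in>S. f differentiable (at x)) \<and>
     (\<forall>v. C_k_on k S (\<lambda>x. frechet_derivative f (at x) v))"

definition smooth_on :: "('a::euclidean_space) set \<Rightarrow> ('a \<Rightarrow> 'b::real_normed_vector) \<Rightarrow> bool" where
  "smooth_on S f \<longleftrightarrow> (\<forall>k. C_k_on k S f)"

subsection \<open>Quaternions and the group Sp(1)GL(n,H)\<close>

text \<open>A quaternion \<open>a + bi + cj + dk\<close> is the vector \<open>(a, b, c, d)\<close>, and \<open>H^n\<close> is
  \<^typ>\<open>(real^4)^'n\<close> with \<open>n = CARD('n)\<close>. The norm of \<^typ>\<open>real^4\<close> is the quaternionic norm.\<close>

type_synonym quat = "real^4"

definition qmult :: "quat \<Rightarrow> quat \<Rightarrow> quat" (infixl "\<star>" 70) where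
  "p \<star> q = vector
    [p$1 * q$1 - p$2 * q$2 - p$3 * q$3 - p$4 * q$4,
     p$1 * q$2 + p$2 * q$1 + p$3 * q$4 - p$4 * q$3,
     p$1 * q$3 - p$2 * q$4 + p$3 * q$1 + p$4 * q$2,
     p$1 * q$4 + p$2 * q$3 - p$3 * q$2 + p$4 * q$1]"

definition q1 :: quat where "q1 = axis 1 1"
definition qi :: quat where "qi = axis 2 1"
definition qj :: quat where "qj = axis 3 1"
definition qk :: quat where "qk = axis 4 1"

definition left_mult :: "quat \<Rightarrow> quat^'n \<Rightarrow> quat^'n" where
  "left_mult q v = (\<chi> a. q \<star> v$a)"

definition right_mult :: "quat^'n^'n \<Rightarrow> quat^'n \<Rightarrow> quat^'n" where
  "right_mult B v = (\<chi> b. \<Sum>a\<in>UNIV. v$a \<star> B$a$b)"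

definition qmat_mult :: "quat^'n^'n \<Rightarrow> quat^'n^'n \<Rightarrow> quat^'n^'n" where
  "qmat_mult B C = (\<chi> a b. \<Sum>c\<in>UNIV. B$a$c \<star> C$c$b)"

definition qmat_one :: "quat^'n^'n" where
  "qmat_one = (\<chi> a b. if a = b then q1 else 0)"

definition GL_H :: "(quat^'n^'n) set" where
  "GL_H = {B. \<exists>C. qmat_mult B C = qmat_one \<and> qmat_mult C B = qmat_one}"

definition Sp1GL :: "(quat^'n \<Rightarrow> quat^'n) set" where
  "Sp1GL = {left_mult q \<circ> right_mult B | q B. norm q = 1 \<and> B \<in> GL_H}"

text \<open>The Lie algebra \<open>sp(1) + gl(n,H)\<close>; \<open>sp(1)\<close> is the space of imaginary quaternions.\<close>

definition sp1gl :: "(quat^'n \<Rightarrow> quat^'n) set" where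
  "sp1gl = {\<lambda>v. left_mult p v + right_mult B v | p B. p$1 = 0}"

subsection \<open>Smooth manifolds of dimension 4n\<close>

text \<open>A chart is a pair of its domain and its coordinate map, with values in
  \<open>R^{4n}\<close>, written as \<^typ>\<open>quat^'n\<close>. A tensor-like object on the manifold is a family of local
  representatives indexed by a chart \<open>c\<close> and a point \<open>x\<close> of \<^term>\<open>cimage c\<close>, subject to
  the usual transformation law on overlaps; its values elsewhere are irrelevant. In the chart \<open>c\<close>,
  tangent spaces are identified with \<^typ>\<open>quat^'n\<close>.\<close>

type_synonym ('m, 'n) chart = "'m set \<times> ('m \<Rightarrow> quat^'n)"

definition cimage :: "('m, 'n) chart \<Rightarrow> (quat^'n) set" where
  "cimage c = snd c ` fst c"

definition overlap :: "('m, 'n) chart \<Rightarrow> ('m, 'n) chart \<Rightarrow> (quat^'n) set" where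
  "overlap c c' = snd c ` (fst c \<inter> fst c')"

definition trans_map :: "('m, 'n) chart \<Rightarrow> ('m, 'n) chart \<Rightarrow> quat^'n \<Rightarrow> quat^'n" where
  "trans_map c c' = snd c' \<circ> inv_into (fst c) (snd c)"

definition D_trans :: "('m, 'n::finite) chart \<Rightarrow> ('m, 'n) chart \<Rightarrow> quat^'n \<Rightarrow> quat^'n \<Rightarrow> quat^'n" where
  "D_trans c c' x = frechet_derivative (trans_map c c') (at x)"

definition smooth_manifold :: "'m topology \<Rightarrow> ('m, 'n::finite) chart set \<Rightarrow> bool" where
  "smooth_manifold X A \<longleftrightarrow>
     Hausdorff_space X \<and> second_countable X \<and>
     (\<Union>c\<in>A. fst c) = topspace X \<and>
     (\<forall>c\<in>A. openin X (fst c) \<and> open (cimage c) \<and>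
        homeomorphic_map (subtopology X (fst c)) (top_of_set (cimage c)) (snd c)) \<and>
     (\<forall>c\<in>A. \<forall>c'\<in>A. smooth_on (overlap c c') (trans_map c c'))"

subsection \<open>G-structures and connections\<close>

text \<open>An element of \<open>P c x\<close> is a frame, i.e. a linear isomorphism from \<open>H^n\<close> to the tangent space
  at the point with coordinates \<open>x\<close>.\<close>

type_synonym ('m, 'n) frames =
  "('m, 'n) chart \<Rightarrow> quat^'n \<Rightarrow> (quat^'n \<Rightarrow> quat^'n) set"

definition local_section ::
  "('m, 'n::finite) frames \<Rightarrow> ('m, 'n) chart \<Rightarrow> (quat^'n) set \<Rightarrow>
   (quat^'n \<Rightarrow> quat^'n \<Rightarrow> quat^'n) \<Rightarrow> bool" where
  "local_section P c V s \<longleftrightarrow>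
     open V \<and> V \<subseteq> cimage c \<and> (\<forall>y\<in>V. s y \<in> P c y) \<and> (\<forall>w. smooth_on V (\<lambda>y. s y w))"

definition Sp1GL_structure :: "('m, 'n::finite) chart set \<Rightarrow> ('m, 'n) frames \<Rightarrow> bool" where
  "Sp1GL_structure A P \<longleftrightarrow>
     (\<forall>c\<in>A. \<forall>x\<in>cimage c. \<forall>s\<in>P c x.
        linear s \<and> bij s \<and> P c x = {s \<circ> h | h. h \<in> Sp1GL}) \<and>
     (\<forall>c\<in>A. \<forall>x\<in>cimage c. \<exists>V s. x \<in> V \<and> local_section P c V s) \<and>
     (\<forall>c\<in>A. \<forall>c'\<in>A. \<forall>x\<in>overlap c c'.
        P c' (trans_map c c' x) = {D_trans c c' x \<circ> s | s. s \<in> P c x})"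

text \<open>\<open>\<Gamma> c x u v\<close> is the Christoffel term: in the chart \<open>c\<close>, the covariant derivative of a vector
  field \<open>Y\<close> in the direction \<open>u\<close> is \<open>DY(u) + \<Gamma>(u, Y)\<close>.\<close>

type_synonym ('m, 'n) christoffel =
  "('m, 'n) chart \<Rightarrow> quat^'n \<Rightarrow> quat^'n \<Rightarrow> quat^'n \<Rightarrow> quat^'n"

definition connection :: "('m, 'n::finite) chart set \<Rightarrow> ('m, 'n) christoffel \<Rightarrow> bool" where
  "connection A \<Gamma> \<longleftrightarrow>
     (\<forall>c\<in>A. \<forall>x\<in>cimage c. bilinear (\<Gamma> c x)) \<and>
     (\<forall>c\<in>A. \<forall>u v. smooth_on (cimage c) (\<lambda>x. \<Gamma> c x u v)) \<and>
     (\<forall>c\<in>A. \<forall>c'\<in>A. \<forall>x\<in>overlap c c'. \<forall>u v.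
        D_trans c c' x (\<Gamma> c x u v) =
          \<Gamma> c' (trans_map c c' x) (D_trans c c' x u) (D_trans c c' x v)
          + frechet_derivative (\<lambda>y. D_trans c c' y v) (at x) u)"

definition torsion_free :: "('m, 'n::finite) chart set \<Rightarrow> ('m, 'n) christoffel \<Rightarrow> bool" where
  "torsion_free A \<Gamma> \<longleftrightarrow> (\<forall>c\<in>A. \<forall>x\<in>cimage c. \<forall>u v. \<Gamma> c x u v = \<Gamma> c x v u)"

text \<open>The linear connection is induced by a connection on \<open>P\<close>: in every local frame \<open>s\<close> from \<open>P\<close>
  the connection form \<open>s\<^sup>-\<^sup>1 \<nabla>s\<close> takes values in the Lie algebra of the structure group.\<close>

definition connection_on :: "('m, 'n::finite) chart set \<Rightarrow> ('m, 'n) frames \<Rightarrow> ('m, 'n) christoffel \<Rightarrow> bool" where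
  "connection_on A P \<Gamma> \<longleftrightarrow> connection A \<Gamma> \<and>
     (\<forall>c\<in>A. \<forall>V s. local_section P c V s \<longrightarrow>
        (\<forall>y\<in>V. \<forall>u. (\<lambda>w. inv (s y) (frechet_derivative (\<lambda>z. s z w) (at y) u + \<Gamma> c y u (s y w)))
           \<in> sp1gl))"

subsection \<open>Self-dual conformal 4-manifolds\<close>

type_synonym ('m, 'n) metric = "('m, 'n) chart \<Rightarrow> quat^'n \<Rightarrow> quat^'n \<Rightarrow> quat^'n \<Rightarrow> real"

definition riemannian_metric :: "('m, 'n::finite) chart set \<Rightarrow> ('m, 'n) metric \<Rightarrow> bool" where
  "riemannian_metric A g \<longleftrightarrow>
     (\<forall>c\<in>A. \<forall>x\<in>cimage c. bilinear (g c x) \<and> (\<forall>u v. g c x u v = g c x v u) \<and>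
        (\<forall>u. u \<noteq> 0 \<longrightarrow> g c x u u > 0)) \<and>
     (\<forall>c\<in>A. \<forall>u v. smooth_on (cimage c) (\<lambda>x. g c x u v)) \<and>
     (\<forall>c\<in>A. \<forall>c'\<in>A. \<forall>x\<in>overlap c c'. \<forall>u v.
        g c x u v = g c' (trans_map c c' x) (D_trans c c' x u) (D_trans c c' x v))"

definition levi_civita :: "('m, 'n::finite) chart set \<Rightarrow> ('m, 'n) metric \<Rightarrow> ('m, 'n) christoffel \<Rightarrow> bool" where
  "levi_civita A g \<Gamma> \<longleftrightarrow> connection A \<Gamma> \<and> torsion_free A \<Gamma> \<and>
     (\<forall>c\<in>A. \<forall>x\<in>cimage c. \<forall>w u v.
        frechet_derivative (\<lambda>y. g c y u v) (at x) w = g c x (\<Gamma> c x w u) v + g c x u (\<Gamma> c x w v))"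

definition curvature :: "('m, 'n::finite) christoffel \<Rightarrow> ('m, 'n) chart \<Rightarrow>
    quat^'n \<Rightarrow> quat^'n \<Rightarrow> quat^'n \<Rightarrow> quat^'n \<Rightarrow> quat^'n" where
  "curvature \<Gamma> c x u v w =
     frechet_derivative (\<lambda>y. \<Gamma> c y v w) (at x) u - frechet_derivative (\<lambda>y. \<Gamma> c y u w) (at x) v
     + \<Gamma> c x u (\<Gamma> c x v w) - \<Gamma> c x v (\<Gamma> c x u w)"

definition endo_trace :: "('a::euclidean_space \<Rightarrow> 'a) \<Rightarrow> real" where
  "endo_trace f = (\<Sum>b\<in>Basis. f b \<bullet> b)"

definition ricci :: "('m, 'n::finite) christoffel \<Rightarrow> ('m, 'n) chart \<Rightarrow>
    quat^'n \<Rightarrow> quat^'n \<Rightarrow> quat^'n \<Rightarrow> real" where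
  "ricci \<Gamma> c x v w = endo_trace (\<lambda>u. curvature \<Gamma> c x u v w)"

definition scalar_curvature :: "('m, 'n::finite) metric \<Rightarrow> ('m, 'n) christoffel \<Rightarrow> ('m, 'n) chart \<Rightarrow>
    quat^'n \<Rightarrow> real" where
  "scalar_curvature g \<Gamma> c x =
     endo_trace (THE f. linear f \<and> (\<forall>u v. g c x (f u) v = ricci \<Gamma> c x u v))"

text \<open>The Weyl tensor in real dimension 4, with sign conventions such that
  \<open>g(R(u,v)w,z) = g(v,w)g(u,z) - g(u,w)g(v,z)\<close> on the unit sphere.\<close>

definition weyl4 :: "('m, 'n::finite) metric \<Rightarrow> ('m, 'n) christoffel \<Rightarrow> ('m, 'n) chart \<Rightarrow>
    quat^'n \<Rightarrow> quat^'n \<Rightarrow> quat^'n \<Rightarrow> quat^'n \<Rightarrow> quat^'n \<Rightarrow> real" where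
  "weyl4 g \<Gamma> c x u v w z =
     g c x (curvature \<Gamma> c x u v w) z
     - (g c x u z * ricci \<Gamma> c x v w - g c x u w * ricci \<Gamma> c x v z
        + g c x v w * ricci \<Gamma> c x u z - g c x v z * ricci \<Gamma> c x u w) / 2
     + scalar_curvature g \<Gamma> c x / 6 * (g c x u z * g c x v w - g c x u w * g c x v z)"

text \<open>For a positively oriented frame \<open>f1, f2, f3, f4\<close> of orthogonal vectors of equal length, the
  anti-self-dual bivectors are spanned by \<open>f1\<and>f2 - f3\<and>f4\<close>, \<open>f1\<and>f3 - f4\<and>f2\<close>, \<open>f1\<and>f4 - f2\<and>f3\<close>. The
  negative Weyl tensor vanishes iff the Weyl tensor vanishes on these.\<close>

definition weyl_minus_vanishes ::
  "(quat^'n \<Rightarrow> quat^'n \<Rightarrow> quat^'n \<Rightarrow> quat^'n \<Rightarrow> real) \<Rightarrow>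
   quat^'n \<Rightarrow> quat^'n \<Rightarrow> quat^'n \<Rightarrow> quat^'n \<Rightarrow> bool" where
  "weyl_minus_vanishes W f1 f2 f3 f4 \<longleftrightarrow> (\<forall>u v.
     W u v f1 f2 = W u v f3 f4 \<and> W u v f1 f3 = W u v f4 f2 \<and> W u v f1 f4 = W u v f2 f3)"

text \<open>Used for \<open>n = 1\<close>, where \<open>Sp(1)GL(1,H)\<close> is the group of orientation-preserving
  conformal linear maps of \<open>H\<close>, so that an \<open>Sp(1)GL(1,H)\<close>-structure consisting of conformal frames
  is the same as a conformal class with an orientation. The orientation is the one
  of Atiyah, Hitchin and Singer: the fundamental 2-forms of \<open>I, J, K\<close> are anti-self-dual, so the
  vanishing half of the Weyl tensor is the one acting on \<open>\<langle>I, J, K\<rangle>\<close>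
  (the one for which the twistor space is integrable). As these forms are
  self-dual for the orientation \<open>1, i, j, k\<close> of \<open>H\<close>, a frame of \<open>P\<close> takes \<open>1, i, k, j\<close> to a
  positively oriented basis.\<close>

definition self_dual_conformal ::
  "('m, 'n::finite) chart set \<Rightarrow> ('m, 'n) frames \<Rightarrow> bool" where
  "self_dual_conformal A P \<longleftrightarrow> (\<exists>g \<Gamma>.
     riemannian_metric A g \<and> levi_civita A g \<Gamma> \<and>
     (\<forall>c\<in>A. \<forall>x\<in>cimage c. \<forall>s\<in>P c x.
        (\<exists>l>0. \<forall>u v. g c x (s u) (s v) = l * (u \<bullet> v)) \<and>
        weyl_minus_vanishes (weyl4 g \<Gamma> c x)
          (s (\<chi> a. q1)) (s (\<chi> a. qi)) (s (\<chi> a. qk)) (s (\<chi> a. qj))))"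

subsection \<open>Quaternionic manifolds\<close>

definition quaternionic_manifold ::
  "'m topology \<Rightarrow> ('m, 'n::finite) chart set \<Rightarrow> ('m, 'n) frames \<Rightarrow> bool" where
  "quaternionic_manifold X A P \<longleftrightarrow>
     smooth_manifold X A \<and> Sp1GL_structure A P \<and>
     (if CARD('n) = 1 then self_dual_conformal A P
      else \<exists>\<Gamma>. connection_on A P \<Gamma> \<and> torsion_free A \<Gamma>)"

text \<open>The almost complex structures \<open>I, J, K\<close> determined by a frame \<open>s\<close> are
  \<open>acs s qi\<close>, \<open>acs s qj\<close>, \<open>acs s qk\<close>.\<close>

definition acs :: "(quat^'n \<Rightarrow> quat^'n) \<Rightarrow> quat \<Rightarrow> quat^'n \<Rightarrow> quat^'n" where
  "acs s q = s \<circ> left_mult q \<circ> inv s"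

subsection \<open>Differential forms\<close>

text \<open>A \<open>k\<close>-form on a vector space is a function on lists of vectors that vanishes
  on lists of length other than \<open>k\<close>.\<close>

definition alt_forms :: "nat \<Rightarrow> (('a::real_vector) list \<Rightarrow> real) set" where
  "alt_forms k = {\<alpha>.
     (\<forall>vs. length vs \<noteq> k \<longrightarrow> \<alpha> vs = 0) \<and>
     (\<forall>vs i. length vs = k \<and> i < k \<longrightarrow> linear (\<lambda>u. \<alpha> (vs[i := u]))) \<and>
     (\<forall>vs i j. length vs = k \<and> i < j \<and> j < k \<and> vs!i = vs!j \<longrightarrow> \<alpha> vs = 0)}"

type_synonym ('m, 'n) form = "('m, 'n) chart \<Rightarrow> quat^'n \<Rightarrow> (quat^'n) list \<Rightarrow> real"

definition diff_forms :: "('m, 'n::finite) chart set \<Rightarrow> nat \<Rightarrow> ('m, 'n) form set" where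
  "diff_forms A k = {\<alpha>.
     (\<forall>c\<in>A. \<forall>x\<in>cimage c. \<alpha> c x \<in> alt_forms k) \<and>
     (\<forall>c\<in>A. \<forall>vs. smooth_on (cimage c) (\<lambda>x. \<alpha> c x vs)) \<and>
     (\<forall>c\<in>A. \<forall>c'\<in>A. \<forall>x\<in>overlap c c'. \<forall>vs.
        \<alpha> c x vs = \<alpha> c' (trans_map c c' x) (map (D_trans c c' x) vs))}"

definition ext_deriv :: "('m, 'n::finite) form \<Rightarrow> ('m, 'n) form" where
  "ext_deriv \<alpha> c x vs = (\<Sum>i<length vs. (-1)^i *
     frechet_derivative (\<lambda>y. \<alpha> c y (take i vs @ drop (Suc i) vs)) (at x) (vs!i))"

subsection \<open>The bundles E(k,r)\<close>

text \<open>The extension by derivations of the dual action \<open>\<alpha> \<mapsto> -\<alpha> \<circ> S\<close> on covectors. The sign makes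
  \<open>IJ = K\<close> hold on covectors as well.\<close>

definition act :: "('a \<Rightarrow> 'a) \<Rightarrow> ('a list \<Rightarrow> real) \<Rightarrow> 'a list \<Rightarrow> real" where
  "act S \<alpha> vs = - (\<Sum>i<length vs. \<alpha> (vs[i := S (vs!i)]))"

definition invariant_subspace ::
  "(quat^'n \<Rightarrow> quat^'n) \<Rightarrow> nat \<Rightarrow> ((quat^'n) list \<Rightarrow> real) set \<Rightarrow> bool" where
  "invariant_subspace s k W \<longleftrightarrow> subspace W \<and> W \<subseteq> alt_forms k \<and>
     (\<forall>q\<in>{qi, qj, qk}. \<forall>\<alpha>\<in>W. act (acs s q) \<alpha> \<in> W)"

definition irreducible_subrep ::
  "(quat^'n \<Rightarrow> quat^'n) \<Rightarrow> nat \<Rightarrow> ((quat^'n) list \<Rightarrow> real) set \<Rightarrow> bool" where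
  "irreducible_subrep s k W \<longleftrightarrow> invariant_subspace s k W \<and> W \<noteq> {0} \<and>
     (\<forall>U. invariant_subspace s k U \<and> U \<subseteq> W \<longrightarrow> U = {0} \<or> U = W)"

text \<open>The weights of a real representation \<open>W\<close> are the integers \<open>m\<close> such that \<open>\<i>m\<close> is an eigenvalue
  of \<open>I\<close> on the complexification of \<open>W\<close>, equivalently such that \<open>-m\<^sup>2\<close> is an eigenvalue of \<open>I\<^sup>2\<close>
  on \<open>W\<close> itself. The complexification of an irreducible \<open>W\<close> of
  highest weight \<open>r\<close> is \<open>V_r\<close> for even \<open>r\<close> and \<open>2V_r\<close> for odd \<open>r\<close>.\<close>

definition is_weight ::
  "(quat^'n \<Rightarrow> quat^'n) \<Rightarrow> ((quat^'n) list \<Rightarrow> real) set \<Rightarrow> int \<Rightarrow> bool" where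
  "is_weight s W m \<longleftrightarrow>
     (\<exists>\<alpha>\<in>W. \<alpha> \<noteq> 0 \<and> act (acs s qi) (act (acs s qi) \<alpha>) = - ((of_int m)\<^sup>2 *\<^sub>R \<alpha>))"

definition highest_weight ::
  "(quat^'n \<Rightarrow> quat^'n) \<Rightarrow> ((quat^'n) list \<Rightarrow> real) set \<Rightarrow> int \<Rightarrow> bool" where
  "highest_weight s W r \<longleftrightarrow> is_weight s W r \<and> (\<forall>m. is_weight s W m \<longrightarrow> m \<le> r)"

text \<open>The fibre does not depend on the frame \<open>s\<close>, as another frame of \<open>P\<close> only rotates
  \<open>I, J, K\<close>. Highest weights are nonnegative, so \<open>E P k (-1) c x = {0}\<close>.\<close>

definition E :: "('m, 'n::finite) frames \<Rightarrow> nat \<Rightarrow> int \<Rightarrow> ('m, 'n) chart \<Rightarrow> quat^'n \<Rightarrow>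
    ((quat^'n) list \<Rightarrow> real) set" where
  "E P k r c x = span (\<Union>s\<in>P c x. \<Union>{W. irreducible_subrep s k W \<and> highest_weight s W r})"

definition fibre_sum :: "('b \<Rightarrow> 'c \<Rightarrow> ('v::plus) set) \<Rightarrow> ('b \<Rightarrow> 'c \<Rightarrow> 'v set) \<Rightarrow> 'b \<Rightarrow> 'c \<Rightarrow> 'v set"
    (infixl "\<oplus>" 65) where
  "(F \<oplus> G) c x = {\<alpha> + \<beta> | \<alpha> \<beta>. \<alpha> \<in> F c x \<and> \<beta> \<in> G c x}"

definition smooth_sections ::
  "('m, 'n::finite) chart set \<Rightarrow> nat \<Rightarrow>
   (('m, 'n) chart \<Rightarrow> quat^'n \<Rightarrow> ((quat^'n) list \<Rightarrow> real) set) \<Rightarrow> ('m, 'n) form set" where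
  "smooth_sections A k F = {\<alpha> \<in> diff_forms A k. \<forall>c\<in>A. \<forall>x\<in>cimage c. \<alpha> c x \<in> F c x}"

end

theory Submission
  imports Defs
begin

text \<open>
  The proof replaces highest weights by the Casimir operator \<open>C = I\<^sup>2 + J\<^sup>2 + K\<^sup>2\<close>: the fibre of
  \<open>E\<^sub>k\<^sub>,\<^sub>r\<close> is the eigenspace of \<open>C\<close> on \<open>k\<close>-forms for the eigenvalue \<open>-r(r + 2)\<close>
  (\<open>E_eq_casimir_eigenspace\<close>). This needs the representation theory of \<open>sp(1)\<close>: on an irreducible
  module of highest weight \<open>r\<close> the operator \<open>C\<close> is the scalar \<open>-r(r + 2)\<close>, and modules of forms are completely
  reducible, because \<open>I, J, K\<close> are skew for the inner product determined by a frame. It also needs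
  that \<open>C\<close> does not depend on the frame, which holds because a change of frame rotates \<open>I, J, K\<close>.

  Let \<open>\<nabla>\<close> be a torsion-free connection on the \<open>Sp(1)GL(n,H)\<close>-structure. For \<open>n \<ge> 2\<close> it is part of the
  definition; for \<open>n = 1\<close> the Levi-Civita connection of a metric in the conformal class serves, since
  \<open>co(4) = sp(1) + gl(1,H)\<close> (\<open>levi_civita_connection_on\<close>). As \<open>\<nabla>\<close> has no torsion, \<open>d\<alpha>\<close> is the image
  of \<open>\<nabla>\<alpha>\<close> under the wedge product \<open>T\<^sup>*M \<otimes> \<Lambda>\<^sup>k \<rightarrow> \<Lambda>\<^sup>k\<^sup>+\<^sup>1\<close> (\<open>ext_deriv_eq_alternation\<close>). As \<open>\<nabla>\<close>
  preserves the structure, \<open>\<nabla>\<^sub>u\<alpha>\<close> again lies in \<open>E\<^sub>k\<^sub>,\<^sub>r\<close> (\<open>covariant_derivative_casimir\<close>). Now \<open>T\<^sup>*M\<close> consists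
  of representations of highest weight \<open>1\<close>, so \<open>T\<^sup>*M \<otimes> E\<^sub>k\<^sub>,\<^sub>r\<close> has only the highest weights \<open>r + 1\<close> and
  \<open>r - 1\<close>, and the wedge product is equivariant. This Clebsch-Gordan decomposition is carried out with
  explicit projections (\<open>alternation_isotypic\<close>).

  That \<open>d\<alpha>\<close> is a differential form, that is, compatible with changes of charts, follows from the same formula,
  since both \<open>\<nabla>\<close> and the wedge product are natural (\<open>covariant_derivative_natural\<close>).
\<close>

section \<open>Multilinear forms and the derivation action\<close>

definition multilinear_forms :: "nat \<Rightarrow> (('a::real_vector) list \<Rightarrow> real) set" where
  "multilinear_forms k = {\<alpha>.
     (\<forall>vs. length vs \<noteq> k \<longrightarrow> \<alpha> vs = 0) \<and>
     (\<forall>vs i. length vs = k \<and> i < k \<longrightarrow> linear (\<lambda>u. \<alpha> (vs[i := u])))}"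

lemma alt_forms_multilinear: "\<alpha> \<in> alt_forms k \<Longrightarrow> \<alpha> \<in> multilinear_forms k"
  by (simp add: alt_forms_def multilinear_forms_def)

lemma multilinear_forms_slot:
  assumes "\<alpha> \<in> multilinear_forms k" "i < length vs"
  shows "linear (\<lambda>u. \<alpha> (vs[i := u]))"
proof (cases "length vs = k")
  case True
  then show ?thesis using assms by (auto simp: multilinear_forms_def)
next
  case False
  then have "(\<lambda>u. \<alpha> (vs[i := u])) = (\<lambda>u. 0)"
    using assms by (auto simp: multilinear_forms_def)
  then show ?thesis by (simp add: linear_zero)
qed

lemma multilinear_formsI:
  assumes "\<And>vs. length vs \<noteq> k \<Longrightarrow> \<alpha> vs = 0"
    and "\<And>vs i. length vs = k \<Longrightarrow> i < k \<Longrightarrow> linear (\<lambda>u. \<alpha> (vs[i := u]))"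
  shows "\<alpha> \<in> multilinear_forms k"
  using assms by (auto simp: multilinear_forms_def)

lemma alt_formsI:
  assumes "\<alpha> \<in> multilinear_forms k"
    and "\<And>vs i j. length vs = k \<Longrightarrow> i < j \<Longrightarrow> j < k \<Longrightarrow> vs!i = vs!j \<Longrightarrow> \<alpha> vs = 0"
  shows "\<alpha> \<in> alt_forms k"
  using assms by (auto simp: multilinear_forms_def alt_forms_def)

lemma alt_forms_length: "\<alpha> \<in> alt_forms k \<Longrightarrow> length vs \<noteq> k \<Longrightarrow> \<alpha> vs = 0"
  by (simp add: alt_forms_def)

lemma alt_forms_eq_0:
  "\<alpha> \<in> alt_forms k \<Longrightarrow> i < length vs \<Longrightarrow> j < length vs \<Longrightarrow> i \<noteq> j \<Longrightarrow> vs!i = vs!j \<Longrightarrow> \<alpha> vs = 0"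
proof (cases "length vs = k")
  case False
  then show ?thesis if "\<alpha> \<in> alt_forms k" using that by (simp add: alt_forms_length)
next
  case True
  assume *: "\<alpha> \<in> alt_forms k" "i < length vs" "j < length vs" "i \<noteq> j" "vs!i = vs!j"
  have "\<forall>vs i j. length vs = k \<and> i < j \<and> j < k \<and> vs!i = vs!j \<longrightarrow> \<alpha> vs = 0"
    using *(1) unfolding alt_forms_def mem_Collect_eq by (elim conjE)
  from this[rule_format, of vs i j] this[rule_format, of vs j i] show "\<alpha> vs = 0"
    using * True by (cases i j rule: linorder_cases) auto
qed

lemma subspace_multilinear_forms: "subspace (multilinear_forms k)"
  unfolding subspace_def
proof (intro conjI ballI allI)
  show "0 \<in> multilinear_forms k"
    by (rule multilinear_formsI) (simp_all add: linear_zero)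
next
  fix \<alpha> \<beta> :: "'a list \<Rightarrow> real"
  assume *: "\<alpha> \<in> multilinear_forms k" "\<beta> \<in> multilinear_forms k"
  then show "\<alpha> + \<beta> \<in> multilinear_forms k"
    by (intro multilinear_formsI)
      (simp_all add: linear_compose_add multilinear_forms_slot, simp add: multilinear_forms_def)
next
  fix \<alpha> :: "'a list \<Rightarrow> real" and c :: real
  assume *: "\<alpha> \<in> multilinear_forms k"
  then show "c *\<^sub>R \<alpha> \<in> multilinear_forms k"
    using linear_compose_scale_right[OF multilinear_forms_slot[OF *], of _ _ c]
    by (intro multilinear_formsI) (simp_all add: scaleR_fun_def, simp add: multilinear_forms_def)
qed

lemma subspace_alt_forms: "subspace (alt_forms k)"
proof -
  have eq: "alt_forms k = multilinear_forms k \<inter>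
    {\<alpha>. \<forall>vs i j. length vs = k \<and> i < j \<and> j < k \<and> vs!i = vs!j \<longrightarrow> \<alpha> vs = 0}"
    unfolding alt_forms_def multilinear_forms_def by auto
  show ?thesis
    unfolding eq
    by (intro subspace_inter subspace_multilinear_forms) (auto simp: subspace_def scaleR_fun_def)
qed

text \<open>Polarization of the alternating condition at \<open>a + b\<close>.\<close>

lemma alt_forms_antisym:
  assumes "\<alpha> \<in> alt_forms k" "i < length vs" "j < length vs" "i \<noteq> j"
  shows "\<alpha> (vs[i := a, j := b]) = - \<alpha> (vs[i := b, j := a])"
proof -
  define f where "f u v = \<alpha> (vs[i := u, j := v])" for u v
  note m = alt_forms_multilinear[OF assms(1)]
  have 1: "linear (f u)" for u
    unfolding f_def using multilinear_forms_slot[OF m, of j "vs[i := u]"] assms by simp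
  have 2: "linear (\<lambda>u. f u v)" for v
    unfolding f_def using multilinear_forms_slot[OF m, of i "vs[j := v]"] assms
    by (simp add: list_update_swap)
  have 3: "f u u = 0" for u
    unfolding f_def by (rule alt_forms_eq_0[OF assms(1), of i _ j]) (use assms in auto)
  have "f (a + b) (a + b) = f a a + f a b + f b a + f b b"
    using linear_add[OF 1] linear_add[OF 2] by simp
  then show ?thesis unfolding 3 by (simp add: f_def)
qed

lemma alt_forms_move:
  assumes "\<alpha> \<in> alt_forms k"
  shows "\<alpha> (xs @ a # ys @ zs) = (-1) ^ length ys * \<alpha> (xs @ ys @ a # zs)"
proof (induction ys arbitrary: xs)
  case (Cons y ys)
  have "\<alpha> (xs @ a # y # ys @ zs) = - \<alpha> (xs @ y # a # ys @ zs)"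
    using alt_forms_antisym[OF assms, of "length xs" "xs @ a # y # ys @ zs" "Suc (length xs)" a y]
    by (simp add: list_update_append nth_append)
  with Cons[of "xs @ [y]"] show ?case by simp
qed simp

lemma linear_act: "linear (act S)"
  by (rule linearI)
    (auto simp: act_def fun_eq_iff scaleR_fun_def sum.distrib sum_distrib_left)

lemmas act_add = linear_add[OF linear_act]
  and act_diff = linear_diff[OF linear_act]
  and act_scaleR = linear_scale[OF linear_act]

lemma act_multilinear:
  assumes S: "linear S" and \<alpha>: "\<alpha> \<in> multilinear_forms k"
  shows "act S \<alpha> \<in> multilinear_forms k"
proof (rule multilinear_formsI)
  show "act S \<alpha> vs = 0" if "length vs \<noteq> k" for vs
    using that \<alpha> by (simp add: act_def multilinear_forms_def)
  fix vs :: "'a list" and i assume l: "length vs = k" and i: "i < k"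
  have "linear (\<lambda>u. \<alpha> (vs[i := u, j := S (vs[i := u] ! j)]))" if j: "j < k" for j
  proof (cases "j = i")
    case True
    have "linear ((\<lambda>u. \<alpha> (vs[i := u])) \<circ> S)"
      by (rule linear_compose[OF S multilinear_forms_slot[OF \<alpha>]]) (simp add: l i)
    then show ?thesis using True l i by (simp add: comp_def)
  next
    case False
    have "linear (\<lambda>u. \<alpha> (vs[j := S (vs ! j), i := u]))"
      by (rule multilinear_forms_slot[OF \<alpha>]) (simp add: l i)
    then show ?thesis using False by (simp add: list_update_swap)
  qed
  then have "linear (\<lambda>u. - (\<Sum>j<k. \<alpha> (vs[i := u, j := S (vs[i := u] ! j)])))"
    by (intro linear_compose_neg linear_compose_sum) auto
  then show "linear (\<lambda>u. act S \<alpha> (vs[i := u]))" by (simp add: act_def l)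
qed

lemma act_alt_forms:
  assumes S: "linear S" and \<alpha>: "\<alpha> \<in> alt_forms k"
  shows "act S \<alpha> \<in> alt_forms k"
proof (rule alt_formsI[OF act_multilinear[OF S alt_forms_multilinear[OF \<alpha>]]])
  fix vs :: "'a list" and i j
  assume *: "length vs = k" "i < j" "j < k" "vs ! i = vs ! j"
  have z: "\<alpha> (vs[l := S (vs ! l)]) = 0" if "l \<noteq> i" "l \<noteq> j" for l
    by (rule alt_forms_eq_0[OF \<alpha>, of i _ j]) (use * that in auto)
  have "(\<Sum>l<k. \<alpha> (vs[l := S (vs ! l)])) = (\<Sum>l\<in>{i, j}. \<alpha> (vs[l := S (vs ! l)]))"
    by (rule sum.mono_neutral_right) (use * z in auto)
  also have "\<dots> = \<alpha> (vs[i := S (vs ! i)]) + \<alpha> (vs[j := S (vs ! j)])" using * by simp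
  also have "\<dots> = 0"
  proof -
    have "vs[i := S (vs ! i)] = vs[i := S (vs ! i), j := vs ! i]"
      using *(2-4) by (metis list_update_id nat_neq_iff nth_list_update_neq)
    moreover have "vs[j := S (vs ! j)] = vs[i := vs ! i, j := S (vs ! i)]"
      unfolding list_update_id by (simp only: *(4))
    ultimately show ?thesis
      using alt_forms_antisym[OF \<alpha>, of i vs j "S (vs ! i)" "vs ! i"] * by simp
  qed
  finally show "act S \<alpha> vs = 0" using * by (simp add: act_def)
qed

lemma act_plus_endo:
  assumes "\<alpha> \<in> multilinear_forms k"
  shows "act (\<lambda>v. S v + T v) \<alpha> = act S \<alpha> + act T \<alpha>"
  using linear_add[OF multilinear_forms_slot[OF assms]]
  by (auto simp: act_def fun_eq_iff sum.distrib)

lemma act_scale_endo: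
  assumes "\<alpha> \<in> multilinear_forms k"
  shows "act (\<lambda>v. c *\<^sub>R S v) \<alpha> = c *\<^sub>R act S \<alpha>"
  using linear_scale[OF multilinear_forms_slot[OF assms]]
  by (auto simp: act_def fun_eq_iff scaleR_fun_def sum_distrib_left)

text \<open>Both orders of composition contain the same sum over pairs of distinct slots, so only the terms in
  which \<open>S\<close> and \<open>T\<close> meet in one slot survive. Hence \<open>act\<close> is a representation of the Lie algebra of
  endomorphisms; the minus sign in its definition turns the reversed composition in a slot back into
  the bracket \<open>[S, T]\<close>.\<close>

lemma act_commutator:
  fixes \<alpha> :: "'a::real_vector list \<Rightarrow> real"
  assumes \<alpha>: "\<alpha> \<in> multilinear_forms k"
  shows "act S (act T \<alpha>) - act T (act S \<alpha>) = act (\<lambda>v. S (T v) - T (S v)) \<alpha>"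
proof
  fix vs :: "'a list"
  let ?n = "length vs"
  define off where
    "off S T = (\<Sum>i<?n. \<Sum>l\<in>{..<?n}-{i}. \<alpha> (vs[i := S (vs ! i), l := T (vs ! l)]))" for S T
  have *: "act S (act T \<alpha>) vs = (\<Sum>i<?n. \<alpha> (vs[i := T (S (vs ! i))])) + off S T" for S T
  proof -
    have "act S (act T \<alpha>) vs =
        (\<Sum>i<?n. \<Sum>l<?n. \<alpha> (vs[i := S (vs ! i), l := T (vs[i := S (vs ! i)] ! l)]))"
      by (simp add: act_def sum_negf)
    also have "\<dots> = (\<Sum>i<?n. \<alpha> (vs[i := T (S (vs ! i))]) +
        (\<Sum>l\<in>{..<?n}-{i}. \<alpha> (vs[i := S (vs ! i), l := T (vs ! l)])))"
      by (intro sum.cong refl) (simp add: sum.remove[where x=i for i])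
    finally show ?thesis by (simp add: sum.distrib off_def)
  qed
  have sym: "off S T = off T S"
  proof -
    have o: "off S T = (\<Sum>i<?n. \<Sum>l<?n. if i = l then 0 else \<alpha> (vs[i := S (vs ! i), l := T (vs ! l)]))"
      for S T
      unfolding off_def by (intro sum.cong refl sum.mono_neutral_cong_left) auto
    show ?thesis unfolding o
      by (subst sum.swap) (auto intro!: sum.cong simp: list_update_swap)
  qed
  have "act (\<lambda>v. S (T v) - T (S v)) \<alpha> vs =
      (\<Sum>i<?n. \<alpha> (vs[i := T (S (vs ! i))])) - (\<Sum>i<?n. \<alpha> (vs[i := S (T (vs ! i))]))"
    using linear_diff[OF multilinear_forms_slot[OF \<alpha>]]
    by (simp add: act_def sum_subtractf)
  then show "(act S (act T \<alpha>) - act T (act S \<alpha>)) vs = act (\<lambda>v. S (T v) - T (S v)) \<alpha> vs"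
    using *[of S T] *[of T S] sym by simp
qed

section \<open>Alternation\<close>

abbreviation omit :: "nat \<Rightarrow> 'a list \<Rightarrow> 'a list" where
  "omit i vs \<equiv> take i vs @ drop (Suc i) vs"

text \<open>A linear family \<open>\<gamma>\<close> of \<open>k\<close>-forms is an element of \<open>V\<^sup>* \<otimes> \<Lambda>\<^sup>k\<close>; its alternation is the image under the wedge product
  \<open>V\<^sup>* \<otimes> \<Lambda>\<^sup>k \<rightarrow> \<Lambda>\<^sup>k\<^sup>+\<^sup>1\<close>. The exterior derivative is the alternation of the
  derivative of a form.\<close>

definition alternation :: "('a \<Rightarrow> 'a list \<Rightarrow> real) \<Rightarrow> 'a list \<Rightarrow> real" where
  "alternation \<gamma> vs = (\<Sum>i<length vs. (-1)^i * \<gamma> (vs ! i) (omit i vs))"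

text \<open>Moving \<open>w\<close> from slot \<open>j\<close> to slot \<open>i\<close> passes \<open>\<bar>i - j\<bar> - 1\<close> entries once the other slot is
  removed. This sign is behind every cancellation in an alternation.\<close>

lemma alt_forms_omit_swap:
  assumes \<alpha>: "\<alpha> \<in> alt_forms k" and ij: "i < length vs" "j < length vs" "i \<noteq> j"
  shows "(-1)^i * \<alpha> (omit i (vs[j := w])) = - ((-1)^j * \<alpha> (omit j (vs[i := w])))"
  using ij
proof (induction i j rule: linorder_wlog)
  case (le i j)
  then have "i < j" by simp
  define xs where "xs = take i vs"
  define ys where "ys = take (j - Suc i) (drop (Suc i) vs)"
  define zs where "zs = drop (Suc j) vs"
  have vs: "vs = xs @ vs ! i # ys @ vs ! j # zs"
  proof -
    have "vs = xs @ vs ! i # drop (Suc i) vs" using le by (simp add: xs_def id_take_nth_drop)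
    also have "drop (Suc i) vs = ys @ drop (j - Suc i) (drop (Suc i) vs)"
      unfolding ys_def by (rule append_take_drop_id[symmetric])
    also have "drop (j - Suc i) (drop (Suc i) vs) = vs ! j # zs"
      using le \<open>i < j\<close> by (simp add: zs_def Cons_nth_drop_Suc)
    finally show ?thesis .
  qed
  have i: "i = length xs" using le by (simp add: xs_def)
  have j: "j = Suc (length xs + length ys)" using le \<open>i < j\<close> by (simp add: i[symmetric] ys_def)
  have 1: "omit i (vs[j := w]) = xs @ ys @ w # zs"
    by (subst (1 2) vs) (simp add: i j list_update_append)
  have 2: "omit j (vs[i := w]) = xs @ w # ys @ zs"
    by (subst (1 2) vs) (simp add: i j list_update_append)
  have m: "\<alpha> (xs @ w # ys @ zs) = (-1) ^ length ys * \<alpha> (xs @ ys @ w # zs)"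
    by (rule alt_forms_move[OF \<alpha>])
  show ?case unfolding 1 2 m by (cases "even (length ys)") (simp_all add: i j power_add)
next
  case (sym i j)
  then have "(-1)^j * \<alpha> (omit j (vs[i := w])) = - ((-1)^i * \<alpha> (omit i (vs[j := w])))"
    by (intro sym(1)) auto
  then show ?case by linarith
qed

lemma act_omit:
  assumes i: "i < length vs"
  shows "act S \<alpha> (omit i vs) =
    - (\<Sum>j\<in>{..<length vs}-{i}. \<alpha> (omit i (vs[j := S (vs ! j)])))"
proof -
  define h where "h l = (if l < i then l else Suc l)" for l
  have l: "length (omit i vs) = length vs - 1" using i by simp
  have b: "bij_betw h {..<length vs - 1} ({..<length vs}-{i})"
    by (rule bij_betw_byWitness[where f'="\<lambda>j. if j < i then j else j - 1"])
      (use i in \<open>auto simp: h_def\<close>)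
  have "(omit i vs)[l := S (omit i vs ! l)] = omit i (vs[h l := S (vs ! h l)])"
    if "l < length vs - 1" for l
    using that i by (auto simp: h_def list_update_append nth_append min_def drop_update_swap take_update_swap list_update_beyond)
  then show ?thesis
    unfolding act_def l using sum.reindex_bij_betw[OF b, of "\<lambda>j. \<alpha> (omit i (vs[j := S (vs ! j)]))"]
    by simp
qed

text \<open>The wedge product is equivariant for the tensor product action, in which \<open>S\<close> acts on the covector
  factor by \<open>\<gamma> \<mapsto> - \<gamma> \<circ> S\<close>.\<close>

lemma act_alternation:
  fixes \<gamma> :: "'a \<Rightarrow> 'a list \<Rightarrow> real"
  shows "act S (alternation \<gamma>) = alternation (\<lambda>u. act S (\<gamma> u) - \<gamma> (S u))"
proof
  fix vs :: "'a list"
  let ?n = "length vs"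
  have "act S (alternation \<gamma>) vs = - (\<Sum>j<?n. \<Sum>i<?n.
      (-1)^i * \<gamma> (vs[j := S (vs ! j)] ! i) (omit i (vs[j := S (vs ! j)])))"
    by (simp add: act_def alternation_def)
  also have "\<dots> = - (\<Sum>i<?n. \<Sum>j<?n.
      (-1)^i * \<gamma> (vs[j := S (vs ! j)] ! i) (omit i (vs[j := S (vs ! j)])))"
    by (subst sum.swap) simp
  also have "\<dots> = - (\<Sum>i<?n. (-1)^i * (\<gamma> (S (vs ! i)) (omit i vs) +
      (\<Sum>j\<in>{..<?n}-{i}. \<gamma> (vs ! i) (omit i (vs[j := S (vs ! j)])))))"
    by (intro sum.cong refl arg_cong[where f=uminus])
      (simp add: sum.remove[where x=i for i] sum_distrib_left distrib_left)
  also have "\<dots> = (\<Sum>i<?n. (-1)^i * (act S (\<gamma> (vs ! i)) (omit i vs) - \<gamma> (S (vs ! i)) (omit i vs)))"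
    unfolding sum_negf[symmetric]
    by (intro sum.cong refl) (simp add: act_omit algebra_simps)
  finally show "act S (alternation \<gamma>) vs = alternation (\<lambda>u. act S (\<gamma> u) - \<gamma> (S u)) vs"
    by (simp add: alternation_def)
qed

lemma alternation_add: "alternation (\<lambda>u. \<gamma> u + \<delta> u) = alternation \<gamma> + alternation \<delta>"
  by (auto simp: alternation_def fun_eq_iff distrib_left sum.distrib)

lemma alternation_scaleR: "alternation (\<lambda>u. c *\<^sub>R \<gamma> u) = c *\<^sub>R alternation \<gamma>"
  by (auto simp: alternation_def fun_eq_iff scaleR_fun_def sum_distrib_left algebra_simps)

lemma alternation_alt_forms:
  assumes \<gamma>: "\<And>u. \<gamma> u \<in> alt_forms k" and lin: "linear \<gamma>"
  shows "alternation \<gamma> \<in> alt_forms (Suc k)"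
proof (rule alt_formsI[OF multilinear_formsI])
  show "alternation \<gamma> vs = 0" if "length vs \<noteq> Suc k" for vs
    using that by (auto simp: alternation_def intro!: sum.neutral alt_forms_length[OF \<gamma>])
next
  fix vs :: "'a list" and l assume n: "length vs = Suc k" and l: "l < Suc k"
  have "linear (\<lambda>u. (-1)^i * \<gamma> (vs[l := u] ! i) (omit i (vs[l := u])))" if i: "i < Suc k" for i
  proof (cases "i = l")
    case True
    have "linear (\<lambda>u. \<gamma> u (omit l vs))"
      using lin by (simp add: linear_iff scaleR_fun_def)
    then have "linear (\<lambda>u. (-1)^l *\<^sub>R \<gamma> u (omit l vs))" by (rule linear_compose_scale_right)
    then show ?thesis using True n l by simp
  next
    case False
    define m where "m = (if l < i then l else l - 1)"
    have "omit i (vs[l := u]) = (omit i vs)[m := u]" for u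
      using False i l n
      by (auto simp: m_def list_update_append min_def drop_update_swap take_update_swap list_update_beyond)
    moreover have "linear (\<lambda>u. \<gamma> (vs ! i) ((omit i vs)[m := u]))"
      by (rule multilinear_forms_slot[OF alt_forms_multilinear[OF \<gamma>]])
        (use False i l n in \<open>auto simp: m_def\<close>)
    ultimately have "linear (\<lambda>u. (-1)^i *\<^sub>R \<gamma> (vs ! i) (omit i (vs[l := u])))"
      by (intro linear_compose_scale_right) simp
    then show ?thesis using False by simp
  qed
  then have "linear (\<lambda>u. \<Sum>i<Suc k. (-1)^i * \<gamma> (vs[l := u] ! i) (omit i (vs[l := u])))"
    by (intro linear_compose_sum) auto
  then show "linear (\<lambda>u. alternation \<gamma> (vs[l := u]))"
    by (simp add: alternation_def n)
next
  fix vs :: "'a list" and i j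
  assume *: "length vs = Suc k" "i < j" "j < Suc k" "vs ! i = vs ! j"
  have z: "\<gamma> (vs ! l) (omit l vs) = 0" if "l \<noteq> i" "l \<noteq> j" "l < Suc k" for l
  proof -
    define h where "h i = (if i < l then i else i - 1)" for i
    have h: "omit l vs ! h m = vs ! m" if "m \<noteq> l" "m < Suc k" for m
      using that * \<open>l < Suc k\<close> by (auto simp: h_def nth_append min_def)
    show ?thesis
      by (rule alt_forms_eq_0[OF \<gamma>, of "h i" _ "h j"])
        (use * that h[of i] h[of j] in \<open>auto simp: h_def\<close>)
  qed
  have "alternation \<gamma> vs = (\<Sum>l\<in>{i, j}. (-1)^l * \<gamma> (vs ! l) (omit l vs))"
    unfolding alternation_def by (rule sum.mono_neutral_right) (use * z in auto)
  also have "\<dots> = (-1)^i * \<gamma> (vs ! i) (omit i vs) + (-1)^j * \<gamma> (vs ! i) (omit j vs)"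
    using * by simp
  also have "\<dots> = 0"
    using alt_forms_omit_swap[OF \<gamma>, of i vs j "vs ! i" "vs ! i"] *
      list_update_id[of vs i] list_update_id[of vs j] by simp
  finally show "alternation \<gamma> vs = 0" .
qed

text \<open>A symmetric bilinear \<open>G\<close> contributes to each pair of slots twice, with opposite signs. For the
  Christoffel terms of a torsion-free connection this says that they drop out of the exterior
  derivative.\<close>

lemma alternation_symmetric_act:
  fixes \<alpha> :: "'a::real_vector list \<Rightarrow> real"
  assumes \<alpha>: "\<alpha> \<in> alt_forms k" and sym: "\<And>u v. G u v = G v u"
  shows "alternation (\<lambda>u. act (G u) \<alpha>) = 0"
proof
  fix vs :: "'a list"
  let ?n = "length vs"
  define F where "F i j = (if i = j then 0 else (-1)^i * \<alpha> (omit i (vs[j := G (vs ! i) (vs ! j)])))" for i j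
  have anti: "F i j = - F j i" if "i < ?n" "j < ?n" for i j
  proof (cases "i = j")
    case False
    show ?thesis
      using alt_forms_omit_swap[OF \<alpha> that False, of "G (vs ! i) (vs ! j)"] False
      unfolding F_def sym[of "vs ! j" "vs ! i"] by (simp only: if_False False False[symmetric])
  qed (simp add: F_def)
  have "alternation (\<lambda>u. act (G u) \<alpha>) vs = - (\<Sum>i<?n. \<Sum>j<?n. F i j)"
    unfolding alternation_def sum_negf[symmetric]
  proof (intro sum.cong refl)
    fix i assume i: "i \<in> {..<?n}"
    have "(\<Sum>j<?n. F i j) = (\<Sum>j\<in>{..<?n}-{i}. (-1)^i * \<alpha> (omit i (vs[j := G (vs ! i) (vs ! j)])))"
      by (rule sum.mono_neutral_cong_right) (auto simp: F_def)
    then show "(- 1) ^ i * act (G (vs ! i)) \<alpha> (omit i vs) = (\<Sum>j<?n. - F i j)"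
      using i by (simp add: act_omit sum_distrib_left sum_negf)
  qed
  moreover have "(\<Sum>i<?n. \<Sum>j<?n. F i j) = - (\<Sum>i<?n. \<Sum>j<?n. F i j)"
  proof -
    have "(\<Sum>i<?n. \<Sum>j<?n. F i j) = (\<Sum>j<?n. \<Sum>i<?n. F i j)" by (rule sum.swap)
    also have "\<dots> = (\<Sum>j<?n. \<Sum>i<?n. - F j i)"
      by (intro sum.cong refl anti) (rule lessThan_iff[THEN iffD1], assumption)+
    finally show ?thesis by (simp add: sum_negf)
  qed
  ultimately show "alternation (\<lambda>u. act (G u) \<alpha>) vs = 0 vs"
    unfolding zero_fun_apply by linarith
qed

section \<open>Finite-dimensional unitary representations of sp(1)\<close>

text \<open>The three operators generate \<open>sp(1)\<close>, with the normalization \<open>[a, b] = 2c\<close> of the units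
  \<open>i, j, k\<close>. The carrier \<open>V\<close> is a subspace of a space that may be infinite-dimensional, whence the
  finite spanning set \<open>F\<close>. The invariant inner product gives complete
  reducibility. The last assumption, integrality of the weights together with their existence, is a
  theorem for every such module, but for forms it has a direct proof.\<close>

locale sp1_module =
  fixes V :: "'v::real_vector set" and a b c :: "'v \<Rightarrow> 'v" and ip :: "'v \<Rightarrow> 'v \<Rightarrow> real" and F :: "'v set"
  assumes subspace_V: "subspace V"
    and linear_abc: "linear a" "linear b" "linear c"
    and abc_in: "v \<in> V \<Longrightarrow> a v \<in> V" "v \<in> V \<Longrightarrow> b v \<in> V" "v \<in> V \<Longrightarrow> c v \<in> V"
    and ab: "v \<in> V \<Longrightarrow> a (b v) - b (a v) = 2 *\<^sub>R c v"
    and bc: "v \<in> V \<Longrightarrow> b (c v) - c (b v) = 2 *\<^sub>R a v"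
    and ca: "v \<in> V \<Longrightarrow> c (a v) - a (c v) = 2 *\<^sub>R b v"
    and finite_F: "finite F" and V_span: "V \<subseteq> span F"
    and ip_sym: "ip u v = ip v u"
    and ip_linear: "linear (ip u)"
    and ip_nonneg: "ip u u \<ge> 0"
    and ip_definite: "v \<in> V \<Longrightarrow> ip v v = 0 \<Longrightarrow> v = 0"
    and ip_skew: "u \<in> V \<Longrightarrow> v \<in> V \<Longrightarrow> ip (a u) v = - ip u (a v)"
      "u \<in> V \<Longrightarrow> v \<in> V \<Longrightarrow> ip (b u) v = - ip u (b v)"
      "u \<in> V \<Longrightarrow> v \<in> V \<Longrightarrow> ip (c u) v = - ip u (c v)"
    and weight_exists: "subspace W \<Longrightarrow> W \<subseteq> V \<Longrightarrow> W \<noteq> {0} \<Longrightarrow> (\<And>v. v \<in> W \<Longrightarrow> a v \<in> W) \<Longrightarrow>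
      \<exists>w\<in>W. \<exists>m::int. w \<noteq> 0 \<and> a (a w) = - ((of_int m)\<^sup>2 *\<^sub>R w)"
begin

definition invariant :: "'v set \<Rightarrow> bool" where
  "invariant W \<longleftrightarrow> subspace W \<and> W \<subseteq> V \<and> (\<forall>v\<in>W. a v \<in> W \<and> b v \<in> W \<and> c v \<in> W)"

definition irreducible :: "'v set \<Rightarrow> bool" where
  "irreducible W \<longleftrightarrow> invariant W \<and> W \<noteq> {0} \<and> (\<forall>U. invariant U \<and> U \<subseteq> W \<longrightarrow> U = {0} \<or> U = W)"

definition weight :: "'v set \<Rightarrow> int \<Rightarrow> bool" where
  "weight W m \<longleftrightarrow> (\<exists>v\<in>W. v \<noteq> 0 \<and> a (a v) = - ((of_int m)\<^sup>2 *\<^sub>R v))"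

definition highest :: "'v set \<Rightarrow> int \<Rightarrow> bool" where
  "highest W r \<longleftrightarrow> weight W r \<and> (\<forall>m. weight W m \<longrightarrow> m \<le> r)"

definition casimir :: "'v \<Rightarrow> 'v" where
  "casimir v = a (a v) + b (b v) + c (c v)"

lemmas a_simps = linear_add[OF linear_abc(1)] linear_diff[OF linear_abc(1)]
  linear_scale[OF linear_abc(1)] linear_0[OF linear_abc(1)] linear_neg[OF linear_abc(1)]
lemmas b_simps = linear_add[OF linear_abc(2)] linear_diff[OF linear_abc(2)]
  linear_scale[OF linear_abc(2)] linear_0[OF linear_abc(2)] linear_neg[OF linear_abc(2)]
lemmas c_simps = linear_add[OF linear_abc(3)] linear_diff[OF linear_abc(3)]
  linear_scale[OF linear_abc(3)] linear_0[OF linear_abc(3)] linear_neg[OF linear_abc(3)]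
lemmas ip_right = linear_add[OF ip_linear] linear_diff[OF ip_linear]
  linear_scale[OF ip_linear] linear_0[OF ip_linear] linear_neg[OF ip_linear]
lemmas V_closed = subspace_0[OF subspace_V] subspace_add[OF subspace_V] subspace_diff[OF subspace_V]
  subspace_scale[OF subspace_V] subspace_neg[OF subspace_V] abc_in

lemma commutators:
  assumes "v \<in> V"
  shows "a (b v) = b (a v) + 2 *\<^sub>R c v" "b (c v) = c (b v) + 2 *\<^sub>R a v" "a (c v) = c (a v) - 2 *\<^sub>R b v"
  using ab[OF assms] bc[OF assms] ca[OF assms] by (auto simp: algebra_simps)

lemma linear_casimir: "linear casimir"
  by (rule linearI) (simp_all add: casimir_def a_simps b_simps c_simps algebra_simps)

lemma casimir_commute:
  assumes "v \<in> V"
  shows "casimir (a v) = a (casimir v)" "casimir (b v) = b (casimir v)" "casimir (c v) = c (casimir v)"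
  using assms by (simp_all add: casimir_def a_simps b_simps c_simps commutators abc_in algebra_simps)

lemma invariant_casimir_eigenspace:
  assumes "invariant W"
  shows "invariant {v\<in>W. casimir v = t *\<^sub>R v}"
proof -
  have "subspace {v\<in>W. casimir v = t *\<^sub>R v}"
    using assms by (auto simp: invariant_def subspace_def linear_add[OF linear_casimir]
        linear_scale[OF linear_casimir] linear_0[OF linear_casimir] algebra_simps)
  moreover have "v \<in> V" if "v \<in> W" for v using assms that by (auto simp: invariant_def)
  ultimately show ?thesis
    using assms by (auto simp: invariant_def casimir_commute a_simps b_simps c_simps)
qed

lemma ip_square: "v \<in> V \<Longrightarrow> ip (a (a v)) v = - ip (a v) (a v)"
  "v \<in> V \<Longrightarrow> ip (b (b v)) v = - ip (b v) (b v)"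
  "v \<in> V \<Longrightarrow> ip (c (c v)) v = - ip (c v) (c v)"
  by (simp_all add: ip_skew abc_in)

lemma ip_pos: "v \<in> V \<Longrightarrow> v \<noteq> 0 \<Longrightarrow> ip v v > 0"
  using ip_definite[of v] ip_nonneg[of v] by fastforce

lemma ip_casimir: "v \<in> V \<Longrightarrow> ip v (casimir v) = - ip (a v) (a v) - ip (b v) (b v) - ip (c v) (c v)"
  using ip_square[of v] by (simp add: casimir_def ip_right ip_sym[of v])

lemma casimir_nonpos:
  assumes "v \<in> V" "casimir v = t *\<^sub>R v" "t > 0"
  shows "v = 0"
proof (rule ccontr)
  assume "v \<noteq> 0"
  then have "t * ip v v > 0" using ip_pos assms by simp
  moreover have "t * ip v v \<le> 0"
    using ip_casimir[OF assms(1)] ip_nonneg[of "a v"] ip_nonneg[of "b v"] ip_nonneg[of "c v"]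
    by (simp add: assms(2) ip_right)
  ultimately show False by simp
qed

lemma weight_bound:
  assumes v: "v \<in> V" "v \<noteq> 0" and cas: "casimir v = - (t *\<^sub>R v)" and w: "a (a v) = - (m\<^sup>2 *\<^sub>R v)"
  shows "m\<^sup>2 \<le> t"
proof -
  have "ip v (a (a v)) = - ip (a v) (a v)" using ip_square(1)[OF v(1)] by (simp add: ip_sym[of v])
  then have "ip (a v) (a v) = m\<^sup>2 * ip v v" by (simp add: w ip_right)
  moreover have "t * ip v v = ip (a v) (a v) + ip (b v) (b v) + ip (c v) (c v)"
    using ip_casimir[OF v(1)] by (simp add: cas ip_right)
  ultimately have "m\<^sup>2 * ip v v \<le> t * ip v v"
    using ip_nonneg[of "b v"] ip_nonneg[of "c v"] by linarith
  then show ?thesis using ip_pos[OF v] by simp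
qed

text \<open>A real weight vector \<open>v\<close> spans with \<open>a v\<close> a plane on which \<open>a\<close> is \<open>m\<close> times a rotation by a
  right angle; \<open>t\<close> is the factor that normalizes \<open>a v\<close>. In weight \<open>0\<close> the plane degenerates: the
  inner product shows \<open>a v = 0\<close>, and \<open>t = 0\<close>.\<close>

lemma weight_pair:
  assumes v: "v \<in> V" and w: "a (a v) = - (m\<^sup>2 *\<^sub>R v)"
  obtains t where "a v = m *\<^sub>R (t *\<^sub>R a v)" "a (t *\<^sub>R a v) = - (m *\<^sub>R v)"
proof (cases "m = 0")
  case True
  have "ip (a v) (a v) = 0" using ip_square(1)[OF v] by (simp add: w True ip_sym[of _ v] ip_right)
  then have "a v = 0" using ip_definite v abc_in by blast
  then show ?thesis using that[of 0] True by (simp add: a_simps)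
next
  case False
  then show ?thesis using that[of "1/m"] by (simp add: a_simps w power2_eq_square)
qed

text \<open>The real form of the raising operator: if \<open>x - \<i>y\<close> has weight \<open>m\<close>, then applying
  \<open>b - \<i>c\<close> yields a vector of weight \<open>m + 2\<close>, with real and imaginary parts \<open>b x - c y\<close> and
  \<open>- (b y + c x)\<close>.\<close>

lemma raise_weight:
  assumes V: "x \<in> V" "y \<in> V" and xy: "a x = m *\<^sub>R y" "a y = - (m *\<^sub>R x)"
  shows "a (b x - c y) = (m + 2) *\<^sub>R (b y + c x)" "a (b y + c x) = - ((m + 2) *\<^sub>R (b x - c y))"
  using V by (simp_all add: a_simps b_simps c_simps commutators xy algebra_simps)

text \<open>A vector killed by the raising operator is a highest weight vector, and there the Casimir operator is a scalar.\<close>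

lemma casimir_if_not_raised:
  assumes V: "x \<in> V" "y \<in> V" and xy: "a x = m *\<^sub>R y" "a y = - (m *\<^sub>R x)"
    and 0: "b x - c y = 0" "b y + c x = 0"
  shows "casimir x = - ((m * (m + 2)) *\<^sub>R x)"
proof -
  have bx: "b x = c y" and cx: "c x = - b y"
    using 0 by (simp_all add: eq_neg_iff_add_eq_0 add.commute)
  have "casimir x = - ((m * m) *\<^sub>R x) + b (c y) - c (b y)"
    by (simp add: casimir_def xy bx cx a_simps c_simps)
  also have "b (c y) = c (b y) + 2 *\<^sub>R a y" using V by (simp add: commutators)
  finally show ?thesis by (simp add: xy algebra_simps)
qed

text \<open>Weight \<open>r + 2\<close> does not occur, so a vector of weight \<open>r\<close> is killed by the raising operator and
  is a Casimir eigenvector. The eigenspace through it is invariant, hence everything.\<close>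

lemma irreducible_casimir:
  assumes irr: "irreducible W" and hw: "highest W r" and v: "v \<in> W"
  shows "casimir v = - (of_int (r * (r + 2)) *\<^sub>R v)" "r \<ge> 0"
proof -
  have inv: "invariant W" and subW: "subspace W" and WV: "W \<subseteq> V"
    and abcW: "\<And>v. v \<in> W \<Longrightarrow> a v \<in> W" "\<And>v. v \<in> W \<Longrightarrow> b v \<in> W" "\<And>v. v \<in> W \<Longrightarrow> c v \<in> W"
    using irr by (auto simp: irreducible_def invariant_def)
  have "weight W (- r)" "weight W r" using hw by (auto simp: highest_def weight_def)
  then show r: "r \<ge> 0" using hw by (force simp: highest_def)
  obtain x where x: "x \<in> W" "x \<noteq> 0" "a (a x) = - ((of_int r)\<^sup>2 *\<^sub>R x)"
    using \<open>weight W r\<close> by (auto simp: weight_def)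
  obtain t where t: "a x = of_int r *\<^sub>R (t *\<^sub>R a x)" "a (t *\<^sub>R a x) = - (of_int r *\<^sub>R x)"
    using weight_pair[of x "of_int r"] x WV by auto
  define y where "y = t *\<^sub>R a x"
  have y: "y \<in> W" unfolding y_def using x abcW subW by (simp add: subspace_scale)
  have xy: "a x = of_int r *\<^sub>R y" "a y = - (of_int r *\<^sub>R x)" using t by (simp_all add: y_def)
  have V: "x \<in> V" "y \<in> V" using x y WV by auto
  define w w' where "w = b x - c y" and "w' = b y + c x"
  have w: "w \<in> W" "w' \<in> W" using x y abcW subW by (simp_all add: w_def w'_def subspace_add subspace_diff)
  have aw: "a w = of_int (r + 2) *\<^sub>R w'" "a w' = - (of_int (r + 2) *\<^sub>R w)"
    using raise_weight[OF V xy] by (simp_all add: w_def w'_def)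
  have "a (a w) = - ((of_int (r + 2))\<^sup>2 *\<^sub>R w)" by (simp add: aw a_simps power2_eq_square del: of_int_add)
  then have "w \<noteq> 0 \<Longrightarrow> weight W (r + 2)" using w unfolding weight_def by blast
  then have w0: "w = 0" using hw unfolding highest_def by fastforce
  then have "w' = 0" using aw r by (simp add: a_simps)
  then have cx: "casimir x = (- of_int (r * (r + 2))) *\<^sub>R x"
    using casimir_if_not_raised[OF V xy] w0 by (simp add: w_def w'_def)
  let ?U = "{v\<in>W. casimir v = (- of_int (r * (r + 2))) *\<^sub>R v}"
  have "?U = {0} \<or> ?U = W"
    using irr invariant_casimir_eigenspace[OF inv, of "- of_int (r * (r + 2))"]
    unfolding irreducible_def by blast
  then have "?U = W" using cx x by blast
  then show "casimir v = - (of_int (r * (r + 2)) *\<^sub>R v)" using v by auto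
qed

text \<open>The Casimir eigenvalue bounds the weights, as \<open>a\<^sup>2\<close> is one of three nonpositive
  summands of the Casimir operator. So there is a highest weight, and it is determined by the eigenvalue since \<open>r \<mapsto> r(r + 2)\<close>
  is injective for \<open>r \<ge> 0\<close>.\<close>

lemma irreducible_highest:
  assumes irr: "irreducible W" and cas: "\<And>v. v \<in> W \<Longrightarrow> casimir v = - (of_int (r * (r + 2)) *\<^sub>R v)"
    and r: "r \<ge> 0"
  shows "highest W r"
proof -
  have subW: "subspace W" and WV: "W \<subseteq> V" and W0: "W \<noteq> {0}"
    and aW: "\<And>v. v \<in> W \<Longrightarrow> a v \<in> W"
    using irr by (auto simp: irreducible_def invariant_def)
  have bound: "m \<le> r" if m: "weight W m" for m
  proof (rule ccontr)
    assume "\<not> m \<le> r"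
    obtain v where v: "v \<in> W" "v \<noteq> 0" "a (a v) = - ((of_int m)\<^sup>2 *\<^sub>R v)"
      using m by (auto simp: weight_def)
    have "(of_int m :: real)\<^sup>2 \<le> of_int (r * (r + 2))"
      by (rule weight_bound[OF _ v(2) cas v(3)]) (use v WV in auto)
    then have "m\<^sup>2 \<le> r * (r + 2)"
      by (metis of_int_le_iff of_int_power)
    moreover have "(r + 1)\<^sup>2 \<le> m\<^sup>2" using \<open>\<not> m \<le> r\<close> r by (intro power_mono) auto
    ultimately show False by (simp add: power2_eq_square algebra_simps)
  qed
  obtain m0 where m0: "weight W m0"
    using weight_exists[OF subW WV W0 aW] by (auto simp: weight_def)
  then have "weight W \<bar>m0\<bar>" by (simp add: weight_def)
  define M where "M = Max {m. weight W m \<and> 0 \<le> m}"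
  have fin: "finite {m. weight W m \<and> 0 \<le> m}"
    by (rule finite_subset[of _ "{0..r}"]) (use bound in auto)
  have M: "weight W M" "0 \<le> M"
    using Max_in[OF fin] \<open>weight W \<bar>m0\<bar>\<close> unfolding M_def by fastforce+
  have "m \<le> M" if "weight W m" for m
    using Max_ge[OF fin, of m] that M by (cases "m \<ge> 0") (auto simp: M_def)
  then have "highest W M" using M by (simp add: highest_def)
  obtain v where v: "v \<in> W" "v \<noteq> 0" using W0 subspace_0[OF subW] by auto
  have "of_int (M * (M + 2)) *\<^sub>R v = of_int (r * (r + 2)) *\<^sub>R v"
    by (metis irreducible_casimir(1)[OF irr \<open>highest W M\<close> v(1)] cas[OF v(1)] neg_equal_iff_equal)
  then have "M * (M + 2) = r * (r + 2)" using v(2) by (simp only: scaleR_cancel_right of_int_eq_iff) simp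
  then have "(M + 1)\<^sup>2 = (r + 1)\<^sup>2" by (simp add: power2_eq_square algebra_simps)
  then have "M = r" using M(2) r by (simp add: power2_eq_iff)
  then show ?thesis using \<open>highest W M\<close> by simp
qed

text \<open>The Gram-Schmidt process; the vector \<open>g\<close> may be zero, and then its coefficient \<open>s\<close> is \<open>0\<close> by division by zero.\<close>

lemma projection_exists:
  assumes "finite B" "B \<subseteq> V" "v \<in> V"
  shows "\<exists>p\<in>span B. \<forall>u\<in>B. ip (v - p) u = 0"
  using assms(1,2,3)
proof (induction arbitrary: v rule: finite_induct)
  case empty
  then show ?case by simp
next
  case (insert f B)
  obtain p where p: "p \<in> span B" "\<And>u. u \<in> B \<Longrightarrow> ip (v - p) u = 0"
    using insert.IH[of v] insert.prems by auto
  obtain q where q: "q \<in> span B" "\<And>u. u \<in> B \<Longrightarrow> ip (f - q) u = 0"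
    using insert.IH[of f] insert.prems by auto
  define g where "g = f - q"
  have sp: "subspace (span (insert f B))" by simp
  have BV: "span B \<subseteq> V" using insert.prems subspace_V by (simp add: span_minimal)
  have gV: "g \<in> V" using q BV insert.prems by (auto simp: g_def V_closed)
  define s where "s = ip g (v - p) / ip g g"
  let ?p = "p + s *\<^sub>R g"
  have mono: "span B \<subseteq> span (insert f B)" by (rule span_mono) auto
  have "?p \<in> span (insert f B)"
    unfolding g_def using p(1) q(1) mono by (intro span_add span_scale span_diff) (auto simp: span_base)
  moreover have B: "ip (v - ?p) u = 0" if "u \<in> B" for u
    using p(2)[OF that] q(2)[OF that]
    unfolding ip_sym[of _ u] by (simp add: ip_right g_def)
  moreover have "ip (v - ?p) f = 0"
  proof -
    have "ip 0 (v - p) = 0" using ip_sym[of 0 "v - p"] by (simp add: ip_right)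
    then have "ip g g = 0 \<Longrightarrow> ip g (v - p) = 0" using ip_definite[OF gV] by auto
    then have "ip g (v - ?p) = 0" by (simp add: ip_right s_def)
    then have "ip (v - ?p) g = 0" by (subst ip_sym)
    moreover have "ip (v - ?p) q = 0"
    proof -
      have "subspace {u. ip (v - ?p) u = 0}" by (auto simp: subspace_def ip_right)
      then have "span B \<subseteq> {u. ip (v - ?p) u = 0}" using B by (intro span_minimal) auto
      then show ?thesis using q by auto
    qed
    ultimately show ?thesis using ip_right(1)[of "v - ?p" g q] by (simp add: g_def)
  qed
  ultimately show ?case by auto
qed

text \<open>A nonzero invariant subspace of minimal dimension is irreducible.\<close>

lemma irreducible_exists:
  assumes "invariant U" "U \<noteq> {0}"
  shows "\<exists>W\<subseteq>U. irreducible W"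
proof -
  define W where "W = arg_min dim (\<lambda>W. invariant W \<and> W \<noteq> {0} \<and> W \<subseteq> U)"
  have W: "invariant W \<and> W \<noteq> {0} \<and> W \<subseteq> U"
    unfolding W_def by (rule arg_min_natI[of _ U]) (use assms in auto)
  have min: "dim W \<le> dim W'" if "invariant W' \<and> W' \<noteq> {0} \<and> W' \<subseteq> U" for W'
    unfolding W_def
    by (rule arg_min_nat_le[of "\<lambda>W. invariant W \<and> W \<noteq> {0} \<and> W \<subseteq> U", OF that])
  have "W' = W" if W': "invariant W'" "W' \<subseteq> W" "W' \<noteq> {0}" for W'
  proof -
    obtain B' where B': "B' \<subseteq> W'" "independent B'" "W' \<subseteq> span B'" "card B' = dim W'"
      by (rule basis_exists)
    have "B' \<subseteq> W" using B' W' by auto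
    then obtain B where B: "B' \<subseteq> B" "B \<subseteq> W" "independent B" "W \<subseteq> span B"
      using maximal_independent_subset_extend[OF _ B'(2)] by metis
    have "B \<subseteq> span F" using B W V_span by (auto simp: invariant_def)
    then have "finite B" using independent_span_bound[OF finite_F B(3)] by simp
    have "card B = dim W" by (rule basis_card_eq_dim[OF B(2) B(4) B(3)])
    then have "card B \<le> card B'" using min[of W'] W W' B' by auto
    then have "B' = B" using B(1) \<open>finite B\<close> by (simp add: card_seteq)
    moreover have "span B' \<subseteq> W'"
      by (rule span_minimal[OF B'(1)]) (use W' in \<open>auto simp: invariant_def\<close>)
    ultimately show ?thesis using B W' by auto
  qed
  then have "irreducible W" using W by (auto simp: irreducible_def)
  then show ?thesis using W by auto
qed

text \<open>The orthogonal complement of the span of all irreducible subspaces is invariant. If it were nonzero,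
  it would contain an irreducible subspace, which would be orthogonal to itself.\<close>

lemma complete_reducibility:
  assumes U: "invariant U"
  shows "U = span (\<Union>{W. irreducible W \<and> W \<subseteq> U})" (is "U = span ?G")
proof
  have subU: "subspace U" and UV: "U \<subseteq> V" using U by (auto simp: invariant_def)
  show GU: "span ?G \<subseteq> U" by (rule span_minimal) (use subU in auto)
  have Ginv: "a v \<in> span ?G \<and> b v \<in> span ?G \<and> c v \<in> span ?G" if "v \<in> span ?G" for v
    using that
  proof (induction rule: span_induct_alt)
    case base
    then show ?case by (simp add: a_simps b_simps c_simps span_0)
  next
    case (step s x y)
    then obtain W where "irreducible W" "W \<subseteq> U" "x \<in> W" by auto
    then have "a x \<in> ?G" "b x \<in> ?G" "c x \<in> ?G" by (auto simp: irreducible_def invariant_def)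
    then show ?case using step by (simp add: a_simps b_simps c_simps span_add span_scale span_base)
  qed
  define K where "K = {v\<in>U. \<forall>g\<in>span ?G. ip g v = 0}"
  have "subspace K"
    using subU by (auto simp: K_def subspace_def ip_right)
  moreover have "a v \<in> K \<and> b v \<in> K \<and> c v \<in> K" if "v \<in> K" for v
  proof -
    have v: "v \<in> U" "v \<in> V" "\<And>g. g \<in> span ?G \<Longrightarrow> ip g v = 0" using that UV by (auto simp: K_def)
    have "ip g (a v) = 0 \<and> ip g (b v) = 0 \<and> ip g (c v) = 0" if g: "g \<in> span ?G" for g
    proof -
      have "g \<in> V" using GU UV g by blast
      then show ?thesis
        using ip_skew[of g v] v Ginv[OF g] by simp
    qed
    then show ?thesis using v(1) U by (simp add: K_def invariant_def)
  qed
  ultimately have K: "invariant K" using UV by (auto simp: invariant_def K_def)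
  have K0: "K = {0}"
  proof (rule ccontr)
    assume "K \<noteq> {0}"
    then obtain W where W: "W \<subseteq> K" "irreducible W" using irreducible_exists[OF K] by auto
    have "subspace W" "W \<noteq> {0}" using W(2) by (simp_all add: irreducible_def invariant_def)
    with subspace_0[OF \<open>subspace W\<close>] obtain w where w: "w \<in> W" "w \<noteq> 0" by blast
    have wK: "w \<in> K" using W(1) w(1) by (rule subsetD)
    then have wU: "w \<in> U" by (simp add: K_def)
    have "W \<subseteq> U" using W(1) by (auto simp: K_def)
    then have "w \<in> span ?G" using W(2) w(1) by (intro span_base) blast
    then have "ip w w = 0" using wK by (simp add: K_def)
    then show False using ip_definite[of w] w(2) wU UV by blast
  qed
  show "U \<subseteq> span ?G"
  proof
    fix u assume u: "u \<in> U"
    obtain B where B: "B \<subseteq> span ?G" "independent B" "span ?G \<subseteq> span B"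
      by (rule basis_exists)
    have "B \<subseteq> V" using B GU UV by auto
    then have "finite B" using independent_span_bound[OF finite_F B(2)] V_span by auto
    then obtain p where p: "p \<in> span B" "\<And>g. g \<in> B \<Longrightarrow> ip (u - p) g = 0"
      using projection_exists[OF \<open>finite B\<close> \<open>B \<subseteq> V\<close> subsetD[OF UV u]] by blast
    have "span B \<subseteq> span ?G" by (rule span_minimal[OF B(1)]) simp
    then have pG: "p \<in> span ?G" using p by auto
    have "subspace {g. ip (u - p) g = 0}" by (auto simp: subspace_def ip_right)
    then have "span B \<subseteq> {g. ip (u - p) g = 0}" using p by (intro span_minimal) auto
    then have "ip g (u - p) = 0" if "g \<in> span ?G" for g
      using that B(3) by (subst ip_sym) blast
    moreover have "u - p \<in> U" using subspace_diff[OF subU u subsetD[OF GU pG]] .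
    ultimately have "u - p \<in> K" by (simp add: K_def)
    then have "u = p" using K0 by simp
    then show "u \<in> span ?G" using pG by simp
  qed
qed

text \<open>Here the description by highest weights, which is hard to differentiate, becomes
  a linear equation.\<close>

lemma isotypic_eq_casimir_eigenspace:
  assumes r: "r \<ge> 0"
  shows "span (\<Union>{W. irreducible W \<and> highest W r}) = {v\<in>V. casimir v = - (of_int (r * (r + 2)) *\<^sub>R v)}"
    (is "_ = ?U")
proof
  have "invariant V" using subspace_V abc_in by (auto simp: invariant_def)
  from invariant_casimir_eigenspace[OF this, of "- of_int (r * (r + 2))"]
  have U: "invariant ?U" by simp
  show "span (\<Union>{W. irreducible W \<and> highest W r}) \<subseteq> ?U"
  proof (rule span_minimal)
    show "subspace ?U" using U by (simp only: invariant_def)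
    show "\<Union>{W. irreducible W \<and> highest W r} \<subseteq> ?U"
      using irreducible_casimir(1) by (fastforce simp: irreducible_def invariant_def)
  qed
  have "{W. irreducible W \<and> W \<subseteq> ?U} \<subseteq> {W. irreducible W \<and> highest W r}"
    using irreducible_highest r by blast
  then have "span (\<Union>{W. irreducible W \<and> W \<subseteq> ?U}) \<subseteq> span (\<Union>{W. irreducible W \<and> highest W r})"
    by (intro span_mono Union_mono)
  then show "?U \<subseteq> span (\<Union>{W. irreducible W \<and> highest W r})"
    using complete_reducibility[OF U] by simp
qed

end

section \<open>Weights of a derivation induced by a complex structure\<close>

text \<open>The condition for \<open>m = 0\<close> excludes nilpotent behaviour of \<open>D\<close>: with it, \<open>D\<close> is semisimple on the
  span of its weight vectors.\<close>

definition weight_vectors :: "'v::real_vector set \<Rightarrow> ('v \<Rightarrow> 'v) \<Rightarrow> 'v set" where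
  "weight_vectors V D =
    {v\<in>V. \<exists>m::nat. D (D v) = - ((real m)\<^sup>2 *\<^sub>R v) \<and> (m = 0 \<longrightarrow> D v = 0)}"

lemma weight_vectorsI:
  "v \<in> V \<Longrightarrow> D (D v) = - ((real m)\<^sup>2 *\<^sub>R v) \<Longrightarrow> (m = 0 \<Longrightarrow> D v = 0) \<Longrightarrow> v \<in> weight_vectors V D"
  by (auto simp: weight_vectors_def)

text \<open>Weights of a sum of commuting operators add up: \<open>\<rho>\<close> has weights \<open>\<plusminus>1\<close> since \<open>\<rho>\<^sup>2 = -1\<close>. On the
  plane spanned by \<open>\<beta>\<close> and \<open>\<kappa>\<close> the involution \<open>D\<rho>/m\<close> has eigenvectors \<open>\<beta> \<plusminus> \<kappa>\<close>, which have
  weights \<open>m \<plusminus> 1\<close> for \<open>D - \<rho>\<close>.\<close>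

lemma weight_vectors_shift:
  assumes V: "subspace V" and lin: "linear D" "linear \<rho>"
    and inV: "\<And>v. v \<in> V \<Longrightarrow> D v \<in> V" "\<And>v. v \<in> V \<Longrightarrow> \<rho> v \<in> V"
    and comm: "\<And>v. v \<in> V \<Longrightarrow> \<rho> (D v) = D (\<rho> v)" and \<rho>: "\<And>v. v \<in> V \<Longrightarrow> \<rho> (\<rho> v) = - v"
    and \<beta>: "\<beta> \<in> weight_vectors V D"
  shows "\<beta> \<in> span (weight_vectors V (\<lambda>v. D v - \<rho> v))"
proof -
  note Ds = linear_add[OF lin(1)] linear_diff[OF lin(1)] linear_scale[OF lin(1)] linear_neg[OF lin(1)] linear_0[OF lin(1)]
  note \<rho>s = linear_add[OF lin(2)] linear_diff[OF lin(2)] linear_scale[OF lin(2)] linear_neg[OF lin(2)] linear_0[OF lin(2)]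
  let ?E = "\<lambda>v. D v - \<rho> v"
  obtain m :: nat where \<beta>V: "\<beta> \<in> V" and m: "D (D \<beta>) = - ((real m)\<^sup>2 *\<^sub>R \<beta>)" "m = 0 \<Longrightarrow> D \<beta> = 0"
    using \<beta> by (auto simp: weight_vectors_def)
  have E2: "?E (?E v) = D (D v) - 2 *\<^sub>R D (\<rho> v) - v" if "v \<in> V" for v
    using that by (simp add: Ds \<rho>s comm \<rho> inV algebra_simps scaleR_2)
  show ?thesis
  proof (cases "m = 0")
    case True
    then have "D \<beta> = 0" "D (\<rho> \<beta>) = 0" using m \<beta>V by (auto simp: \<rho>s simp flip: comm)
    then have "?E (?E \<beta>) = - ((real 1)\<^sup>2 *\<^sub>R \<beta>)" using E2[OF \<beta>V] by (simp add: Ds)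
    then have "\<beta> \<in> weight_vectors V ?E" using \<beta>V by (intro weight_vectorsI[where m=1]) auto
    then show ?thesis by (rule span_base)
  next
    case False
    define \<kappa> where "\<kappa> = (1 / real m) *\<^sub>R D (\<rho> \<beta>)"
    have \<kappa>V: "\<kappa> \<in> V" unfolding \<kappa>_def using \<beta>V inV V by (simp add: subspace_scale)
    have D\<kappa>: "D (\<rho> \<kappa>) = real m *\<^sub>R \<beta>"
    proof -
      have "D (\<rho> (D (\<rho> \<beta>))) = D (D (\<rho> (\<rho> \<beta>)))" using \<beta>V by (simp add: comm inV)
      then show ?thesis using m False \<beta>V by (simp add: \<kappa>_def Ds \<rho>s \<rho> power2_eq_square)
    qed
    have DD\<kappa>: "D (D \<kappa>) = - ((real m)\<^sup>2 *\<^sub>R \<kappa>)"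
    proof -
      have "D (D (D (\<rho> \<beta>))) = D (\<rho> (D (D \<beta>)))" using \<beta>V by (simp add: comm inV)
      then show ?thesis by (simp add: \<kappa>_def Ds \<rho>s m)
    qed
    have D\<beta>: "D (\<rho> \<beta>) = real m *\<^sub>R \<kappa>" using False by (simp add: \<kappa>_def)
    have w: "\<beta> + \<epsilon> *\<^sub>R \<kappa> \<in> weight_vectors V ?E" if \<epsilon>: "\<epsilon> = 1 \<or> \<epsilon> = -1" for \<epsilon> :: real
    proof -
      define v where "v = \<beta> + \<epsilon> *\<^sub>R \<kappa>"
      have v: "v \<in> V" unfolding v_def using \<beta>V \<kappa>V V by (simp add: subspace_add subspace_scale)
      have D\<rho>v: "D (\<rho> v) = (\<epsilon> * m) *\<^sub>R v"
        using \<epsilon> by (auto simp: v_def Ds \<rho>s D\<beta> D\<kappa> algebra_simps)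
      have DDv: "D (D v) = - ((real m)\<^sup>2 *\<^sub>R v)" by (simp add: v_def Ds m DD\<kappa> algebra_simps)
      define n where "n = (if \<epsilon> = 1 then m + 1 else m - 1)"
      have n: "real n = real m + \<epsilon>" using \<epsilon> False by (auto simp: n_def)
      have "?E (?E v) = - ((real n)\<^sup>2 *\<^sub>R v)"
        using \<epsilon> unfolding E2[OF v] D\<rho>v DDv n
        by (auto simp: power2_eq_square algebra_simps)
      moreover have "?E v = 0" if "n = 0"
      proof -
        have "\<epsilon> = -1" "m = 1" using that n \<epsilon> by auto
        then have "D (\<rho> v) = - v" using D\<rho>v by simp
        then have "\<rho> (D (\<rho> v)) = - \<rho> v" by (simp add: \<rho>s)
        moreover have "\<rho> (D (\<rho> v)) = - D v" using v by (simp add: comm inV \<rho> Ds)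
        ultimately show ?thesis by simp
      qed
      ultimately have "v \<in> weight_vectors V ?E" using v by (intro weight_vectorsI[where m=n])
      then show ?thesis unfolding v_def .
    qed
    have "\<beta> = (1/2) *\<^sub>R ((\<beta> + 1 *\<^sub>R \<kappa>) + (\<beta> + (-1) *\<^sub>R \<kappa>))" by (simp flip: scaleR_2)
    also have "\<dots> \<in> span (weight_vectors V ?E)"
      by (intro span_scale span_add span_base w) auto
    finally show ?thesis .
  qed
qed

text \<open>The derivation induced by a complex structure is a sum of the commuting operators \<open>- \<rho> i\<close> that
  apply \<open>I\<close> to a single slot; each slot shifts the weights by one, starting from the zero operator
  \<open>D 0\<close>, all of whose vectors have weight \<open>0\<close>.\<close>

lemma span_weight_vectors_act:
  fixes I :: "'a::real_vector \<Rightarrow> 'a"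
  assumes I: "linear I" "\<And>v. I (I v) = - v"
  shows "multilinear_forms k \<subseteq> span (weight_vectors (multilinear_forms k) (act I))"
proof -
  let ?V = "multilinear_forms k :: ('a list \<Rightarrow> real) set"
  define \<rho> where "\<rho> i \<alpha> vs = \<alpha> (vs[i := I (vs ! i)])" for i and \<alpha> :: "'a list \<Rightarrow> real" and vs
  define D where "D j \<alpha> = - (\<Sum>i<j. \<rho> i \<alpha>)" for j and \<alpha> :: "'a list \<Rightarrow> real"
  have lin\<rho>: "linear (\<rho> i)" for i
    by (rule linearI) (auto simp: \<rho>_def scaleR_fun_def)
  have linD: "linear (D j)" for j
    unfolding D_def by (intro linear_compose_neg linear_compose_sum lin\<rho> ballI)
  have \<rho>V: "\<rho> i \<alpha> \<in> ?V" if \<alpha>: "\<alpha> \<in> ?V" and i: "i < k" for i \<alpha>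
  proof (rule multilinear_formsI)
    show "\<rho> i \<alpha> vs = 0" if "length vs \<noteq> k" for vs using \<alpha> that by (simp add: \<rho>_def multilinear_forms_def)
    fix vs :: "'a list" and j assume *: "length vs = k" "j < k"
    show "linear (\<lambda>u. \<rho> i \<alpha> (vs[j := u]))"
    proof (cases "j = i")
      case True
      have "linear ((\<lambda>u. \<alpha> (vs[i := u])) \<circ> I)"
        by (rule linear_compose[OF I(1) multilinear_forms_slot[OF \<alpha>]]) (use * i in simp)
      then show ?thesis using True * by (simp add: \<rho>_def comp_def)
    next
      case False
      have "linear (\<lambda>u. \<alpha> (vs[i := I (vs ! i), j := u]))"
        by (rule multilinear_forms_slot[OF \<alpha>]) (use * in simp)
      then show ?thesis using False by (simp add: \<rho>_def list_update_swap)
    qed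
  qed
  have \<rho>\<rho>: "\<rho> i (\<rho> i \<alpha>) = - \<alpha>" if \<alpha>: "\<alpha> \<in> ?V" and i: "i < k" for i \<alpha>
  proof
    fix vs
    show "\<rho> i (\<rho> i \<alpha>) vs = (- \<alpha>) vs"
    proof (cases "length vs = k")
      case True
      then have "\<alpha> (vs[i := - (vs ! i)]) = - \<alpha> (vs[i := vs ! i])"
        using linear_neg[OF multilinear_forms_slot[OF \<alpha>]] i by blast
      then show ?thesis using True i by (simp add: \<rho>_def I(2))
    qed (use \<alpha> in \<open>simp add: \<rho>_def multilinear_forms_def\<close>)
  qed
  have comm: "\<rho> i (\<rho> j \<alpha>) = \<rho> j (\<rho> i \<alpha>)" if "i \<noteq> j" for i j \<alpha>
    using that by (auto simp: \<rho>_def fun_eq_iff list_update_swap)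
  have DV: "D j \<alpha> \<in> ?V" if "\<alpha> \<in> ?V" "j \<le> k" for j \<alpha>
    unfolding D_def using that \<rho>V
    by (intro subspace_neg subspace_sum subspace_multilinear_forms) auto
  have "?V \<subseteq> span (weight_vectors ?V (D j))" if "j \<le> k" for j
    using that
  proof (induction j)
    case 0
    have "\<alpha> \<in> weight_vectors ?V (D 0)" if "\<alpha> \<in> ?V" for \<alpha>
      using that unfolding weight_vectors_def by (auto intro!: exI[of _ 0] simp: D_def)
    then show ?case using span_base by blast
  next
    case (Suc j)
    have eq: "D (Suc j) = (\<lambda>\<alpha>. D j \<alpha> - \<rho> j \<alpha>)" by (auto simp: D_def)
    have "weight_vectors ?V (D j) \<subseteq> span (weight_vectors ?V (\<lambda>\<alpha>. D j \<alpha> - \<rho> j \<alpha>))"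
    proof
      fix \<beta> assume "\<beta> \<in> weight_vectors ?V (D j)"
      then show "\<beta> \<in> span (weight_vectors ?V (\<lambda>\<alpha>. D j \<alpha> - \<rho> j \<alpha>))"
      proof (rule weight_vectors_shift[OF subspace_multilinear_forms linD lin\<rho>, rotated -1])
        show "\<rho> j (D j \<alpha>) = D j (\<rho> j \<alpha>)" for \<alpha>
          unfolding D_def linear_neg[OF lin\<rho>] linear_sum[OF lin\<rho>]
          by (intro arg_cong[where f=uminus] sum.cong refl comm) auto
      qed (use Suc DV \<rho>V \<rho>\<rho> in auto)
    qed
    then have "span (weight_vectors ?V (D j)) \<subseteq> span (weight_vectors ?V (\<lambda>\<alpha>. D j \<alpha> - \<rho> j \<alpha>))"
      by (intro span_minimal) auto
    with Suc show ?case unfolding eq by (meson Suc_leD subset_trans)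
  qed
  moreover have actD: "act I \<alpha> = D k \<alpha>" if "\<alpha> \<in> ?V" for \<alpha>
  proof
    fix vs
    show "act I \<alpha> vs = D k \<alpha> vs"
    proof (cases "length vs = k")
      case True
      have "(\<Sum>i<k. \<rho> i \<alpha>) vs = (\<Sum>i<k. \<rho> i \<alpha> vs)" for k by (induction k) auto
      then show ?thesis using True by (simp add: act_def D_def \<rho>_def)
    next
      case False
      then show ?thesis using DV[OF that, of k] act_multilinear[OF I(1) that]
        by (simp add: multilinear_forms_def)
    qed
  qed
  have "weight_vectors ?V (act I) = weight_vectors ?V (D k)"
    unfolding weight_vectors_def by (intro Collect_cong conj_cong refl) (simp add: actD DV)
  ultimately show ?thesis by auto
qed

text \<open>An invariant subspace of a sum of eigenspaces contains an eigenvector: applying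
  \<open>D\<^sup>2 + (m x)\<^sup>2\<close> removes the component along \<open>x\<close>, and the last nonzero vector obtained in this way is
  an eigenvector.\<close>

lemma weight_vector_in_subspace:
  assumes D: "linear D" and T: "finite T" "\<And>x. x \<in> T \<Longrightarrow> D (D x) = - ((real (m x))\<^sup>2 *\<^sub>R x)"
    and W: "subspace W" "\<And>v. v \<in> W \<Longrightarrow> D v \<in> W" and w: "w \<in> W" "w \<noteq> 0" "w \<in> span T"
  shows "\<exists>v\<in>W. \<exists>n::nat. v \<noteq> 0 \<and> D (D v) = - ((real n)\<^sup>2 *\<^sub>R v)"
  using T w
proof (induction arbitrary: w rule: finite_induct)
  case empty
  then show ?case by simp
next
  case (insert x T)
  note Ds = linear_add[OF D] linear_diff[OF D] linear_scale[OF D] linear_neg[OF D] linear_0[OF D]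
  define w' where "w' = D (D w) + (real (m x))\<^sup>2 *\<^sub>R w"
  have w'W: "w' \<in> W" unfolding w'_def using insert.prems W by (simp add: subspace_add subspace_scale)
  obtain t where t: "w - t *\<^sub>R x \<in> span T" using insert.prems(4) by (auto simp: span_insert)
  have DT: "D (D y) \<in> span T" if "y \<in> span T" for y
    using that
  proof (induction rule: span_induct_alt)
    case base
    then show ?case by (simp add: Ds span_0)
  next
    case (step c z y)
    then show ?case using insert.prems(1)
      by (simp add: Ds span_add span_diff span_scale span_neg span_base)
  qed
  have "w' = D (D (w - t *\<^sub>R x)) + (real (m x))\<^sup>2 *\<^sub>R (w - t *\<^sub>R x)"
    by (simp add: w'_def Ds insert.prems(1) algebra_simps)
  also have "\<dots> \<in> span T" using DT t by (simp add: span_add span_scale)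
  finally have "w' \<in> span T" .
  show ?case
  proof (cases "w' = 0")
    case True
    then have "D (D w) = - ((real (m x))\<^sup>2 *\<^sub>R w)" by (simp add: w'_def eq_neg_iff_add_eq_0)
    then show ?thesis using insert.prems by blast
  next
    case False
    show ?thesis
      by (rule insert.IH[OF _ w'W False \<open>w' \<in> span T\<close>]) (use insert.prems(1) in auto)
  qed
qed

lemma act_weight_exists:
  fixes I :: "'a::real_vector \<Rightarrow> 'a"
  assumes I: "linear I" "\<And>v. I (I v) = - v"
    and W: "subspace W" "W \<subseteq> multilinear_forms k" "W \<noteq> {0}" "\<And>\<alpha>. \<alpha> \<in> W \<Longrightarrow> act I \<alpha> \<in> W"
  shows "\<exists>\<alpha>\<in>W. \<exists>m::int. \<alpha> \<noteq> 0 \<and> act I (act I \<alpha>) = - ((of_int m)\<^sup>2 *\<^sub>R \<alpha>)"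
proof -
  obtain w where w: "w \<in> W" "w \<noteq> 0" using W(3) subspace_0[OF W(1)] by blast
  then have "w \<in> span (weight_vectors (multilinear_forms k) (act I))"
    using span_weight_vectors_act[OF I, of k] W(2) by blast
  then obtain T r where T: "finite T" "T \<subseteq> weight_vectors (multilinear_forms k) (act I)"
      "w = (\<Sum>a\<in>T. r a *\<^sub>R a)"
    unfolding span_explicit by blast
  have "\<exists>m. \<forall>x\<in>T. act I (act I x) = - ((real (m x))\<^sup>2 *\<^sub>R x)"
    using T(2) unfolding weight_vectors_def by (intro bchoice) blast
  then obtain m where m: "\<And>x. x \<in> T \<Longrightarrow> act I (act I x) = - ((real (m x))\<^sup>2 *\<^sub>R x)" by blast
  have "w \<in> span T" unfolding T(3) by (intro span_sum span_scale span_base)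
  from weight_vector_in_subspace[OF linear_act T(1) m W(1,4) w this]
  obtain v and n :: nat where "v \<in> W" "v \<noteq> 0" "act I (act I v) = - ((real n)\<^sup>2 *\<^sub>R v)" by blast
  then show ?thesis by (intro bexI[of _ v] exI[of _ "int n"]) auto
qed

section \<open>An inner product on forms\<close>

text \<open>The sum of \<open>\<alpha> bs * \<beta> bs\<close> over all lists \<open>bs\<close> of \<open>k\<close> basis vectors, by recursion on the first
  slot.\<close>

primrec form_inner :: "nat \<Rightarrow> ('a::euclidean_space list \<Rightarrow> real) \<Rightarrow> ('a list \<Rightarrow> real) \<Rightarrow> real" where
  "form_inner 0 \<alpha> \<beta> = \<alpha> [] * \<beta> []"
| "form_inner (Suc k) \<alpha> \<beta> = (\<Sum>b\<in>Basis. form_inner k (\<lambda>vs. \<alpha> (b # vs)) (\<lambda>vs. \<beta> (b # vs)))"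

lemma form_inner_sym: "form_inner k \<alpha> \<beta> = form_inner k \<beta> \<alpha>"
  by (induction k arbitrary: \<alpha> \<beta>) (simp_all add: mult.commute)

lemma form_inner_nonneg: "form_inner k \<alpha> \<alpha> \<ge> 0"
  by (induction k arbitrary: \<alpha>) (simp_all add: sum_nonneg)

lemma linear_form_inner: "linear (form_inner k \<alpha>)"
proof (induction k arbitrary: \<alpha>)
  case 0
  show ?case by (rule linearI) (simp_all add: scaleR_fun_def algebra_simps)
next
  case (Suc k)
  have l: "linear (\<lambda>\<beta>. form_inner k \<gamma> (\<lambda>vs. \<beta> (b # vs)))" for \<gamma> and b :: 'a
  proof -
    have "linear (\<lambda>\<beta> vs. \<beta> (b # vs))" by (rule linearI) (auto simp: scaleR_fun_def)
    from linear_compose[OF this Suc] show ?thesis by (simp add: comp_def)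
  qed
  show ?case by (simp, intro linear_compose_sum ballI l)
qed

lemma multilinear_forms_Cons:
  assumes "\<alpha> \<in> multilinear_forms (Suc k)"
  shows "(\<lambda>vs. \<alpha> (v # vs)) \<in> multilinear_forms k" "linear (\<lambda>v. \<alpha> (v # vs))"
proof -
  show "(\<lambda>vs. \<alpha> (v # vs)) \<in> multilinear_forms k"
  proof (rule multilinear_formsI)
    show "\<alpha> (v # vs) = 0" if "length vs \<noteq> k" for vs using assms that by (simp add: multilinear_forms_def)
    fix vs :: "'a list" and i assume "length vs = k" "i < k"
    then show "linear (\<lambda>u. \<alpha> (v # vs[i := u]))"
      using multilinear_forms_slot[OF assms, of "Suc i" "v # vs"] by simp
  qed
  show "linear (\<lambda>v. \<alpha> (v # vs))" using multilinear_forms_slot[OF assms, of 0 "0 # vs"] by simp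
qed

lemma linear_eq_sum_Basis:
  fixes f :: "'a::euclidean_space \<Rightarrow> real"
  assumes "linear f"
  shows "f v = (\<Sum>b\<in>Basis. (v \<bullet> b) * f b)"
proof -
  have "f v = f (\<Sum>b\<in>Basis. (v \<bullet> b) *\<^sub>R b)" by (simp add: euclidean_representation)
  also have "\<dots> = (\<Sum>b\<in>Basis. (v \<bullet> b) * f b)" by (simp add: linear_sum[OF assms] linear_scale[OF assms])
  finally show ?thesis .
qed

lemma form_inner_definite:
  fixes \<alpha> :: "'a::euclidean_space list \<Rightarrow> real"
  assumes "\<alpha> \<in> multilinear_forms k" "form_inner k \<alpha> \<alpha> = 0"
  shows "\<alpha> = 0"
  using assms
proof (induction k arbitrary: \<alpha>)
  case 0
  have "\<alpha> vs = 0" for vs using 0 by (cases "vs = []") (auto simp: multilinear_forms_def)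
  then show ?case by (simp add: fun_eq_iff)
next
  case (Suc k)
  have b: "(\<lambda>vs. \<alpha> (b # vs)) = 0" if "b \<in> Basis" for b
    using Suc.prems(2) that
    by (intro Suc.IH multilinear_forms_Cons Suc.prems(1))
      (simp add: sum_nonneg_eq_0_iff form_inner_nonneg)
  have "\<alpha> vs = 0" for vs
  proof (cases vs)
    case Nil
    then show ?thesis using Suc.prems by (simp add: multilinear_forms_def)
  next
    case (Cons v ws)
    have "\<alpha> (v # ws) = (\<Sum>b\<in>Basis. (v \<bullet> b) * \<alpha> (b # ws))"
      by (rule linear_eq_sum_Basis[OF multilinear_forms_Cons(2)[OF Suc.prems(1)]])
    also have "\<dots> = 0" using b by (intro sum.neutral) (auto simp: fun_eq_iff)
    finally show ?thesis using Cons by simp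
  qed
  then show ?case by (simp add: fun_eq_iff)
qed

text \<open>The infinitesimal form of the fact that isometries of the vector space are isometries of the space of
  forms. In the first slot, expansion of \<open>S b\<close> in the basis moves \<open>S\<close> to the other argument.\<close>

lemma form_inner_act_skew:
  fixes S :: "'a::euclidean_space \<Rightarrow> 'a"
  assumes S: "\<And>u v. S u \<bullet> v = - (u \<bullet> S v)"
    and \<alpha>: "\<alpha> \<in> multilinear_forms k" and \<beta>: "\<beta> \<in> multilinear_forms k"
  shows "form_inner k (act S \<alpha>) \<beta> = - form_inner k \<alpha> (act S \<beta>)"
  using \<alpha> \<beta>
proof (induction k arbitrary: \<alpha> \<beta>)
  case 0
  then show ?case by (simp add: act_def)
next
  case (Suc k)
  let ?c = "\<lambda>\<alpha> v vs. \<alpha> (v # vs)"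
  have act: "?c (act S \<alpha>) v = act S (?c \<alpha> v) - ?c \<alpha> (S v)" for \<alpha> :: "'a list \<Rightarrow> real" and v
    by (auto simp: act_def fun_eq_iff sum.lessThan_Suc_shift simp del: sum.lessThan_Suc)
  have sum: "form_inner k \<gamma> (?c \<alpha> (S b)) = (\<Sum>e\<in>Basis. (S b \<bullet> e) * form_inner k \<gamma> (?c \<alpha> e))"
    if \<alpha>: "\<alpha> \<in> multilinear_forms (Suc k)" for \<alpha> \<gamma> b
  proof (rule linear_eq_sum_Basis)
    have "linear (\<lambda>v. ?c \<alpha> v)"
      using multilinear_forms_Cons(2)[OF \<alpha>]
      by (intro linearI) (auto simp: fun_eq_iff linear_iff scaleR_fun_def)
    from linear_compose[OF this linear_form_inner]
    show "linear (\<lambda>v. form_inner k \<gamma> (?c \<alpha> v))" by (simp add: comp_def)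
  qed
  note diff = linear_diff[OF linear_form_inner]
  have left: "form_inner k (\<gamma> - \<delta>) \<epsilon> = form_inner k \<gamma> \<epsilon> - form_inner k \<delta> \<epsilon>"
    for \<gamma> \<delta> \<epsilon> :: "'a list \<Rightarrow> real"
    using diff[of k \<epsilon> \<gamma> \<delta>] by (simp add: form_inner_sym[of k _ \<epsilon>])
  have cross: "(\<Sum>b\<in>Basis. form_inner k (?c \<alpha> (S b)) (?c \<beta> b)) =
      - (\<Sum>b\<in>Basis. form_inner k (?c \<alpha> b) (?c \<beta> (S b)))"
  proof -
    have "(\<Sum>b\<in>Basis. form_inner k (?c \<alpha> (S b)) (?c \<beta> b)) =
        (\<Sum>b\<in>Basis. \<Sum>e\<in>Basis. (S b \<bullet> e) * form_inner k (?c \<beta> b) (?c \<alpha> e))"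
      by (intro sum.cong refl) (subst form_inner_sym, rule sum[OF Suc.prems(1)])
    also have "\<dots> = (\<Sum>e\<in>Basis. \<Sum>b\<in>Basis. (S b \<bullet> e) * form_inner k (?c \<beta> b) (?c \<alpha> e))"
      by (rule sum.swap)
    also have "\<dots> = (\<Sum>e\<in>Basis. - (\<Sum>b\<in>Basis. (S e \<bullet> b) * form_inner k (?c \<alpha> e) (?c \<beta> b)))"
    proof (intro sum.cong refl)
      fix e :: 'a
      have "(S b \<bullet> e) * form_inner k (?c \<beta> b) (?c \<alpha> e) = - ((S e \<bullet> b) * form_inner k (?c \<alpha> e) (?c \<beta> b))" for b
        using S[of b e] form_inner_sym[of k "?c \<beta> b"] by (simp add: inner_commute)
      then show "(\<Sum>b\<in>Basis. (S b \<bullet> e) * form_inner k (?c \<beta> b) (?c \<alpha> e)) =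
          - (\<Sum>b\<in>Basis. (S e \<bullet> b) * form_inner k (?c \<alpha> e) (?c \<beta> b))"
        by (simp add: sum_negf)
    qed
    finally show ?thesis using sum[OF Suc.prems(2)] by (simp add: sum_negf)
  qed
  have IH: "form_inner k (act S (?c \<alpha> b)) (?c \<beta> b) = - form_inner k (?c \<alpha> b) (act S (?c \<beta> b))" for b
    by (intro Suc.IH multilinear_forms_Cons Suc.prems)
  show ?case
    using cross by (simp add: act left diff IH sum_subtractf sum_negf)
qed

text \<open>Products of coordinate functions \<open>v \<mapsto> v \<bullet> b\<close>, one for each slot; they witness that spaces of forms are finite-dimensional.\<close>

primrec tensor_basis :: "nat \<Rightarrow> ('a::euclidean_space list \<Rightarrow> real) set" where
  "tensor_basis 0 = {\<lambda>vs. if vs = [] then 1 else 0}"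
| "tensor_basis (Suc k) =
    (\<lambda>(b, f) vs. case vs of [] \<Rightarrow> 0 | v # ws \<Rightarrow> (v \<bullet> b) * f ws) ` (Basis \<times> tensor_basis k)"

lemma finite_tensor_basis: "finite (tensor_basis k)"
  by (induction k) auto

lemma multilinear_forms_span: "multilinear_forms k \<subseteq> span (tensor_basis k :: ('a::euclidean_space list \<Rightarrow> real) set)"
proof (induction k)
  case 0
  show ?case
  proof
    fix \<alpha> :: "'a list \<Rightarrow> real" assume "\<alpha> \<in> multilinear_forms 0"
    then have "\<alpha> = \<alpha> [] *\<^sub>R (\<lambda>vs. if vs = [] then 1 else 0)"
      by (auto simp: multilinear_forms_def fun_eq_iff scaleR_fun_def)
    also have "\<dots> \<in> span (tensor_basis 0)" by (intro span_scale span_base) simp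
    finally show "\<alpha> \<in> span (tensor_basis 0)" .
  qed
next
  case (Suc k)
  show ?case
  proof
    fix \<alpha> :: "'a list \<Rightarrow> real" assume \<alpha>: "\<alpha> \<in> multilinear_forms (Suc k)"
    define t where "t b f vs = (case vs of [] \<Rightarrow> 0 | v # ws \<Rightarrow> (v \<bullet> b) * f ws)"
      for b :: 'a and f :: "'a list \<Rightarrow> real" and vs
    have lin: "linear (t b)" for b
      by (rule linearI) (auto simp: t_def fun_eq_iff scaleR_fun_def algebra_simps split: list.split)
    have tb: "t b f \<in> span (tensor_basis (Suc k))" if "b \<in> Basis" "f \<in> multilinear_forms k" for b f
    proof -
      have "t b f \<in> t b ` span (tensor_basis k)" using that Suc by blast
      also have "\<dots> = span (t b ` tensor_basis k)" by (rule linear_span_image[OF lin, symmetric])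
      also have "\<dots> \<subseteq> span (tensor_basis (Suc k))"
        by (rule span_mono) (use that in \<open>auto simp: t_def[abs_def] image_iff\<close>)
      finally show ?thesis .
    qed
    have "\<alpha> = (\<Sum>b\<in>Basis. t b (\<lambda>vs. \<alpha> (b # vs)))"
    proof
      fix vs
      have s: "(\<Sum>b\<in>B. t b (\<lambda>vs. \<alpha> (b # vs))) vs = (\<Sum>b\<in>B. t b (\<lambda>vs. \<alpha> (b # vs)) vs)" for B
        by (induction B rule: infinite_finite_induct) auto
      show "\<alpha> vs = (\<Sum>b\<in>Basis. t b (\<lambda>vs. \<alpha> (b # vs))) vs"
        unfolding s
      proof (cases vs)
        case Nil
        then show "\<alpha> vs = (\<Sum>b\<in>Basis. t b (\<lambda>vs. \<alpha> (b # vs)) vs)"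
          using \<alpha> by (simp add: t_def multilinear_forms_def)
      next
        case (Cons v ws)
        then show "\<alpha> vs = (\<Sum>b\<in>Basis. t b (\<lambda>vs. \<alpha> (b # vs)) vs)"
          using linear_eq_sum_Basis[OF multilinear_forms_Cons(2)[OF \<alpha>], of v ws] by (simp only: t_def list.case)
      qed
    qed
    also have "\<dots> \<in> span (tensor_basis (Suc k))"
      by (intro span_sum tb multilinear_forms_Cons \<alpha>)
    finally show "\<alpha> \<in> span (tensor_basis (Suc k))" .
  qed
qed

section \<open>Quaternionic linear algebra\<close>

lemma qmult_nth [simp]:
  "(p \<star> q) $ 1 = p$1 * q$1 - p$2 * q$2 - p$3 * q$3 - p$4 * q$4"
  "(p \<star> q) $ 2 = p$1 * q$2 + p$2 * q$1 + p$3 * q$4 - p$4 * q$3"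
  "(p \<star> q) $ 3 = p$1 * q$3 - p$2 * q$4 + p$3 * q$1 + p$4 * q$2"
  "(p \<star> q) $ 4 = p$1 * q$4 + p$2 * q$3 - p$3 * q$2 + p$4 * q$1"
  by (simp_all add: qmult_def vector_def)

lemma quat_eq_iff: "p = q \<longleftrightarrow> p$1 = q$1 \<and> p$2 = q$2 \<and> p$3 = q$3 \<and> p$4 = q$4" for p q :: quat
  by (simp add: vec_eq_iff forall_4)

lemma quat_vec_eqI: "(\<And>a. u $ a = v $ a) \<Longrightarrow> u = v" for u v :: "quat^'n"
  by (simp add: vec_eq_iff)

lemma quat_basis_nth [simp]:
  "q1 $ 1 = 1" "q1 $ 2 = 0" "q1 $ 3 = 0" "q1 $ 4 = 0"
  "qi $ 1 = 0" "qi $ 2 = 1" "qi $ 3 = 0" "qi $ 4 = 0"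
  "qj $ 1 = 0" "qj $ 2 = 0" "qj $ 3 = 1" "qj $ 4 = 0"
  "qk $ 1 = 0" "qk $ 2 = 0" "qk $ 3 = 0" "qk $ 4 = 1"
  by (simp_all add: q1_def qi_def qj_def qk_def axis_def)

lemma qmult_assoc: "(p \<star> q) \<star> r = p \<star> (q \<star> r)"
  by (simp add: quat_eq_iff algebra_simps)

lemma qmult_add_right: "p \<star> (q + r) = p \<star> q + p \<star> r"
  and qmult_add_left: "(p + q) \<star> r = p \<star> r + q \<star> r"
  and qmult_scaleR_right: "p \<star> (t *\<^sub>R q) = t *\<^sub>R (p \<star> q)"
  and qmult_scaleR_left: "(t *\<^sub>R p) \<star> q = t *\<^sub>R (p \<star> q)"
  by (simp_all add: quat_eq_iff algebra_simps)

lemma qmult_0 [simp]: "p \<star> 0 = 0" "0 \<star> p = 0"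
  by (simp_all add: quat_eq_iff)

lemma qmult_sum_right: "p \<star> (\<Sum>x\<in>X. f x) = (\<Sum>x\<in>X. p \<star> f x)"
  by (induction X rule: infinite_finite_induct) (simp_all add: qmult_add_right)

lemma linear_left_mult: "linear (left_mult q)"
  by (rule linearI; rule quat_vec_eqI) (simp_all add: left_mult_def qmult_add_right qmult_scaleR_right)

lemma left_mult_left_mult: "left_mult p (left_mult q v) = left_mult (p \<star> q) v"
  by (simp add: left_mult_def qmult_assoc)

lemma left_mult_right_mult: "left_mult p (right_mult B v) = right_mult B (left_mult p v)"
  by (simp add: left_mult_def right_mult_def qmult_sum_right qmult_assoc)

lemma left_mult_add: "left_mult (p + q) v = left_mult p v + left_mult q v"
  by (rule quat_vec_eqI) (simp add: left_mult_def qmult_add_left)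

lemma left_mult_scaleR: "left_mult (t *\<^sub>R p) v = t *\<^sub>R left_mult p v"
  by (rule quat_vec_eqI) (simp add: left_mult_def qmult_scaleR_left)

lemma left_mult_skew:
  assumes "q $ 1 = 0"
  shows "left_mult q u \<bullet> v = - (u \<bullet> left_mult q v)"
  unfolding inner_vec_def[of "left_mult q u"] inner_vec_def[of u] sum_negf[symmetric]
  by (intro sum.cong refl) (simp add: left_mult_def inner_vec_def sum_4 assms algebra_simps)

lemma imaginary_quat:
  assumes "q $ 1 = 0"
  shows "q = q$2 *\<^sub>R qi + q$3 *\<^sub>R qj + q$4 *\<^sub>R qk"
  using assms by (simp add: quat_eq_iff)

lemma qmult_units: "qi \<star> qj = qk" "qj \<star> qi = - qk" "qj \<star> qk = qi" "qk \<star> qj = - qi"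
  "qk \<star> qi = qj" "qi \<star> qk = - qj"
  "qi \<star> qi = - q1" "qj \<star> qj = - q1" "qk \<star> qk = - q1"
  by (simp_all add: quat_eq_iff)

lemma left_mult_q1: "left_mult q1 v = v"
  by (rule quat_vec_eqI) (simp add: left_mult_def quat_eq_iff)

section \<open>The sp(1)-module of forms determined by a frame\<close>

definition form_casimir :: "(quat^'n \<Rightarrow> quat^'n) \<Rightarrow> ((quat^'n) list \<Rightarrow> real) \<Rightarrow> (quat^'n) list \<Rightarrow> real" where
  "form_casimir s \<alpha> = act (acs s qi) (act (acs s qi) \<alpha>) + act (acs s qj) (act (acs s qj) \<alpha>)
    + act (acs s qk) (act (acs s qk) \<alpha>)"

definition pullback :: "('a \<Rightarrow> 'b) \<Rightarrow> ('b list \<Rightarrow> real) \<Rightarrow> 'a list \<Rightarrow> real" where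
  "pullback s \<alpha> vs = \<alpha> (map s vs)"

lemma linear_pullback: "linear (pullback s)"
  by (rule linearI) (auto simp: pullback_def scaleR_fun_def)

lemma pullback_multilinear:
  assumes s: "linear s" and \<alpha>: "\<alpha> \<in> multilinear_forms k"
  shows "pullback s \<alpha> \<in> multilinear_forms k"
proof (rule multilinear_formsI)
  show "pullback s \<alpha> vs = 0" if "length vs \<noteq> k" for vs
    using \<alpha> that by (simp add: pullback_def multilinear_forms_def)
  fix vs :: "'a list" and i assume "length vs = k" "i < k"
  then have "linear ((\<lambda>u. \<alpha> ((map s vs)[i := u])) \<circ> s)"
    by (intro linear_compose[OF s multilinear_forms_slot[OF \<alpha>]]) simp
  then show "linear (\<lambda>u. pullback s \<alpha> (vs[i := u]))"
    by (simp add: pullback_def comp_def map_update)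
qed

lemma pullback_alt_forms:
  assumes s: "linear s" and \<alpha>: "\<alpha> \<in> alt_forms k"
  shows "pullback s \<alpha> \<in> alt_forms k"
proof (rule alt_formsI[OF pullback_multilinear[OF s alt_forms_multilinear[OF \<alpha>]]])
  fix vs :: "'a list" and i j
  assume "length vs = k" "i < j" "j < k" "vs ! i = vs ! j"
  then show "pullback s \<alpha> vs = 0"
    unfolding pullback_def by (intro alt_forms_eq_0[OF \<alpha>, of i _ j]) auto
qed

text \<open>Pulling back along a frame replaces the varying endomorphisms \<open>acs s q\<close> by the constant ones
  \<open>left_mult q\<close>.\<close>

lemma pullback_act:
  assumes "\<And>v. s (T v) = S (s v)"
  shows "pullback s (act S \<alpha>) = act T (pullback s \<alpha>)"
  by (auto simp: pullback_def act_def fun_eq_iff map_update assms intro!: sum.cong)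

lemma pullback_inj:
  assumes "surj s"
  shows "pullback s \<alpha> = pullback s \<beta> \<longleftrightarrow> \<alpha> = \<beta>"
proof
  assume *: "pullback s \<alpha> = pullback s \<beta>"
  show "\<alpha> = \<beta>"
  proof
    fix vs
    have "map s (map (inv s) vs) = vs" using assms by (simp add: comp_def surj_f_inv_f)
    then show "\<alpha> vs = \<beta> vs" using fun_cong[OF *, of "map (inv s) vs"] by (simp only: pullback_def)
  qed
qed simp

locale frame =
  fixes s :: "quat^'n::finite \<Rightarrow> quat^'n"
  assumes linear_s: "linear s" and bij_s: "bij s"
begin

lemma s_inv [simp]: "s (inv s v) = v" "inv s (s v) = v"
  using bij_s by (simp_all add: bij_is_surj surj_f_inv_f bij_is_inj inv_f_f)

lemma linear_inv_s: "linear (inv s)"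
proof (rule linearI)
  fix x y and t :: real
  have "inv s (s (inv s x) + s (inv s y)) = inv s x + inv s y"
    unfolding linear_add[OF linear_s, symmetric] by (rule s_inv)
  then show "inv s (x + y) = inv s x + inv s y" by simp
  have "inv s (t *\<^sub>R s (inv s x)) = t *\<^sub>R inv s x"
    unfolding linear_scale[OF linear_s, symmetric] by (rule s_inv)
  then show "inv s (t *\<^sub>R x) = t *\<^sub>R inv s x" by simp
qed

lemma linear_acs: "linear (acs s q)"
  unfolding acs_def by (intro linear_compose linear_inv_s linear_left_mult linear_s)

lemma acs_acs: "acs s p (acs s q v) = acs s (p \<star> q) v"
  by (simp add: acs_def left_mult_left_mult)

lemma acs_scaleR: "acs s (t *\<^sub>R q) v = t *\<^sub>R acs s q v"
  by (simp add: acs_def left_mult_scaleR linear_scale[OF linear_s])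

lemma acs_minus: "acs s (- q) v = - acs s q v"
  using acs_scaleR[of "-1" q v] by simp

lemma acs_add: "acs s (p + q) v = acs s p v + acs s q v"
  by (simp add: acs_def left_mult_add linear_add[OF linear_s])

lemma acs_q1: "acs s q1 v = v"
  by (simp add: acs_def left_mult_q1)

lemma s_left_mult: "s (left_mult q v) = acs s q (s v)"
  by (simp add: acs_def)

lemma act_acs_commutator:
  assumes "\<alpha> \<in> multilinear_forms k" "p \<star> q = r" "q \<star> p = - r"
  shows "act (acs s p) (act (acs s q) \<alpha>) - act (acs s q) (act (acs s p) \<alpha>) = 2 *\<^sub>R act (acs s r) \<alpha>"
proof -
  have "(\<lambda>v. acs s p (acs s q v) - acs s q (acs s p v)) = (\<lambda>v. 2 *\<^sub>R acs s r v)"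
    by (simp only: acs_acs assms acs_minus scaleR_2 diff_minus_eq_add)
  then show ?thesis using act_commutator[OF assms(1), of "acs s p" "acs s q"]
      act_scale_endo[OF assms(1), of 2 "acs s r"] by simp
qed

lemma act_acs_imaginary:
  assumes "\<alpha> \<in> multilinear_forms k" "q $ 1 = 0"
  shows "act (acs s q) \<alpha> = q$2 *\<^sub>R act (acs s qi) \<alpha> + q$3 *\<^sub>R act (acs s qj) \<alpha> + q$4 *\<^sub>R act (acs s qk) \<alpha>"
proof -
  have "acs s q = (\<lambda>v. q$2 *\<^sub>R acs s qi v + q$3 *\<^sub>R acs s qj v + q$4 *\<^sub>R acs s qk v)"
    by (subst imaginary_quat[OF assms(2)]) (simp add: fun_eq_iff acs_add acs_scaleR)
  then show ?thesis
    by (simp add: act_plus_endo[OF assms(1)] act_scale_endo[OF assms(1)])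
qed

text \<open>The inner product of forms induced by the one on the tangent space that makes the frame an isometry.\<close>

definition inner_form :: "nat \<Rightarrow> ((quat^'n) list \<Rightarrow> real) \<Rightarrow> ((quat^'n) list \<Rightarrow> real) \<Rightarrow> real" where
  "inner_form k \<alpha> \<beta> = form_inner k (pullback s \<alpha>) (pullback s \<beta>)"

lemma inner_form_skew:
  assumes "q $ 1 = 0" "\<alpha> \<in> alt_forms k" "\<beta> \<in> alt_forms k"
  shows "inner_form k (act (acs s q) \<alpha>) \<beta> = - inner_form k \<alpha> (act (acs s q) \<beta>)"
  unfolding inner_form_def pullback_act[of s "left_mult q", OF s_left_mult]
  by (intro form_inner_act_skew left_mult_skew pullback_multilinear linear_s alt_forms_multilinear assms)

lemma sp1_module:
  "sp1_module (alt_forms k) (act (acs s qi)) (act (acs s qj)) (act (acs s qk)) (inner_form k) (tensor_basis k)"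
proof (rule sp1_module.intro)
  show "inner_form k u v = inner_form k v u" for u v
    unfolding inner_form_def by (rule form_inner_sym)
  show "linear (inner_form k u)" for u
    unfolding inner_form_def
    using linear_compose[OF linear_pullback[of s] linear_form_inner[of k "pullback s u"]] by (simp add: comp_def)
  show "inner_form k u u \<ge> 0" for u
    unfolding inner_form_def by (rule form_inner_nonneg)
  show "v = 0" if "v \<in> alt_forms k" "inner_form k v v = 0" for v
  proof -
    have "pullback s v = 0"
      using that unfolding inner_form_def
      by (intro form_inner_definite[of _ k] pullback_multilinear linear_s alt_forms_multilinear)
    then have "pullback s v = pullback s 0" by (simp add: linear_0[OF linear_pullback])
    then show ?thesis using pullback_inj[OF bij_is_surj[OF bij_s]] by blast
  qed
  show "alt_forms k \<subseteq> span (tensor_basis k :: ((quat^'n) list \<Rightarrow> real) set)"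
    using multilinear_forms_span alt_forms_multilinear by blast
  show "\<exists>w\<in>W. \<exists>m::int. w \<noteq> 0 \<and> act (acs s qi) (act (acs s qi) w) = - ((of_int m)\<^sup>2 *\<^sub>R w)"
    if "subspace W" "W \<subseteq> alt_forms k" "W \<noteq> {0}" "\<And>v. v \<in> W \<Longrightarrow> act (acs s qi) v \<in> W" for W
  proof (rule act_weight_exists)
    show "acs s qi (acs s qi v) = - v" for v
      by (simp add: acs_acs qmult_units acs_minus acs_q1)
    show "W \<subseteq> multilinear_forms k" using that(2) alt_forms_multilinear by blast
  qed (use that linear_acs in auto)
qed (auto intro: subspace_alt_forms linear_act act_alt_forms linear_acs finite_tensor_basis
    act_acs_commutator[OF alt_forms_multilinear] inner_form_skew simp: qmult_units)

interpretation forms: sp1_module "alt_forms k" "act (acs s qi)" "act (acs s qj)" "act (acs s qk)"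
  "inner_form k" "tensor_basis k" for k
  by (rule sp1_module)

lemma invariant_iff: "forms.invariant k W \<longleftrightarrow> invariant_subspace s k W"
  by (auto simp: forms.invariant_def invariant_subspace_def)

lemma irreducible_iff: "forms.irreducible k W \<longleftrightarrow> irreducible_subrep s k W"
  unfolding forms.irreducible_def irreducible_subrep_def invariant_iff ..

lemma highest_iff: "forms.highest W r \<longleftrightarrow> highest_weight s W r"
  unfolding forms.highest_def highest_weight_def forms.weight_def is_weight_def ..

lemma casimir_eq: "forms.casimir = form_casimir s"
  by (auto simp: forms.casimir_def form_casimir_def fun_eq_iff)

lemma span_irreducible_highest:
  assumes "r \<ge> 0"
  shows "span (\<Union>{W. irreducible_subrep s k W \<and> highest_weight s W r}) =
    {\<alpha> \<in> alt_forms k. form_casimir s \<alpha> = - (of_int (r * (r + 2)) *\<^sub>R \<alpha>)}"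
  using forms.isotypic_eq_casimir_eigenspace[OF assms, of k]
  unfolding irreducible_iff highest_iff casimir_eq .

text \<open>Used for \<open>r = 0\<close>, where the decomposition of \<open>V\<^sup>* \<otimes> E\<close> has a formal summand of highest weight
  \<open>-1\<close>, that is, of Casimir eigenvalue \<open>1\<close>.\<close>

lemma form_casimir_nonpos:
  assumes "\<alpha> \<in> alt_forms k" "form_casimir s \<alpha> = t *\<^sub>R \<alpha>" "t > 0"
  shows "\<alpha> = 0"
  using forms.casimir_nonpos[of \<alpha> k t] assms unfolding casimir_eq by blast

lemma form_casimir_commute:
  assumes "\<alpha> \<in> alt_forms k" "q \<in> {qi, qj, qk}"
  shows "form_casimir s (act (acs s q) \<alpha>) = act (acs s q) (form_casimir s \<alpha>)"
  using forms.casimir_commute[OF assms(1)] assms(2) unfolding casimir_eq by blast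

lemma linear_form_casimir: "linear (form_casimir s)"
  using forms.linear_casimir unfolding casimir_eq .

text \<open>The decomposition \<open>V\<^sub>1 \<otimes> V\<^sub>r = V\<^sub>r\<^sub>+\<^sub>1 \<oplus> V\<^sub>r\<^sub>-\<^sub>1\<close>. On \<open>V\<^sup>* \<otimes> \<Lambda>\<^sup>k\<close> the Casimir operator is
  \<open>-3 + C + 2T\<close>, where \<open>-3\<close> and \<open>C\<close> are those of the factors and \<open>T\<close> is the mixed term
  \<open>I \<otimes> I + J \<otimes> J + K \<otimes> K\<close>. As \<open>IJ = K\<close> on covectors, \<open>T\<^sup>2 = 2T - C\<close>. With \<open>C = -r(r + 2)\<close> the
  eigenvalues of \<open>T\<close> are \<open>-r\<close> and \<open>r + 2\<close>, and the Casimir operator takes the values \<open>-(r + 1)(r + 3)\<close> and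
  \<open>-(r - 1)(r + 1)\<close>. The wedge product is equivariant, so these values persist on \<open>\<Lambda>\<^sup>k\<^sup>+\<^sup>1\<close>.\<close>

lemma alternation_isotypic:
  fixes \<gamma> :: "quat^'n \<Rightarrow> (quat^'n) list \<Rightarrow> real" and r :: int
  assumes lin: "linear \<gamma>" and alt: "\<And>u. \<gamma> u \<in> alt_forms k"
    and cas: "\<And>u. form_casimir s (\<gamma> u) = - (of_int (r * (r + 2)) *\<^sub>R \<gamma> u)" and r: "r \<ge> 0"
  shows "\<exists>\<theta>\<in>alt_forms (Suc k). \<exists>\<eta>\<in>alt_forms (Suc k). alternation \<gamma> = \<theta> + \<eta> \<and>
    form_casimir s \<theta> = - (of_int ((r + 1) * (r + 3)) *\<^sub>R \<theta>) \<and>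
    form_casimir s \<eta> = - (of_int ((r - 1) * (r + 1)) *\<^sub>R \<eta>)"
proof -
  let ?I = "acs s qi" and ?J = "acs s qj" and ?K = "acs s qk"
  note act_simps = act_add act_diff act_scaleR linear_neg[OF linear_act]
  define T where "T \<delta> u = - (act ?I (\<delta> (?I u)) + act ?J (\<delta> (?J u)) + act ?K (\<delta> (?K u)))"
    for \<delta> :: "quat^'n \<Rightarrow> (quat^'n) list \<Rightarrow> real" and u
  define R where "R = (of_int r :: real)"
  have linT: "linear (T \<gamma>)"
  proof -
    have "linear (\<lambda>u. act (acs s q) (\<gamma> (acs s q u)))" for q
      using linear_compose[OF linear_compose[OF linear_acs[of q] lin] linear_act[of "acs s q"]]
      by (simp add: comp_def)
    then show ?thesis unfolding T_def by (intro linear_compose_neg linear_compose_add)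
  qed
  have altT: "T \<gamma> u \<in> alt_forms k" for u
    unfolding T_def
    by (intro subspace_neg subspace_add subspace_alt_forms act_alt_forms linear_acs alt)
  have casT: "form_casimir s (T \<gamma> u) = - (of_int (r * (r + 2)) *\<^sub>R T \<gamma> u)" for u
    unfolding T_def linear_neg[OF linear_form_casimir] linear_add[OF linear_form_casimir]
    by (simp add: form_casimir_commute[OF alt] cas act_simps algebra_simps)
  have TT: "T (T \<gamma>) u = (R * (R + 2)) *\<^sub>R \<gamma> u + 2 *\<^sub>R T \<gamma> u" for u
  proof -
    note m = alt_forms_multilinear[OF alt]
    have c: "act ?I (act ?J (\<gamma> v)) = act ?J (act ?I (\<gamma> v)) + 2 *\<^sub>R act ?K (\<gamma> v)"
      "act ?J (act ?K (\<gamma> v)) = act ?K (act ?J (\<gamma> v)) + 2 *\<^sub>R act ?I (\<gamma> v)"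
      "act ?K (act ?I (\<gamma> v)) = act ?I (act ?K (\<gamma> v)) + 2 *\<^sub>R act ?J (\<gamma> v)" for v
      using act_acs_commutator[OF m, of qi qj qk v] act_acs_commutator[OF m, of qj qk qi v]
        act_acs_commutator[OF m, of qk qi qj v]
      by (simp_all add: qmult_units diff_eq_eq add.commute)
    have "form_casimir s (\<gamma> u) = - ((R * (R + 2)) *\<^sub>R \<gamma> u)" using cas by (simp add: R_def)
    then have e: "(R * (R + 2)) *\<^sub>R \<gamma> u = - form_casimir s (\<gamma> u)" by simp
    show ?thesis
      unfolding e form_casimir_def T_def
      by (simp add: acs_acs qmult_units acs_minus acs_q1 linear_neg[OF lin] act_simps c algebra_simps scaleR_2)
  qed
  have cas_alt: "form_casimir s (alternation \<delta>) =
      alternation (\<lambda>u. form_casimir s (\<delta> u) + 2 *\<^sub>R T \<delta> u - 3 *\<^sub>R \<delta> u)"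
    if lin: "linear \<delta>" for \<delta>
  proof -
    have three: "3 *\<^sub>R \<alpha> = \<alpha> + \<alpha> + \<alpha>" for \<alpha> :: "(quat^'n) list \<Rightarrow> real"
      using scaleR_add_left[of 2 1 \<alpha>] by (simp add: scaleR_2)
    show ?thesis
      unfolding form_casimir_def act_alternation alternation_add[symmetric] T_def three
      by (simp add: acs_acs qmult_units acs_minus acs_q1 linear_neg[OF lin] act_simps algebra_simps scaleR_2)
  qed
  have eig: "form_casimir s (alternation \<delta>) = (- (R * (R + 2)) + 2 * t - 3) *\<^sub>R alternation \<delta>"
    if "linear \<delta>" "\<And>u. form_casimir s (\<delta> u) = - ((R * (R + 2)) *\<^sub>R \<delta> u)" "\<And>u. T \<delta> u = t *\<^sub>R \<delta> u"
    for \<delta> t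
    unfolding cas_alt[OF that(1)] alternation_scaleR[symmetric]
    by (rule arg_cong[where f=alternation]) (simp add: that(2,3) fun_eq_iff scaleR_fun_def algebra_simps)
  \<comment> \<open>The spectral projections of \<open>T\<close> for \<open>-r\<close> and \<open>r + 2\<close>, whose difference is \<open>2r + 2\<close>.\<close>
  define d where "d = 1 / (2 * R + 2)"
  define \<gamma>p where "\<gamma>p u = d *\<^sub>R ((R + 2) *\<^sub>R \<gamma> u - T \<gamma> u)" for u
  define \<gamma>m where "\<gamma>m u = d *\<^sub>R (R *\<^sub>R \<gamma> u + T \<gamma> u)" for u
  have R: "R \<ge> 0" using r by (simp add: R_def)
  have linp: "linear \<gamma>p" and linm: "linear \<gamma>m"
    unfolding \<gamma>p_def \<gamma>m_def
    by (intro linear_compose_scale_right linear_compose_sub linear_compose_add lin linT)+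
  have altp: "\<gamma>p u \<in> alt_forms k" and altm: "\<gamma>m u \<in> alt_forms k" for u
    unfolding \<gamma>p_def \<gamma>m_def
    by (intro subspace_scale subspace_diff subspace_add subspace_alt_forms alt altT)+
  have T_lin: "T (\<lambda>u. x *\<^sub>R \<delta> u + y *\<^sub>R \<epsilon> u) u = x *\<^sub>R T \<delta> u + y *\<^sub>R T \<epsilon> u" for x y \<delta> \<epsilon> u
    unfolding T_def by (simp add: act_simps algebra_simps)
  have p: "\<gamma>p = (\<lambda>u. (d * (R + 2)) *\<^sub>R \<gamma> u + (- d) *\<^sub>R T \<gamma> u)"
    and m: "\<gamma>m = (\<lambda>u. (d * R) *\<^sub>R \<gamma> u + d *\<^sub>R T \<gamma> u)"
    by (simp_all add: \<gamma>p_def \<gamma>m_def fun_eq_iff algebra_simps)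
  have cas': "form_casimir s (x *\<^sub>R \<gamma> u + y *\<^sub>R T \<gamma> u) = - ((R * (R + 2)) *\<^sub>R (x *\<^sub>R \<gamma> u + y *\<^sub>R T \<gamma> u))" for x y u
    unfolding linear_add[OF linear_form_casimir] linear_scale[OF linear_form_casimir] cas casT R_def
    by (simp add: algebra_simps)
  have Tp: "T \<gamma>p u = (- R) *\<^sub>R \<gamma>p u" and Tm: "T \<gamma>m u = (R + 2) *\<^sub>R \<gamma>m u" for u
    unfolding p m T_lin TT by (simp_all add: algebra_simps)
  have sum: "\<gamma> u = \<gamma>p u + \<gamma>m u" for u
  proof -
    have "\<gamma>p u + \<gamma>m u = (d * (2 * R + 2)) *\<^sub>R \<gamma> u"
      by (simp add: \<gamma>p_def \<gamma>m_def fun_eq_iff scaleR_fun_def algebra_simps)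
    then show ?thesis using R by (simp add: d_def)
  qed
  show ?thesis
  proof (intro bexI conjI)
    show "alternation \<gamma> = alternation \<gamma>p + alternation \<gamma>m"
      unfolding alternation_add[symmetric] by (rule arg_cong[where f=alternation]) (simp add: sum fun_eq_iff)
    show "form_casimir s (alternation \<gamma>p) = - (of_int ((r + 1) * (r + 3)) *\<^sub>R alternation \<gamma>p)"
      unfolding eig[OF linp cas'[of "d * (R + 2)" _ "- d", folded p[THEN fun_cong]] Tp]
      unfolding scaleR_minus_left[symmetric]
      by (rule arg_cong[where f="\<lambda>t. t *\<^sub>R _"]) (simp add: R_def algebra_simps)
    show "form_casimir s (alternation \<gamma>m) = - (of_int ((r - 1) * (r + 1)) *\<^sub>R alternation \<gamma>m)"
      unfolding eig[OF linm cas'[of "d * R" _ d, folded m[THEN fun_cong]] Tm]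
      unfolding scaleR_minus_left[symmetric]
      by (rule arg_cong[where f="\<lambda>t. t *\<^sub>R _"]) (simp add: R_def algebra_simps)
    show "alternation \<gamma>p \<in> alt_forms (Suc k)" "alternation \<gamma>m \<in> alt_forms (Suc k)"
      by (intro alternation_alt_forms altp altm linp linm)+
  qed
qed

end

section \<open>Independence of the frame\<close>

definition qconj :: "quat \<Rightarrow> quat" where "qconj p = (2 * p$1) *\<^sub>R q1 - p"

lemma qconj_mult:
  assumes "norm p = 1"
  shows "qconj p \<star> p = q1" "(p$1)\<^sup>2 + (p$2)\<^sup>2 + (p$3)\<^sup>2 + (p$4)\<^sup>2 = 1"
proof -
  have "p \<bullet> p = 1" using assms by (simp add: norm_eq_1)
  then show "(p$1)\<^sup>2 + (p$2)\<^sup>2 + (p$3)\<^sup>2 + (p$4)\<^sup>2 = 1"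
    by (simp add: inner_vec_def sum_4 power2_eq_square)
  then show "qconj p \<star> p = q1"
    by (simp add: quat_eq_iff qconj_def power2_eq_square algebra_simps)
qed

text \<open>The components of the images of \<open>i, j, k\<close> under conjugation by a unit quaternion form an orthogonal
  matrix.\<close>

lemma rotation_orthonormal:
  fixes p :: quat
  defines "m \<equiv> \<lambda>q. p \<star> q \<star> qconj p"
  assumes p: "norm p = 1"
  shows "m qi $ 1 = 0" "m qj $ 1 = 0" "m qk $ 1 = 0"
    "(m qi $ 2)\<^sup>2 + (m qj $ 2)\<^sup>2 + (m qk $ 2)\<^sup>2 = 1"
    "(m qi $ 3)\<^sup>2 + (m qj $ 3)\<^sup>2 + (m qk $ 3)\<^sup>2 = 1"
    "(m qi $ 4)\<^sup>2 + (m qj $ 4)\<^sup>2 + (m qk $ 4)\<^sup>2 = 1"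
    "m qi $ 2 * m qi $ 3 + m qj $ 2 * m qj $ 3 + m qk $ 2 * m qk $ 3 = 0"
    "m qi $ 2 * m qi $ 4 + m qj $ 2 * m qj $ 4 + m qk $ 2 * m qk $ 4 = 0"
    "m qi $ 3 * m qi $ 4 + m qj $ 3 * m qj $ 4 + m qk $ 3 * m qk $ 4 = 0"
  using qconj_mult(2)[OF p] unfolding m_def
  by (simp_all add: qconj_def, algebra+, simp_all add: algebra_simps)

text \<open>\<open>GL(n,H)\<close> commutes with left multiplications, and \<open>Sp(1)\<close> conjugates them. So another frame rotates
  \<open>I, J, K\<close>, and a sum of three squares is invariant under rotations.\<close>

lemma form_casimir_frame_change:
  fixes s h :: "quat^'n::finite \<Rightarrow> quat^'n"
  assumes s: "linear s" "bij s" and h: "h \<in> Sp1GL" and bij: "bij (s \<circ> h)" and \<alpha>: "\<alpha> \<in> alt_forms k"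
  shows "form_casimir (s \<circ> h) \<alpha> = form_casimir s \<alpha>"
proof -
  interpret frame s by (rule frame.intro) (fact s)+
  obtain p B where p: "norm p = 1" and hpB: "h = left_mult p \<circ> right_mult B"
    using h by (auto simp: Sp1GL_def)
  define m where "m q = p \<star> q \<star> qconj p" for q
  have mp: "m q \<star> p = p \<star> q" for q
    by (simp add: m_def qmult_assoc qconj_mult(1)[OF p]) (simp add: quat_eq_iff)
  have hq: "h (left_mult q v) = left_mult (m q) (h v)" for q v
    by (simp add: hpB left_mult_left_mult flip: left_mult_right_mult) (simp add: mp)
  have acs: "acs (s \<circ> h) q = acs s (m q)" for q
  proof
    fix v
    obtain w where w: "v = s (h w)" using bij by (metis bij_pointE comp_apply)
    have "inv (s \<circ> h) (s (h w)) = w" using bij by (metis bij_inv_eq_iff comp_apply)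
    then show "acs (s \<circ> h) q v = acs s (m q) v" by (simp add: acs_def w hq)
  qed
  note \<alpha>m = alt_forms_multilinear[OF \<alpha>]
  note rot = rotation_orthonormal[OF p, folded m_def]
  let ?A = "act (acs s qi)" and ?B = "act (acs s qj)" and ?C = "act (acs s qk)"
  have sq: "act (acs s q) (act (acs s q) \<alpha>) =
      (q$2)\<^sup>2 *\<^sub>R ?A (?A \<alpha>) + (q$3)\<^sup>2 *\<^sub>R ?B (?B \<alpha>) + (q$4)\<^sup>2 *\<^sub>R ?C (?C \<alpha>)
      + (q$2 * q$3) *\<^sub>R (?A (?B \<alpha>) + ?B (?A \<alpha>)) + (q$2 * q$4) *\<^sub>R (?A (?C \<alpha>) + ?C (?A \<alpha>))
      + (q$3 * q$4) *\<^sub>R (?B (?C \<alpha>) + ?C (?B \<alpha>))" if "q $ 1 = 0" for q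
    by (simp add: act_acs_imaginary[OF act_multilinear[OF linear_acs \<alpha>m] that]
      act_acs_imaginary[OF \<alpha>m that] act_add act_scaleR power2_eq_square algebra_simps)
  have "form_casimir (s \<circ> h) \<alpha> =
      ((m qi $ 2)\<^sup>2 + (m qj $ 2)\<^sup>2 + (m qk $ 2)\<^sup>2) *\<^sub>R ?A (?A \<alpha>)
    + ((m qi $ 3)\<^sup>2 + (m qj $ 3)\<^sup>2 + (m qk $ 3)\<^sup>2) *\<^sub>R ?B (?B \<alpha>)
    + ((m qi $ 4)\<^sup>2 + (m qj $ 4)\<^sup>2 + (m qk $ 4)\<^sup>2) *\<^sub>R ?C (?C \<alpha>)
    + (m qi $ 2 * m qi $ 3 + m qj $ 2 * m qj $ 3 + m qk $ 2 * m qk $ 3) *\<^sub>R (?A (?B \<alpha>) + ?B (?A \<alpha>))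
    + (m qi $ 2 * m qi $ 4 + m qj $ 2 * m qj $ 4 + m qk $ 2 * m qk $ 4) *\<^sub>R (?A (?C \<alpha>) + ?C (?A \<alpha>))
    + (m qi $ 3 * m qi $ 4 + m qj $ 3 * m qj $ 4 + m qk $ 3 * m qk $ 4) *\<^sub>R (?B (?C \<alpha>) + ?C (?B \<alpha>))"
    unfolding form_casimir_def acs sq[OF rot(1)] sq[OF rot(2)] sq[OF rot(3)]
    by (simp only: scaleR_add_left ac_simps)
  then show ?thesis unfolding rot by (simp add: form_casimir_def)
qed

lemma E_eq_casimir_eigenspace:
  fixes P :: "('m, 'n::finite) frames"
  assumes P: "Sp1GL_structure A P" "c \<in> A" "x \<in> cimage c" and s: "s \<in> P c x" and r: "r \<ge> 0"
  shows "E P k r c x = {\<alpha> \<in> alt_forms k. form_casimir s \<alpha> = - (of_int (r * (r + 2)) *\<^sub>R \<alpha>)}"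
    (is "_ = ?U s")
proof -
  have lb: "linear s'" "bij s'" "P c x = {s' \<circ> h | h. h \<in> Sp1GL}" if "s' \<in> P c x" for s'
    using P that unfolding Sp1GL_structure_def by blast+
  have U: "span (\<Union>{W. irreducible_subrep s' k W \<and> highest_weight s' W r}) = ?U s" if s': "s' \<in> P c x" for s'
  proof -
    interpret s': frame s' using lb(1,2)[OF s'] by (rule frame.intro)
    obtain h where h: "h \<in> Sp1GL" "s' = s \<circ> h" using lb(3)[OF s] s' by auto
    have "form_casimir s' \<alpha> = form_casimir s \<alpha>" if "\<alpha> \<in> alt_forms k" for \<alpha>
      unfolding h(2) by (rule form_casimir_frame_change[OF lb(1,2)[OF s] h(1) _ that]) (use lb s' h in auto)
    then show ?thesis unfolding s'.span_irreducible_highest[OF r] by auto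
  qed
  let ?G = "\<lambda>s'. \<Union>{W. irreducible_subrep s' k W \<and> highest_weight s' W r}"
  show ?thesis
  proof
    have "?G s' \<subseteq> ?U s" if "s' \<in> P c x" for s'
      using span_superset[of "?G s'"] U[OF that] by simp
    moreover have "subspace (?U s)" using U[OF s] subspace_span by metis
    ultimately show "E P k r c x \<subseteq> ?U s" unfolding E_def by (intro span_minimal) blast+
    show "?U s \<subseteq> E P k r c x"
      unfolding E_def U[OF s, symmetric] by (rule span_mono) (use s in blast)
  qed
qed

section \<open>Conformal endomorphisms in dimension four\<close>

text \<open>\<open>co(4) = \<real> \<oplus> so(4)\<close>, and left and right multiplications by imaginary quaternions span \<open>so(4)\<close>. The
  components of \<open>p\<close> and \<open>q\<close> solve the linear equations that \<open>f v = p v + v q\<close> imposes on the matrix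
  of \<open>f\<close> in the basis \<open>1, i, j, k\<close>.\<close>

lemma conformal_endomorphism_in_sp1gl:
  fixes f :: "quat^'n::finite \<Rightarrow> quat^'n"
  assumes n: "CARD('n) = 1" and lin: "linear f"
    and conf: "\<And>u v. f u \<bullet> v + u \<bullet> f v = l * (u \<bullet> v)"
  shows "f \<in> sp1gl"
proof -
  obtain a :: 'n where a: "UNIV = {a}" using n by (metis card_1_singletonE)
  have eqI: "u = v" if "u $ a = v $ a" for u v :: "quat^'n"
    using that a by (intro quat_vec_eqI) (metis UNIV_I singletonD)
  define e where "e q = (\<chi> b::'n. q)" for q :: quat
  have inner: "u \<bullet> v = u $ a $ 1 * v $ a $ 1 + u $ a $ 2 * v $ a $ 2 + u $ a $ 3 * v $ a $ 3 + u $ a $ 4 * v $ a $ 4"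
    for u v :: "quat^'n"
    by (simp add: inner_vec_def a sum_4)
  define m where "m p = f (e p) $ a" for p
  have m: "m p \<bullet> q + p \<bullet> m q = l * (p \<bullet> q)" for p q
    using conf[of "e p" "e q"] by (simp add: inner m_def e_def) (simp add: inner_vec_def sum_4)
  have fm: "f v $ a = v$a$1 *\<^sub>R m q1 + v$a$2 *\<^sub>R m qi + v$a$3 *\<^sub>R m qj + v$a$4 *\<^sub>R m qk" for v
  proof -
    have "v = v$a$1 *\<^sub>R e q1 + v$a$2 *\<^sub>R e qi + v$a$3 *\<^sub>R e qj + v$a$4 *\<^sub>R e qk"
      by (rule eqI) (simp add: e_def quat_eq_iff)
    then have "f v = v$a$1 *\<^sub>R f (e q1) + v$a$2 *\<^sub>R f (e qi) + v$a$3 *\<^sub>R f (e qj) + v$a$4 *\<^sub>R f (e qk)"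
      by (metis linear_add[OF lin] linear_scale[OF lin])
    then show ?thesis by (simp add: m_def)
  qed
  have nth: "x \<bullet> q1 = x $ 1" "x \<bullet> qi = x $ 2" "x \<bullet> qj = x $ 3" "x \<bullet> qk = x $ 4"
    "q1 \<bullet> x = x $ 1" "qi \<bullet> x = x $ 2" "qj \<bullet> x = x $ 3" "qk \<bullet> x = x $ 4" for x :: quat
    by (simp_all add: inner_vec_def sum_4)
  have ms: "m q1 $ 1 = l / 2" "m qi $ 2 = l / 2" "m qj $ 3 = l / 2" "m qk $ 4 = l / 2"
    "m qi $ 1 = - m q1 $ 2" "m qj $ 1 = - m q1 $ 3" "m qk $ 1 = - m q1 $ 4"
    "m qj $ 2 = - m qi $ 3" "m qk $ 2 = - m qi $ 4" "m qk $ 3 = - m qj $ 4"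
    using m[of q1 q1] m[of qi qi] m[of qj qj] m[of qk qk] m[of qi q1] m[of qj q1] m[of qk q1]
      m[of qj qi] m[of qk qi] m[of qk qj] by (simp_all add: nth)
  define p :: quat where "p = vector [0, (m q1 $ 2 + m qj $ 4) / 2, (m q1 $ 3 - m qi $ 4) / 2, (m q1 $ 4 + m qi $ 3) / 2]"
  define q :: quat where "q = vector [l / 2, (m q1 $ 2 - m qj $ 4) / 2, (m q1 $ 3 + m qi $ 4) / 2, (m q1 $ 4 - m qi $ 3) / 2]"
  have pq [simp]: "p $ 1 = 0" "p $ 2 = (m q1 $ 2 + m qj $ 4) / 2" "p $ 3 = (m q1 $ 3 - m qi $ 4) / 2"
    "p $ 4 = (m q1 $ 4 + m qi $ 3) / 2" "q $ 1 = l / 2" "q $ 2 = (m q1 $ 2 - m qj $ 4) / 2"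
    "q $ 3 = (m q1 $ 3 + m qi $ 4) / 2" "q $ 4 = (m q1 $ 4 - m qi $ 3) / 2"
    by (simp_all add: p_def q_def vector_def)
  define B :: "quat^'n^'n" where "B = (\<chi> b c. q)"
  have "f v = left_mult p v + right_mult B v" for v
  proof (rule eqI)
    have "f v $ a = p \<star> v $ a + v $ a \<star> q"
      unfolding fm quat_eq_iff by (simp add: ms field_simps)
    then show "f v $ a = (left_mult p v + right_mult B v) $ a"
      by (simp add: left_mult_def right_mult_def B_def a)
  qed
  then have "f = (\<lambda>v. left_mult p v + right_mult B v)" by auto
  then show ?thesis unfolding sp1gl_def using pq(1) by blast
qed

section \<open>Smooth families of forms\<close>

lemma C_k_on_cong:
  assumes "open S" "\<And>x. x \<in> S \<Longrightarrow> f x = g x" "C_k_on k S f"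
  shows "C_k_on k S g"
  using assms(2,3)
proof (induction k arbitrary: f g)
  case 0
  then show ?case using continuous_on_cong by (metis C_k_on.simps(1))
next
  case (Suc k)
  have d: "f differentiable at x" if "x \<in> S" for x using Suc.prems that by simp
  have "g differentiable at x" if x: "x \<in> S" for x
  proof -
    obtain D where "(f has_derivative D) (at x)" using d[OF x] by (auto simp: differentiable_def)
    from has_derivative_transform_within_open[OF this assms(1) x Suc.prems(1)]
    show ?thesis by (auto simp: differentiable_def)
  qed
  moreover have "C_k_on k S (\<lambda>x. frechet_derivative g (at x) v)" for v
  proof (rule Suc.IH)
    show "C_k_on k S (\<lambda>x. frechet_derivative f (at x) v)" using Suc.prems by simp
    show "frechet_derivative f (at x) v = frechet_derivative g (at x) v" if "x \<in> S" for x
      using frechet_derivative_transform_within_open[OF d[OF that] assms(1) that Suc.prems(1)] by simp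
  qed
  ultimately show ?case by simp
qed

lemma C_k_on_const: "C_k_on k S (\<lambda>x. c)"
  by (induction k arbitrary: c) auto

lemma C_k_on_add:
  assumes "open S" "C_k_on k S f" "C_k_on k S g"
  shows "C_k_on k S (\<lambda>x. f x + g x)"
  using assms(2,3)
proof (induction k arbitrary: f g)
  case 0
  then show ?case by (simp add: continuous_on_add)
next
  case (Suc k)
  have d: "((\<lambda>x. f x + g x) has_derivative (\<lambda>v. frechet_derivative f (at x) v + frechet_derivative g (at x) v)) (at x)"
    if "x \<in> S" for x
    using Suc.prems that by (intro has_derivative_add) (simp_all add: frechet_derivative_works)
  have "C_k_on k S (\<lambda>x. frechet_derivative (\<lambda>x. f x + g x) (at x) v)" for v
  proof (rule C_k_on_cong[OF assms(1)])
    show "C_k_on k S (\<lambda>x. frechet_derivative f (at x) v + frechet_derivative g (at x) v)"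
      using Suc by simp
  qed (simp add: frechet_derivative_at[OF d, symmetric])
  then show ?case using d unfolding C_k_on.simps differentiable_def by blast
qed

lemma C_k_on_scaleR:
  assumes "open S" "C_k_on k S f"
  shows "C_k_on k S (\<lambda>x. c *\<^sub>R f x)"
  using assms(2)
proof (induction k arbitrary: f)
  case 0
  then show ?case by (simp add: continuous_on_scaleR)
next
  case (Suc k)
  have d: "((\<lambda>x. c *\<^sub>R f x) has_derivative (\<lambda>v. c *\<^sub>R frechet_derivative f (at x) v)) (at x)"
    if "x \<in> S" for x
    using Suc.prems that by (intro has_derivative_scaleR_right) (simp add: frechet_derivative_works)
  have "C_k_on k S (\<lambda>x. frechet_derivative (\<lambda>x. c *\<^sub>R f x) (at x) v)" for v
  proof (rule C_k_on_cong[OF assms(1)])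
    show "C_k_on k S (\<lambda>x. c *\<^sub>R frechet_derivative f (at x) v)" using Suc by simp
  qed (simp add: frechet_derivative_at[OF d, symmetric])
  then show ?case using d unfolding C_k_on.simps differentiable_def by blast
qed

lemma smooth_on_sum:
  assumes "open S" "\<And>i. i \<in> I \<Longrightarrow> smooth_on S (f i)"
  shows "smooth_on S (\<lambda>x. \<Sum>i\<in>I. f i x)"
  using assms(2)
proof (induction I rule: infinite_finite_induct)
  case (insert i I)
  then show ?case by (simp add: smooth_on_def C_k_on_add[OF assms(1)])
qed (simp_all add: smooth_on_def C_k_on_const)

lemma smooth_on_scaleR: "open S \<Longrightarrow> smooth_on S f \<Longrightarrow> smooth_on S (\<lambda>x. c *\<^sub>R f x)"
  by (simp add: smooth_on_def C_k_on_scaleR)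

lemma smooth_on_frechet_derivative:
  "smooth_on S f \<Longrightarrow> smooth_on S (\<lambda>x. frechet_derivative f (at x) v)"
  unfolding smooth_on_def by (metis C_k_on.simps(2))

lemma smooth_on_has_derivative:
  assumes "smooth_on S f" "x \<in> S"
  shows "(f has_derivative frechet_derivative f (at x)) (at x)"
  using assms unfolding smooth_on_def frechet_derivative_works[symmetric] by (metis C_k_on.simps(2))

lemma has_derivative_unique_open:
  assumes "open V" "x \<in> V" "\<And>y. y \<in> V \<Longrightarrow> f y = g y"
    and "(f has_derivative f') (at x)" "(g has_derivative g') (at x)"
  shows "f' = g'"
  using has_derivative_unique[OF has_derivative_transform_within_open[OF assms(4,1,2,3)] assms(5)] .

text \<open>Identities that are linear in \<open>\<alpha> y\<close> pass to the derivative. Forms are functions on lists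
  here, so the derivative is taken separately for each list of arguments.\<close>

lemma derivative_multilinear_forms:
  assumes V: "open V" "x \<in> V" and \<alpha>: "\<And>y. y \<in> V \<Longrightarrow> \<alpha> y \<in> multilinear_forms k"
    and d: "\<And>vs. ((\<lambda>y. \<alpha> y vs) has_derivative (\<lambda>u. \<alpha>' u vs)) (at x)"
  shows "\<alpha>' u \<in> multilinear_forms k"
proof (rule multilinear_formsI)
  show "\<alpha>' u vs = 0" if "length vs \<noteq> k" for vs
    using has_derivative_unique_open[OF V _ d has_derivative_const, of vs 0] \<alpha> that
    by (simp add: multilinear_forms_def fun_eq_iff)
  fix vs :: "'b list" and i assume *: "length vs = k" "i < k"
  have l: "linear (\<lambda>w. \<alpha> y (vs[i := w]))" if "y \<in> V" for y
    by (rule multilinear_forms_slot[OF \<alpha>[OF that]]) (simp add: *)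
  show "linear (\<lambda>w. \<alpha>' u (vs[i := w]))"
  proof (rule linearI)
    fix a b and t :: real
    have "(\<lambda>u. \<alpha>' u (vs[i := a + b])) = (\<lambda>u. \<alpha>' u (vs[i := a]) + \<alpha>' u (vs[i := b]))"
      by (rule has_derivative_unique_open[OF V _ d has_derivative_add[OF d d]]) (simp add: linear_add[OF l])
    then show "\<alpha>' u (vs[i := a + b]) = \<alpha>' u (vs[i := a]) + \<alpha>' u (vs[i := b])" by (rule fun_cong)
    have "(\<lambda>u. \<alpha>' u (vs[i := t *\<^sub>R a])) = (\<lambda>u. t *\<^sub>R \<alpha>' u (vs[i := a]))"
      by (rule has_derivative_unique_open[OF V _ d has_derivative_scaleR_right[OF d]]) (simp add: linear_scale[OF l])
    then show "\<alpha>' u (vs[i := t *\<^sub>R a]) = t *\<^sub>R \<alpha>' u (vs[i := a])" by (rule fun_cong)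
  qed
qed

lemma derivative_alt_forms:
  assumes V: "open V" "x \<in> V" and \<alpha>: "\<And>y. y \<in> V \<Longrightarrow> \<alpha> y \<in> alt_forms k"
    and d: "\<And>vs. ((\<lambda>y. \<alpha> y vs) has_derivative (\<lambda>u. \<alpha>' u vs)) (at x)"
  shows "\<alpha>' u \<in> alt_forms k"
proof (rule alt_formsI[OF derivative_multilinear_forms[OF V alt_forms_multilinear[OF \<alpha>] d]])
  fix vs :: "'b list" and i j assume "length vs = k" "i < j" "j < k" "vs ! i = vs ! j"
  then have "\<alpha> y vs = 0" if "y \<in> V" for y
    using alt_forms_eq_0[OF \<alpha>[OF that], of i vs j] by auto
  then show "\<alpha>' u vs = 0"
    using has_derivative_unique_open[OF V _ d has_derivative_const, of vs 0] by (simp add: fun_eq_iff)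
qed

lemma derivative_linear:
  assumes "\<And>vs. ((\<lambda>y. \<alpha> y vs) has_derivative (\<lambda>u. \<alpha>' u vs)) (at x)"
  shows "linear \<alpha>'"
  using has_derivative_linear[OF assms]
  by (intro linearI) (auto simp: fun_eq_iff scaleR_fun_def linear_iff)

lemma has_derivative_act:
  assumes "\<And>vs. ((\<lambda>y. \<alpha> y vs) has_derivative (\<lambda>u. \<alpha>' u vs)) (at x)"
  shows "((\<lambda>y. act S (\<alpha> y) vs) has_derivative (\<lambda>u. act S (\<alpha>' u) vs)) (at x)"
  unfolding act_def by (intro has_derivative_minus has_derivative_sum assms)

lemma has_derivative_form_casimir:
  assumes "\<And>vs. ((\<lambda>y. \<alpha> y vs) has_derivative (\<lambda>u. \<alpha>' u vs)) (at x)"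
  shows "((\<lambda>y. form_casimir s (\<alpha> y) vs) has_derivative (\<lambda>u. form_casimir s (\<alpha>' u) vs)) (at x)"
  unfolding form_casimir_def plus_fun_apply
  by (intro has_derivative_add has_derivative_act assms)

text \<open>The Leibniz rule when the arguments of a multilinear form vary as well. Arguments are treated one at
  a time: the expansion of the first one in a basis leaves constant vectors in its slot.\<close>

lemma has_derivative_multilinear_eval:
  fixes \<alpha> :: "'a::real_normed_vector \<Rightarrow> 'b::euclidean_space list \<Rightarrow> real"
  assumes V: "open V" "x \<in> V" and \<alpha>: "\<And>y. y \<in> V \<Longrightarrow> \<alpha> y \<in> multilinear_forms k"
    and d: "\<And>vs. ((\<lambda>y. \<alpha> y vs) has_derivative (\<lambda>u. \<alpha>' u vs)) (at x)"
    and g: "\<And>w. ((\<lambda>y. g y w) has_derivative (\<lambda>u. g' u w)) (at x)"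
  shows "((\<lambda>y. \<alpha> y (map (g y) vs)) has_derivative
    (\<lambda>u. \<alpha>' u (map (g x) vs) + (\<Sum>i<length vs. \<alpha> x ((map (g x) vs)[i := g' u (vs ! i)])))) (at x)"
proof -
  have \<alpha>': "\<alpha>' u \<in> multilinear_forms k" for u by (rule derivative_multilinear_forms[OF V \<alpha> d])
  have expand: "\<beta> (ws @ v # zs) = (\<Sum>b\<in>Basis. (v \<bullet> b) * \<beta> (ws @ b # zs))"
    if "\<beta> \<in> multilinear_forms k" for \<beta> ws v zs
    using linear_eq_sum_Basis[OF multilinear_forms_slot[OF that, of "length ws" "ws @ v # zs"], of v]
    by simp
  have "((\<lambda>y. \<alpha> y (ws @ map (g y) vs)) has_derivative
    (\<lambda>u. \<alpha>' u (ws @ map (g x) vs) + (\<Sum>i<length vs. \<alpha> x (ws @ (map (g x) vs)[i := g' u (vs ! i)])))) (at x)" for ws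
  proof (induction vs arbitrary: ws)
    case Nil
    then show ?case using d by simp
  next
    case (Cons w vs)
    let ?R = "\<lambda>ws u. \<alpha>' u (ws @ map (g x) vs) + (\<Sum>i<length vs. \<alpha> x (ws @ (map (g x) vs)[i := g' u (vs ! i)]))"
    have IH: "((\<lambda>y. \<alpha> y (ws @ b # map (g y) vs)) has_derivative ?R (ws @ [b])) (at x)" for b
      using Cons.IH[of "ws @ [b]"] by simp
    have "((\<lambda>y. \<Sum>b\<in>Basis. (g y w \<bullet> b) * \<alpha> y (ws @ b # map (g y) vs)) has_derivative
        (\<lambda>u. \<Sum>b\<in>Basis. (g x w \<bullet> b) * ?R (ws @ [b]) u + (g' u w \<bullet> b) * \<alpha> x (ws @ b # map (g x) vs))) (at x)"
      by (intro has_derivative_sum has_derivative_mult has_derivative_inner_left g IH)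
    moreover have "(\<Sum>b\<in>Basis. (g x w \<bullet> b) * ?R (ws @ [b]) u + (g' u w \<bullet> b) * \<alpha> x (ws @ b # map (g x) vs)) =
      \<alpha>' u (ws @ map (g x) (w # vs)) +
      (\<Sum>i<length (w # vs). \<alpha> x (ws @ (map (g x) (w # vs))[i := g' u ((w # vs) ! i)]))" for u
    proof -
      have "(\<Sum>b\<in>Basis. (g x w \<bullet> b) * ?R (ws @ [b]) u) =
          (\<Sum>b\<in>Basis. (g x w \<bullet> b) * \<alpha>' u (ws @ b # map (g x) vs)) +
          (\<Sum>b\<in>Basis. \<Sum>i<length vs. (g x w \<bullet> b) * \<alpha> x (ws @ b # (map (g x) vs)[i := g' u (vs ! i)]))"
        by (simp add: distrib_left sum.distrib sum_distrib_left)
      also have "(\<Sum>b\<in>Basis. \<Sum>i<length vs. (g x w \<bullet> b) * \<alpha> x (ws @ b # (map (g x) vs)[i := g' u (vs ! i)])) =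
          (\<Sum>i<length vs. \<Sum>b\<in>Basis. (g x w \<bullet> b) * \<alpha> x (ws @ b # (map (g x) vs)[i := g' u (vs ! i)]))"
        by (rule sum.swap)
      finally have "(\<Sum>b\<in>Basis. (g x w \<bullet> b) * ?R (ws @ [b]) u) =
          \<alpha>' u (ws @ g x w # map (g x) vs) +
          (\<Sum>i<length vs. \<alpha> x (ws @ g x w # (map (g x) vs)[i := g' u (vs ! i)]))"
        unfolding expand[OF \<alpha>', symmetric] expand[OF \<alpha>[OF V(2)], symmetric] .
      then show ?thesis
        unfolding sum.distrib expand[OF \<alpha>[OF V(2)], symmetric]
        by (simp add: sum.lessThan_Suc_shift del: sum.lessThan_Suc)
    qed
    ultimately have "((\<lambda>y. \<Sum>b\<in>Basis. (g y w \<bullet> b) * \<alpha> y (ws @ b # map (g y) vs)) has_derivative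
        (\<lambda>u. \<alpha>' u (ws @ map (g x) (w # vs)) +
      (\<Sum>i<length (w # vs). \<alpha> x (ws @ (map (g x) (w # vs))[i := g' u ((w # vs) ! i)])))) (at x)"
      by simp
    then show ?case
      by (rule has_derivative_transform_within_open[OF _ V]) (simp add: expand[OF \<alpha>, symmetric])
  qed
  from this[of "[]"] show ?thesis by simp
qed

section \<open>Charts\<close>

lemma open_cimage: "smooth_manifold X A \<Longrightarrow> c \<in> A \<Longrightarrow> open (cimage c)"
  by (simp add: smooth_manifold_def)

lemma overlap_facts:
  assumes M: "smooth_manifold X A" and c: "c \<in> A" "c' \<in> A"
  shows "open (overlap c c')" "overlap c c' \<subseteq> cimage c"
    "x \<in> overlap c c' \<Longrightarrow> trans_map c c' x \<in> cimage c'"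
proof -
  have op: "openin X (fst c)" "openin X (fst c')" "open (cimage c)"
    and hom: "homeomorphic_map (subtopology X (fst c)) (top_of_set (cimage c)) (snd c)"
    using M c by (auto simp: smooth_manifold_def)
  have "openin (subtopology X (fst c)) (fst c \<inter> fst c')"
    using op by (simp add: openin_open_subtopology openin_Int)
  then have "openin (top_of_set (cimage c)) (overlap c c')"
    using hom unfolding overlap_def homeomorphic_eq_everything_map open_map_def by blast
  then show "open (overlap c c')" using op(3) openin_open_eq by blast
  show "overlap c c' \<subseteq> cimage c" by (auto simp: overlap_def cimage_def)
  have inj: "inj_on (snd c) (fst c)"
    using hom op(1)[THEN openin_subset]
    by (auto simp: homeomorphic_eq_everything_map topspace_subtopology Int_absorb1)
  assume "x \<in> overlap c c'"
  then obtain m where "m \<in> fst c" "m \<in> fst c'" "x = snd c m" by (auto simp: overlap_def)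
  then show "trans_map c c' x \<in> cimage c'"
    using inj by (simp add: trans_map_def cimage_def inv_into_f_f)
qed

lemma trans_map_has_derivative:
  assumes "smooth_manifold X A" "c \<in> A" "c' \<in> A" "x \<in> overlap c c'"
  shows "(trans_map c c' has_derivative D_trans c c' x) (at x)"
    "((\<lambda>y. D_trans c c' y w) has_derivative (\<lambda>u. frechet_derivative (\<lambda>y. D_trans c c' y w) (at x) u)) (at x)"
proof -
  have "smooth_on (overlap c c') (trans_map c c')" using assms by (simp add: smooth_manifold_def)
  then show "(trans_map c c' has_derivative D_trans c c' x) (at x)"
    "((\<lambda>y. D_trans c c' y w) has_derivative (\<lambda>u. frechet_derivative (\<lambda>y. D_trans c c' y w) (at x) u)) (at x)"
    unfolding D_trans_def
    by (intro smooth_on_has_derivative[OF _ assms(4)] smooth_on_frechet_derivative; assumption)+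
qed

section \<open>The covariant derivative\<close>

text \<open>On vectors the Christoffel endomorphism \<open>\<Gamma> c x u\<close> is added to the derivative; on forms it acts by the
  dual derivation.\<close>

definition covariant_derivative ::
  "('m, 'n::finite) christoffel \<Rightarrow> ('m, 'n) form \<Rightarrow> ('m, 'n) chart \<Rightarrow> quat^'n \<Rightarrow> quat^'n \<Rightarrow> (quat^'n) list \<Rightarrow> real"
  where
  "covariant_derivative \<Gamma> \<alpha> c x u =
    (\<lambda>vs. frechet_derivative (\<lambda>y. \<alpha> c y vs) (at x) u) + act (\<Gamma> c x u) (\<alpha> c x)"

lemma diff_forms_has_derivative:
  assumes "\<alpha> \<in> diff_forms A k" "c \<in> A" "x \<in> cimage c"
  shows "((\<lambda>y. \<alpha> c y vs) has_derivative (\<lambda>u. frechet_derivative (\<lambda>y. \<alpha> c y vs) (at x) u)) (at x)"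
  using assms smooth_on_has_derivative[of "cimage c" "\<lambda>y. \<alpha> c y vs" x] by (simp add: diff_forms_def)

lemma covariant_derivative_alt_forms:
  assumes M: "smooth_manifold X A" and \<Gamma>: "connection A \<Gamma>" and \<alpha>: "\<alpha> \<in> diff_forms A k"
    and c: "c \<in> A" "x \<in> cimage c"
  shows "covariant_derivative \<Gamma> \<alpha> c x u \<in> alt_forms k" "linear (covariant_derivative \<Gamma> \<alpha> c x)"
proof -
  have a: "\<alpha> c y \<in> alt_forms k" if "y \<in> cimage c" for y using \<alpha> c that by (simp add: diff_forms_def)
  have bil: "bilinear (\<Gamma> c x)" using \<Gamma> c by (simp add: connection_def)
  note d = diff_forms_has_derivative[OF \<alpha> c]
  have "(\<lambda>vs. frechet_derivative (\<lambda>y. \<alpha> c y vs) (at x) u) \<in> alt_forms k"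
    by (rule derivative_alt_forms[OF open_cimage[OF M c(1)] c(2) a d])
  then show "covariant_derivative \<Gamma> \<alpha> c x u \<in> alt_forms k"
    unfolding covariant_derivative_def using bil
    by (intro subspace_add subspace_alt_forms act_alt_forms a c) (simp_all add: bilinear_def)
  have "linear (\<lambda>u. act (\<Gamma> c x u) (\<alpha> c x))"
  proof (rule linearI)
    note m = alt_forms_multilinear[OF a[OF c(2)]]
    show "act (\<Gamma> c x (u + v)) (\<alpha> c x) = act (\<Gamma> c x u) (\<alpha> c x) + act (\<Gamma> c x v) (\<alpha> c x)" for u v
    proof -
      have "\<Gamma> c x (u + v) = (\<lambda>w. \<Gamma> c x u w + \<Gamma> c x v w)"
        by (simp add: fun_eq_iff bilinear_ladd[OF bil])
      then show ?thesis by (simp add: act_plus_endo[OF m])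
    qed
    show "act (\<Gamma> c x (t *\<^sub>R u)) (\<alpha> c x) = t *\<^sub>R act (\<Gamma> c x u) (\<alpha> c x)" for u and t :: real
    proof -
      have "\<Gamma> c x (t *\<^sub>R u) = (\<lambda>w. t *\<^sub>R \<Gamma> c x u w)"
        by (simp add: fun_eq_iff bilinear_lmul[OF bil])
      then show ?thesis by (simp add: act_scale_endo[OF m])
    qed
  qed
  from linear_compose_add[OF derivative_linear[of "\<alpha> c", OF d] this]
  show "linear (covariant_derivative \<Gamma> \<alpha> c x)"
    by (simp add: covariant_derivative_def[abs_def])
qed

lemma ext_deriv_eq_alternation:
  assumes \<alpha>: "\<alpha> \<in> diff_forms A k" and \<Gamma>: "torsion_free A \<Gamma>" and c: "c \<in> A" "x \<in> cimage c"
  shows "ext_deriv \<alpha> c x = alternation (covariant_derivative \<Gamma> \<alpha> c x)"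
proof -
  have "alternation (\<lambda>u. act (\<Gamma> c x u) (\<alpha> c x)) = 0"
    by (rule alternation_symmetric_act) (use \<alpha> \<Gamma> c in \<open>auto simp: diff_forms_def torsion_free_def\<close>)
  then have "alternation (covariant_derivative \<Gamma> \<alpha> c x) =
      alternation (\<lambda>u vs. frechet_derivative (\<lambda>y. \<alpha> c y vs) (at x) u)"
    unfolding covariant_derivative_def alternation_add by simp
  then show ?thesis by (simp add: fun_eq_iff ext_deriv_def alternation_def)
qed

text \<open>The second derivatives of the coordinate change that appear when the transformation law of \<open>\<alpha>\<close> is
  differentiated are those in the transformation law of the Christoffel terms. Together with the
  preceding lemma this gives the naturality of \<open>d\<close>; the symmetry of second derivatives
  enters through the symmetry of the Christoffel terms in both charts.\<close>

lemma covariant_derivative_natural: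
  assumes M: "smooth_manifold X A" and \<Gamma>: "connection A \<Gamma>" and \<alpha>: "\<alpha> \<in> diff_forms A k"
    and c: "c \<in> A" "c' \<in> A" and x: "x \<in> overlap c c'"
  shows "covariant_derivative \<Gamma> \<alpha> c x u vs =
    covariant_derivative \<Gamma> \<alpha> c' (trans_map c c' x) (D_trans c c' x u) (map (D_trans c c' x) vs)"
proof -
  note ov = overlap_facts[OF M c]
  define \<tau> D where "\<tau> = trans_map c c'" and "D = D_trans c c'"
  define H where "H u w = frechet_derivative (\<lambda>y. D y w) (at x) u" for u w
  note dt = trans_map_has_derivative[OF M c x, folded \<tau>_def D_def]
  have pull: "\<alpha> c y vs = \<alpha> c' (\<tau> y) (map (D y) vs)" if "y \<in> overlap c c'" for y vs
    using \<alpha> c that by (simp add: diff_forms_def \<tau>_def D_def)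
  have a: "\<alpha> c' (\<tau> y) \<in> multilinear_forms k" if "y \<in> overlap c c'" for y
    using \<alpha> c ov(3)[OF that] by (auto simp: diff_forms_def \<tau>_def intro: alt_forms_multilinear)
  define \<alpha>' where "\<alpha>' u vs = frechet_derivative (\<lambda>y. \<alpha> c' y vs) (at (\<tau> x)) u" for u vs
  have d: "((\<lambda>y. \<alpha> c' (\<tau> y) ws) has_derivative (\<lambda>u. \<alpha>' (D x u) ws)) (at x)" for ws
    using diff_chain_at[OF dt(1) diff_forms_has_derivative[OF \<alpha> c(2) ov(3)[OF x, folded \<tau>_def]]]
    by (simp add: comp_def \<alpha>'_def)
  have "((\<lambda>y. \<alpha> c' (\<tau> y) (map (D y) vs)) has_derivative
      (\<lambda>u. \<alpha>' (D x u) (map (D x) vs) + (\<Sum>i<length vs. \<alpha> c' (\<tau> x) ((map (D x) vs)[i := H u (vs ! i)])))) (at x)"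
    unfolding H_def by (rule has_derivative_multilinear_eval[OF ov(1) x a d dt(2)])
  from has_derivative_unique_open[OF ov(1) x pull diff_forms_has_derivative[OF \<alpha> c(1)] this]
  have 1: "frechet_derivative (\<lambda>y. \<alpha> c y vs) (at x) u = \<alpha>' (D x u) (map (D x) vs) +
      (\<Sum>i<length vs. \<alpha> c' (\<tau> x) ((map (D x) vs)[i := H u (vs ! i)]))"
    using x ov(2) by (auto dest: fun_cong)
  have 2: "act (\<Gamma> c x u) (\<alpha> c x) vs =
      - (\<Sum>i<length vs. \<alpha> c' (\<tau> x) ((map (D x) vs)[i := D x (\<Gamma> c x u (vs ! i))]))"
    by (simp add: act_def pull[OF x] map_update)
  have 3: "act (\<Gamma> c' (\<tau> x) (D x u)) (\<alpha> c' (\<tau> x)) (map (D x) vs) =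
      - (\<Sum>i<length vs. \<alpha> c' (\<tau> x) ((map (D x) vs)[i := \<Gamma> c' (\<tau> x) (D x u) (D x (vs ! i))]))"
    by (simp add: act_def)
  have 4: "D x (\<Gamma> c x u v) = \<Gamma> c' (\<tau> x) (D x u) (D x v) + H u v" for v
    using \<Gamma> c x by (simp add: connection_def \<tau>_def D_def H_def)
  have "\<alpha> c' (\<tau> x) ((map (D x) vs)[i := D x (\<Gamma> c x u (vs ! i))]) =
      \<alpha> c' (\<tau> x) ((map (D x) vs)[i := \<Gamma> c' (\<tau> x) (D x u) (D x (vs ! i))]) +
      \<alpha> c' (\<tau> x) ((map (D x) vs)[i := H u (vs ! i)])" if "i < length vs" for i
    unfolding 4 by (rule linear_add[OF multilinear_forms_slot[OF a[OF x]]]) (simp add: that)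
  then show ?thesis
    unfolding covariant_derivative_def plus_fun_apply \<tau>_def[symmetric] D_def[symmetric] 1 2 3
    by (simp add: sum.distrib \<alpha>'_def)
qed


lemma local_section_has_derivative:
  assumes "local_section P c V s" "y \<in> V"
  shows "((\<lambda>z. s z w) has_derivative (\<lambda>u. frechet_derivative (\<lambda>z. s z w) (at y) u)) (at y)"
  using assms smooth_on_has_derivative[of V "\<lambda>z. s z w" y] by (simp add: local_section_def)

text \<open>The part in \<open>sp(1)\<close> commutes with its own Casimir operator, and the part in \<open>gl(n,H)\<close> commutes with
  \<open>I\<close>, \<open>J\<close> and \<open>K\<close>.\<close>

lemma form_casimir_act_sp1gl:
  fixes \<beta> :: "(quat^'n::finite) list \<Rightarrow> real"
  assumes \<beta>: "\<beta> \<in> alt_forms k" and \<omega>: "\<omega> \<in> sp1gl"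
  shows "form_casimir id (act \<omega> \<beta>) = act \<omega> (form_casimir id \<beta>)"
proof -
  interpret frame "id :: quat^'n \<Rightarrow> quat^'n" by (rule frame.intro) (auto simp: linear_iff)
  have acs: "acs id q = left_mult q" for q :: quat by (simp add: acs_def)
  note casimir_add = linear_add[OF linear_form_casimir]
    and casimir_scale = linear_scale[OF linear_form_casimir]
  obtain p B where p: "p $ 1 = 0" and \<omega>: "\<omega> = (\<lambda>v. left_mult p v + right_mult B v)"
    using \<omega> by (auto simp: sp1gl_def)
  have in_alt: "form_casimir id \<gamma> \<in> alt_forms k" if "\<gamma> \<in> alt_forms k" for \<gamma> :: "(quat^'n) list \<Rightarrow> real"
    unfolding form_casimir_def
    by (intro subspace_add subspace_alt_forms act_alt_forms linear_acs that)
  have act\<omega>: "act \<omega> \<gamma> = p$2 *\<^sub>R act (acs id qi) \<gamma> + p$3 *\<^sub>R act (acs id qj) \<gamma> + p$4 *\<^sub>R act (acs id qk) \<gamma>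
      + act (right_mult B) \<gamma>" if "\<gamma> \<in> alt_forms k" for \<gamma>
    unfolding \<omega> act_plus_endo[OF alt_forms_multilinear[OF that]]
    using act_acs_imaginary[OF alt_forms_multilinear[OF that] p] by (simp add: acs)
  have R: "act (acs id q) (act (right_mult B) \<gamma>) = act (right_mult B) (act (acs id q) \<gamma>)"
    if "\<gamma> \<in> alt_forms k" for \<gamma> q
  proof -
    have "act (\<lambda>v::quat^'n. 0) \<gamma> = 0"
      using act_scale_endo[OF alt_forms_multilinear[OF that], of 0 "\<lambda>v. v"] by simp
    then show ?thesis
      using act_commutator[OF alt_forms_multilinear[OF that], of "acs id q" "right_mult B"]
      by (simp add: acs left_mult_right_mult)
  qed
  have "form_casimir id (act (right_mult B) \<beta>) = act (right_mult B) (form_casimir id \<beta>)"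
    unfolding form_casimir_def
    by (simp add: R \<beta> act_alt_forms linear_acs act_add)
  then show ?thesis
    unfolding act\<omega>[OF \<beta>] act\<omega>[OF in_alt[OF \<beta>]] casimir_add casimir_scale
    by (simp add: form_casimir_commute[OF \<beta>])
qed

text \<open>In a local frame \<open>s\<close> the Casimir operator has constant coefficients, so the pulled back form and its
  derivative \<open>\<beta>'\<close> satisfy the same eigenvalue equation. The covariant derivative differs from \<open>\<beta>'\<close> by the action of the
  connection form \<open>\<omega>\<close>, which lies in \<open>sp(1) + gl(n,H)\<close> and so commutes with the Casimir operator.\<close>

lemma covariant_derivative_casimir:
  assumes M: "smooth_manifold X A" and P: "Sp1GL_structure A P" and \<Gamma>: "connection_on A P \<Gamma>"
    and \<alpha>: "\<alpha> \<in> diff_forms A k" and c: "c \<in> A"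
    and eig: "\<And>y s. y \<in> cimage c \<Longrightarrow> s \<in> P c y \<Longrightarrow> form_casimir s (\<alpha> c y) = t *\<^sub>R \<alpha> c y"
    and s: "local_section P c V s" and x: "x \<in> V"
  shows "form_casimir (s x) (covariant_derivative \<Gamma> \<alpha> c x u) = t *\<^sub>R covariant_derivative \<Gamma> \<alpha> c x u"
proof -
  have V: "open V" "V \<subseteq> cimage c" and sP: "\<And>y. y \<in> V \<Longrightarrow> s y \<in> P c y"
    using s by (auto simp: local_section_def)
  have fr: "linear (s y)" "bij (s y)" if "y \<in> V" for y
    using P c V that sP[OF that] by (auto simp: Sp1GL_structure_def)
  have a: "\<alpha> c y \<in> alt_forms k" if "y \<in> V" for y
    using \<alpha> c V that by (auto simp: diff_forms_def)
  note am = alt_forms_multilinear[OF a]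
  have xc: "x \<in> cimage c" using V x by auto
  have casimir_pullback: "pullback (s y) (form_casimir (s y) \<beta>) = form_casimir id (pullback (s y) \<beta>)"
    if "y \<in> V" for y \<beta>
  proof -
    interpret frame "s y" using fr[OF that] by (rule frame.intro)
    have "pullback (s y) (act (acs (s y) q) \<gamma>) = act (acs id q) (pullback (s y) \<gamma>)" for q \<gamma>
      by (rule pullback_act) (simp add: acs_def)
    then show ?thesis unfolding form_casimir_def linear_add[OF linear_pullback] by simp
  qed
  define \<alpha>' where "\<alpha>' u vs = frechet_derivative (\<lambda>y. \<alpha> c y vs) (at x) u" for u vs
  define s' where "s' u w = frechet_derivative (\<lambda>z. s z w) (at x) u" for u w
  define \<beta> where "\<beta> y = pullback (s y) (\<alpha> c y)" for y
  define \<beta>' where "\<beta>' u vs = \<alpha>' u (map (s x) vs) +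
    (\<Sum>i<length vs. \<alpha> c x ((map (s x) vs)[i := s' u (vs ! i)]))" for u vs
  have d: "((\<lambda>y. \<beta> y vs) has_derivative (\<lambda>u. \<beta>' u vs)) (at x)" for vs
    unfolding \<beta>_def pullback_def \<beta>'_def \<alpha>'_def s'_def
    by (rule has_derivative_multilinear_eval[OF V(1) x am diff_forms_has_derivative[OF \<alpha> c xc]
      local_section_has_derivative[OF s x]])
  have \<beta>: "\<beta> y \<in> alt_forms k" "form_casimir id (\<beta> y) = t *\<^sub>R \<beta> y" if "y \<in> V" for y
  proof -
    show "\<beta> y \<in> alt_forms k" unfolding \<beta>_def by (rule pullback_alt_forms[OF fr(1)[OF that] a[OF that]])
    have "y \<in> cimage c" using V that by auto
    show "form_casimir id (\<beta> y) = t *\<^sub>R \<beta> y"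
      unfolding \<beta>_def casimir_pullback[OF that, symmetric] eig[OF \<open>y \<in> cimage c\<close> sP[OF that]]
      by (rule linear_scale[OF linear_pullback])
  qed
  have \<beta>': "form_casimir id (\<beta>' u) = t *\<^sub>R \<beta>' u"
  proof
    fix vs
    have "(\<lambda>u. form_casimir id (\<beta>' u) vs) = (\<lambda>u. t *\<^sub>R \<beta>' u vs)"
      by (rule has_derivative_unique_open[OF V(1) x _ has_derivative_form_casimir[OF d]
          has_derivative_scaleR_right[OF d]]) (simp add: \<beta> scaleR_fun_def)
    then show "form_casimir id (\<beta>' u) vs = (t *\<^sub>R \<beta>' u) vs"
      by (auto dest: fun_cong simp: scaleR_fun_def)
  qed
  interpret frame "s x" using fr[OF x] by (rule frame.intro)
  define \<omega> where "\<omega> w = inv (s x) (s' u w + \<Gamma> c x u (s x w))" for w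
  have \<omega>: "\<omega> \<in> sp1gl"
    using \<Gamma> c s x unfolding connection_on_def \<omega>_def[abs_def] s'_def by blast
  have s\<omega>: "s x (\<omega> w) = s' u w + \<Gamma> c x u (s x w)" for w by (simp add: \<omega>_def)
  have pull: "pullback (s x) (covariant_derivative \<Gamma> \<alpha> c x u) = \<beta>' u + act \<omega> (\<beta> x)"
  proof
    fix vs
    have "\<alpha> c x ((map (s x) vs)[i := s x (\<omega> (vs ! i))]) = \<alpha> c x ((map (s x) vs)[i := s' u (vs ! i)])
        + \<alpha> c x ((map (s x) vs)[i := \<Gamma> c x u (s x (vs ! i))])" if "i < length vs" for i
      unfolding s\<omega> by (rule linear_add[OF multilinear_forms_slot[OF am[OF x]]]) (simp add: that)
    then show "pullback (s x) (covariant_derivative \<Gamma> \<alpha> c x u) vs = (\<beta>' u + act \<omega> (\<beta> x)) vs"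
      by (simp add: pullback_def covariant_derivative_def \<beta>'_def \<alpha>'_def act_def \<beta>_def map_update sum.distrib)
  qed
  interpret idf: frame "id :: quat^'b \<Rightarrow> quat^'b" by (rule frame.intro) (auto simp: linear_iff)
  have "pullback (s x) (form_casimir (s x) (covariant_derivative \<Gamma> \<alpha> c x u)) =
      form_casimir id (\<beta>' u) + act \<omega> (form_casimir id (\<beta> x))"
    unfolding casimir_pullback[OF x] pull linear_add[OF idf.linear_form_casimir]
      form_casimir_act_sp1gl[OF \<beta>(1)[OF x] \<omega>] ..
  also have "\<dots> = pullback (s x) (t *\<^sub>R covariant_derivative \<Gamma> \<alpha> c x u)"
    unfolding linear_scale[OF linear_pullback] pull \<beta>' \<beta>(2)[OF x] act_scaleR scaleR_add_right ..
  finally show ?thesis using pullback_inj[OF bij_is_surj[OF bij_s]] by blast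
qed

section \<open>Torsion-free connections\<close>

text \<open>Differentiating \<open>g(s a, s b) = l (a \<bullet> b)\<close> along a local section \<open>s\<close> shows that the connection form
  \<open>\<omega> = s\<^sup>-\<^sup>1 \<nabla>s\<close> is an infinitesimal conformal map of \<open>H\<close>. The metric is
  regarded as a family of multilinear forms \<open>G\<close> on lists of length two, so that the Leibniz rule above
  applies.\<close>

lemma levi_civita_connection_on:
  fixes A :: "('m, 'n::finite) chart set"
  assumes n: "CARD('n) = 1" and M: "smooth_manifold X A" and P: "Sp1GL_structure A P"
    and g: "riemannian_metric A g" and \<Gamma>: "levi_civita A g \<Gamma>"
    and conf: "\<And>c x s. c \<in> A \<Longrightarrow> x \<in> cimage c \<Longrightarrow> s \<in> P c x \<Longrightarrow>
      \<exists>l>0. \<forall>u v. g c x (s u) (s v) = l * (u \<bullet> v)"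
  shows "connection_on A P \<Gamma>"
  unfolding connection_on_def
proof (intro conjI ballI allI impI)
  show "connection A \<Gamma>" using \<Gamma> by (simp add: levi_civita_def)
next
  fix c V s x u assume c: "c \<in> A" and s: "local_section P c V s" and x: "x \<in> V"
  have V: "open V" "V \<subseteq> cimage c" and sP: "\<And>y. y \<in> V \<Longrightarrow> s y \<in> P c y"
    using s by (auto simp: local_section_def)
  have xc: "x \<in> cimage c" using V x by auto
  have lin_s: "linear (s y)" and bij_s: "bij (s y)" if "y \<in> V" for y
    using P c V that sP[OF that] by (auto simp: Sp1GL_structure_def)
  interpret frame "s x" by (rule frame.intro[OF lin_s[OF x] bij_s[OF x]])
  have bil: "bilinear (g c y)" if "y \<in> cimage c" for y using g c that by (simp add: riemannian_metric_def)
  define G where "G y vs = (if length vs = 2 then g c y (vs ! 0) (vs ! 1) else 0)" for y vs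
  define G' where "G' h vs = frechet_derivative (\<lambda>y. G y vs) (at x) h" for h vs
  define s' where "s' h w = frechet_derivative (\<lambda>z. s z w) (at x) h" for h w
  note ds = local_section_has_derivative[OF s x, folded s'_def]
  have G2: "G y [v, w] = g c y v w" for y v w by (simp add: G_def)
  have Gm: "G y \<in> multilinear_forms 2" if "y \<in> V" for y
  proof (rule multilinear_formsI)
    have b: "bilinear (g c y)" using bil V that by blast
    fix vs :: "(quat^'n) list" and i :: nat assume *: "length vs = 2" "i < 2"
    then have "i = 0 \<or> i = 1" by auto
    then show "linear (\<lambda>u. G y (vs[i := u]))"
      using * b by (auto simp: G_def bilinear_def)
  qed (simp add: G_def)
  have dG: "((\<lambda>y. G y vs) has_derivative (\<lambda>h. G' h vs)) (at x)" for vs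
  proof (cases "length vs = 2")
    case True
    have "smooth_on (cimage c) (\<lambda>y. g c y (vs ! 0) (vs ! 1))" using g c by (simp add: riemannian_metric_def)
    from smooth_on_has_derivative[OF this xc] show ?thesis by (simp add: G_def G'_def True)
  next
    case False
    then show ?thesis by (simp add: G_def G'_def)
  qed
  have LC: "G' u [v, w] = g c x (\<Gamma> c x u v) w + g c x v (\<Gamma> c x u w)" for v w
    using \<Gamma> c xc by (simp add: levi_civita_def G'_def G2)
  have deriv: "((\<lambda>y. G y (map (s y) [a, b])) has_derivative
      (\<lambda>h. G' h [s x a, s x b] + (g c x (s' h a) (s x b) + g c x (s x a) (s' h b)))) (at x)" for a b
    using has_derivative_multilinear_eval[OF V(1) x Gm dG ds, where vs="[a, b]"]
    by (simp add: G2 numeral_2_eq_2)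
  define \<omega> where "\<omega> w = inv (s x) (s' u w + \<Gamma> c x u (s x w))" for w
  have s\<omega>: "s x (\<omega> w) = s' u w + \<Gamma> c x u (s x w)" for w by (simp add: \<omega>_def)
  obtain l0 where l0: "l0 > 0" "\<And>v w. g c x (s x v) (s x w) = l0 * (v \<bullet> w)"
    using conf[OF c xc sP[OF x]] by blast
  define e where "e = (\<chi> a::'n. q1)"
  have e: "e \<noteq> 0" by (auto simp: e_def vec_eq_iff[where 'a=quat] quat_eq_iff)
  have metric: "G y (map (s y) [a, b]) = G y (map (s y) [e, e]) * ((a \<bullet> b) / (e \<bullet> e))" if y: "y \<in> V" for y a b
  proof -
    have "y \<in> cimage c" using V y by auto
    then obtain l where "\<And>v w. g c y (s y v) (s y w) = l * (v \<bullet> w)"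
      using conf[OF c _ sP[OF y]] by blast
    then show ?thesis using e by (simp add: G2)
  qed
  define l where "l = (G' u [s x e, s x e] + (g c x (s' u e) (s x e) + g c x (s x e) (s' u e))) / (e \<bullet> e)"
  have "\<omega> a \<bullet> b + a \<bullet> \<omega> b = l / l0 * (a \<bullet> b)" for a b
  proof -
    from has_derivative_unique_open[OF V(1) x metric deriv has_derivative_mult_left[OF deriv]]
    have "G' u [s x a, s x b] + (g c x (s' u a) (s x b) + g c x (s x a) (s' u b)) = l * (a \<bullet> b)"
      by (auto dest!: fun_cong[of _ _ u] simp: l_def)
    then have "g c x (s x (\<omega> a)) (s x b) + g c x (s x a) (s x (\<omega> b)) = l * (a \<bullet> b)"
      unfolding s\<omega> LC bilinear_ladd[OF bil[OF xc]] bilinear_radd[OF bil[OF xc]] by simp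
    then show ?thesis using l0 by (simp add: field_simps)
  qed
  moreover have "linear \<omega>"
  proof -
    have "linear (s' u)"
    proof (rule linearI)
      fix v w and t :: real
      have "(\<lambda>h. s' h (v + w)) = (\<lambda>h. s' h v + s' h w)"
        by (rule has_derivative_unique_open[OF V(1) x _ ds has_derivative_add[OF ds ds]])
          (simp add: linear_add[OF lin_s])
      then show "s' u (v + w) = s' u v + s' u w" by (rule fun_cong)
      have "(\<lambda>h. s' h (t *\<^sub>R w)) = (\<lambda>h. t *\<^sub>R s' h w)"
        by (rule has_derivative_unique_open[OF V(1) x _ ds has_derivative_scaleR_right[OF ds]])
          (simp add: linear_scale[OF lin_s])
      then show "s' u (t *\<^sub>R w) = t *\<^sub>R s' u w" by (rule fun_cong)
    qed
    moreover have "linear (\<lambda>w. \<Gamma> c x u (s x w))"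
    proof -
      have "linear (\<Gamma> c x u)" using \<Gamma> c xc by (simp add: levi_civita_def connection_def bilinear_def)
      from linear_compose[OF linear_s this] show ?thesis by (simp add: comp_def)
    qed
    ultimately have "linear (\<lambda>w. s' u w + \<Gamma> c x u (s x w))" by (rule linear_compose_add)
    from linear_compose[OF this linear_inv_s] show ?thesis by (simp add: comp_def \<omega>_def[abs_def])
  qed
  ultimately have "\<omega> \<in> sp1gl" by (intro conformal_endomorphism_in_sp1gl[OF n])
  then show "(\<lambda>w. inv (s x) (frechet_derivative (\<lambda>z. s z w) (at x) u + \<Gamma> c x u (s x w))) \<in> sp1gl"
    by (simp add: \<omega>_def[abs_def] s'_def)
qed

lemma quaternionic_manifold_connection:
  fixes A :: "('m, 'n::finite) chart set"
  assumes "quaternionic_manifold X A P"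
  obtains \<Gamma> where "connection_on A P \<Gamma>" "torsion_free A \<Gamma>"
proof (cases "CARD('n) = 1")
  case True
  then have "self_dual_conformal A P" and M: "smooth_manifold X A" "Sp1GL_structure A P"
    using assms by (simp_all add: quaternionic_manifold_def)
  then obtain g \<Gamma> where g: "riemannian_metric A g" "levi_civita A g \<Gamma>"
    and conf: "\<forall>c\<in>A. \<forall>x\<in>cimage c. \<forall>s\<in>P c x. \<exists>l>0. \<forall>u v. g c x (s u) (s v) = l * (u \<bullet> v)"
    unfolding self_dual_conformal_def by blast
  have "connection_on A P \<Gamma>"
    by (rule levi_civita_connection_on[OF True M g]) (use conf in blast)
  then show ?thesis using that g(2) by (simp add: levi_civita_def)
next
  case False
  then show ?thesis using assms that by (auto simp: quaternionic_manifold_def)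
qed

section \<open>The exterior derivative\<close>

lemma ext_deriv_diff_forms:
  assumes M: "smooth_manifold X A" and \<Gamma>: "connection A \<Gamma>" "torsion_free A \<Gamma>" and \<alpha>: "\<alpha> \<in> diff_forms A k"
  shows "ext_deriv \<alpha> \<in> diff_forms A (Suc k)"
  unfolding diff_forms_def
proof (intro CollectI conjI ballI allI)
  fix c x assume c: "c \<in> A" "x \<in> cimage c"
  show "ext_deriv \<alpha> c x \<in> alt_forms (Suc k)"
    unfolding ext_deriv_eq_alternation[OF \<alpha> \<Gamma>(2) c]
    by (rule alternation_alt_forms) (rule covariant_derivative_alt_forms[OF M \<Gamma>(1) \<alpha> c])+
next
  fix c vs assume c: "c \<in> A"
  have "smooth_on (cimage c) (\<lambda>y. \<alpha> c y ws)" for ws using \<alpha> c by (simp add: diff_forms_def)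
  then have "smooth_on (cimage c) (\<lambda>x. (-1)^i *\<^sub>R
      frechet_derivative (\<lambda>y. \<alpha> c y (omit i vs)) (at x) (vs ! i))" for i
    by (intro smooth_on_scaleR open_cimage[OF M c] smooth_on_frechet_derivative)
  then show "smooth_on (cimage c) (\<lambda>x. ext_deriv \<alpha> c x vs)"
    unfolding ext_deriv_def by (intro smooth_on_sum open_cimage[OF M c]) simp
next
  fix c c' x vs assume c: "c \<in> A" "c' \<in> A" and x: "x \<in> overlap c c'"
  note ov = overlap_facts[OF M c]
  have xc: "x \<in> cimage c" using ov(2) x by auto
  show "ext_deriv \<alpha> c x vs = ext_deriv \<alpha> c' (trans_map c c' x) (map (D_trans c c' x) vs)"
    unfolding ext_deriv_eq_alternation[OF \<alpha> \<Gamma>(2) c(1) xc] ext_deriv_eq_alternation[OF \<alpha> \<Gamma>(2) c(2) ov(3)[OF x]]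
      alternation_def length_map
  proof (intro sum.cong refl)
    fix i assume "i \<in> {..<length vs}"
    then show "(- 1) ^ i * covariant_derivative \<Gamma> \<alpha> c x (vs ! i) (omit i vs) =
      (- 1) ^ i * covariant_derivative \<Gamma> \<alpha> c' (trans_map c c' x) (map (D_trans c c' x) vs ! i)
        (omit i (map (D_trans c c' x) vs))"
      using covariant_derivative_natural[OF M \<Gamma>(1) \<alpha> c x, of "vs ! i" "omit i vs"]
      by (simp add: take_map drop_map)
  qed
qed

theorem theorem4p3:
  fixes X :: "'m topology" and A :: "('m, 'n::finite) chart set" and P :: "('m, 'n) frames"
    and k r :: nat
  assumes "quaternionic_manifold X A P"
  shows "ext_deriv \<in> smooth_sections A k (E P k (int r)) \<rightarrow>
    smooth_sections A (k + 1) (E P (k + 1) (int r + 1) \<oplus> E P (k + 1) (int r - 1))"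
proof
  fix \<alpha> assume "\<alpha> \<in> smooth_sections A k (E P k (int r))"
  then have \<alpha>: "\<alpha> \<in> diff_forms A k" and \<alpha>E: "\<And>c x. c \<in> A \<Longrightarrow> x \<in> cimage c \<Longrightarrow> \<alpha> c x \<in> E P k (int r) c x"
    by (auto simp: smooth_sections_def)
  have M: "smooth_manifold X A" and P: "Sp1GL_structure A P"
    using assms by (auto simp: quaternionic_manifold_def)
  obtain \<Gamma> where \<Gamma>: "connection_on A P \<Gamma>" "torsion_free A \<Gamma>"
    by (rule quaternionic_manifold_connection[OF assms])
  then have conn: "connection A \<Gamma>" by (simp add: connection_on_def)
  show "ext_deriv \<alpha> \<in> smooth_sections A (k + 1) (E P (k + 1) (int r + 1) \<oplus> E P (k + 1) (int r - 1))"
    unfolding smooth_sections_def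
  proof (intro CollectI conjI ballI)
    show "ext_deriv \<alpha> \<in> diff_forms A (k + 1)"
      using ext_deriv_diff_forms[OF M conn \<Gamma>(2) \<alpha>] by simp
    fix c x assume c: "c \<in> A" "x \<in> cimage c"
    obtain V s where xV: "x \<in> V" and s: "local_section P c V s"
      using P c unfolding Sp1GL_structure_def by blast
    have sP: "s x \<in> P c x" using s xV by (simp add: local_section_def)
    interpret frame "s x" using P c sP by (intro frame.intro) (auto simp: Sp1GL_structure_def)
    let ?t = "of_int (int r * (int r + 2)) :: real"
    have eig: "form_casimir s' (\<alpha> c y) = (- ?t) *\<^sub>R \<alpha> c y" if "y \<in> cimage c" "s' \<in> P c y" for y s'
      using \<alpha>E[OF c(1) that(1)] unfolding E_eq_casimir_eigenspace[OF P c(1) that of_nat_0_le_iff] by simp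
    note cov = covariant_derivative_alt_forms[OF M conn \<alpha> c]
    have cov_eig: "form_casimir (s x) (covariant_derivative \<Gamma> \<alpha> c x u) =
        - (?t *\<^sub>R covariant_derivative \<Gamma> \<alpha> c x u)" for u
      using covariant_derivative_casimir[OF M P \<Gamma>(1) \<alpha> c(1) eig s xV] by simp
    obtain \<theta> \<eta> where \<theta>: "\<theta> \<in> alt_forms (Suc k)" "form_casimir (s x) \<theta> = - (of_int ((int r + 1) * (int r + 3)) *\<^sub>R \<theta>)"
      and \<eta>: "\<eta> \<in> alt_forms (Suc k)" "form_casimir (s x) \<eta> = - (of_int ((int r - 1) * (int r + 1)) *\<^sub>R \<eta>)"
      and sum: "ext_deriv \<alpha> c x = \<theta> + \<eta>"
      using alternation_isotypic[OF cov(2) cov(1) cov_eig of_nat_0_le_iff]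
      unfolding ext_deriv_eq_alternation[OF \<alpha> \<Gamma>(2) c] by blast
    have "\<theta> \<in> E P (k + 1) (int r + 1) c x"
      using \<theta> by (subst E_eq_casimir_eigenspace[OF P c sP]) (auto simp: algebra_simps)
    moreover have "\<eta> \<in> E P (k + 1) (int r - 1) c x"
    \<comment> \<open>For \<open>r = 0\<close> the Casimir eigenvalue of \<open>\<eta>\<close> is \<open>1\<close>, but the Casimir operator is nonpositive.\<close>
    proof (cases "r = 0")
      case True
      then have "\<eta> = 0" using \<eta> by (intro form_casimir_nonpos[of _ "Suc k" 1]) auto
      then show ?thesis by (simp add: E_def span_0)
    next
      case False
      then show ?thesis
        using \<eta> by (subst E_eq_casimir_eigenspace[OF P c sP]) (auto simp: algebra_simps)
    qed
    ultimately show "ext_deriv \<alpha> c x \<in> (E P (k + 1) (int r + 1) \<oplus> E P (k + 1) (int r - 1)) c x"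
      unfolding fibre_sum_def sum by blast
  qed
qed

end
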